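(* Let $\mathbb K$ be an algebraically closed field of characteristic $0$, let $\Pi$ be a connected Dynkin diagram (of an irreducible reduced root system), and let $W_\Delta$ be the Weyl group of the root system $\Delta$ of type $\mathrm{BC}_2$. Suppose that $(S,T)\in\mathrm{SPA}(\Pi)$. Then for every $u\in W_\Delta$ the $u$-image ${}^{u}\mathfrak P(S,T)$ of the SP-graded Kantor pair $\mathfrak P(S,T)$ is graded-isomorphic to $\mathfrak P(u*(S,T))$.
   Context: Kantor pairs. A trilinear pair is a pair $P=(P^-,P^+)$ of vector spaces with trilinear products $\{\,,\,,\,\}^\sigma:P^\sigma\times P^{-\sigma}\times P^\sigma\to P^\sigma$, $\sigma=\pm$. With $D^\sigma(x,y)u=\{x,y,u\}^\sigma$ and $K^\sigma(x,z)w=\{x,w,z\}^\sigma-\{z,w,x\}^\sigma$, $P$ is a Kantor pair if $[D^\sigma(x,y),D^\sigma(z,w)]=D^\sigma(D^\sigma(x,y)z,w)-D^\sigma(z,D^{-\sigma}(y,x)w)$ and $K^\sigma(x,z)D^{-\sigma}(w,u)+D^\sigma(u,w)K^\sigma(x,z)=K^\sigma(K^\sigma(x,z)w,u)$ for $x,z,u\in P^\sigma$, $y,w\in P^{-\sigma}$. An SP-grading of a Kantor pair is a decomposition $P^\sigma=P_0^\sigma\oplus P_1^\sigma$, $\sigma=\pm$, such that (with $P_i^\sigma=0$ for $i\neq0,1$) $\{P_i^\sigma,P_j^{-\sigma},P_k^\sigma\}^\sigma\subseteq P^\sigma_{i-j+k}$. Graded-isomorphisms are pairs of linear bijections preserving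 products and the components $P_i^\sigma$. $\mathrm{BC}_2$-gradings and Weyl images. $\Delta=\{\pm\alpha_1,\pm\alpha_2,\pm(\alpha_1+\alpha_2),\pm2\alpha_1,\pm(2\alpha_1+\alpha_2),\pm(2\alpha_1+2\alpha_2)\}$ with base $\{\alpha_1,\alpha_2\}$; its root lattice $Q_\Delta$ is identified with $\mathbb Z^2$ via this base. A $\mathrm{BC}_2$-graded Lie algebra is a $\mathbb Z^2$-graded Lie algebra $L$ with support in $\Delta\cup\{0\}$. Such an $L$ envelops the SP-graded Kantor pair $P$ with $P_i^\sigma=L_{(\sigma1,\sigma i)}$, $i=0,1$, and products $\{x,y,z\}^\sigma=[[x,y],z]$; every SP-graded Kantor pair arises this way. For $u\in W_\Delta$, ${}^uL$ is the Lie algebra $L$ with grading $({}^uL)_\alpha=L_{u^{-1}\alpha}$. For an SP-graded Kantor pair $P$, the $u$-image ${}^uP$ is the SP-graded Kantor pair enveloped by ${}^uL$, where $L$ is any $\mathrm{BC}_2$-graded Lie algebra that envelops $P$ (the result is independent of $L$). Dynkin diagram data. Let $\mathcal G$ be a finite dimensional simple Lie algebra over $\mathbb K$ with Cartan subalgebra $\mathcal H$ and root system $\Sigma$, a base of which is identified with $\Pi$. $Q_\Sigma$ is the root lattice and $W_\Sigma$ the Weyl group. For $S\subseteq\Pi$, $\chi_S\in\mathrm{Hom}(Q_\Sigma,\mathbb Z)$ is $1$ on $S$ and $0$ on $\Pi\setminus S$; $\chi_{(S,T)}=(\chi_S,\chi_T)\in \mathrm{Hom}(Q_\Sigma,\mathbb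 Z^2)$. $\mathrm{SPA}(\Pi)$ is the set of pairs $(S,T)$ of subsets of $\Pi$ such that $\chi_{(S,T)}(\Sigma)\subseteq\Delta\cup\{0\}$ and $\chi_{(S,T)}(\Sigma)$ contains one of $\pm\alpha_1,\pm(\alpha_1+\alpha_2)$. For $(S,T)\in\mathrm{SPA}(\Pi)$, $\mathfrak P(S,T)$ is the SP-graded Kantor pair $P$ with $P_i^\sigma=\sum_{\mu\in\Sigma,\ \chi_S(\mu)=\sigma1,\ \chi_T(\mu)=\sigma i}\mathcal G_\mu$ ($i=0,1$) and products $\{x,y,z\}^\sigma=[[x,y],z]$ in $\mathcal G$. The action $*$. For $u\in W_\Delta$ and $(S,T)\in\mathrm{SPA}(\Pi)$, the set $\{u\circ\chi_{(S,T)}\circ w:w\in W_\Sigma\}$ contains exactly one element $\rho$ that is positive, i.e. such that $\rho(\Pi)\subseteq\Delta^+\cup\{0\}$; this $\rho$ equals $\chi_{(S',T')}$ for a unique $(S',T')\in\mathrm{SPA}(\Pi)$, and $u*(S,T):=(S',T')$. This defines a left action of $W_\Delta$ on $\mathrm{SPA}(\Pi)$. *)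

theory Defs
  imports
    "HOL-Computational_Algebra.Polynomial"
    "HOL-Library.Function_Algebras"
    "HOL-Library.Product_Plus"
begin

section \<open>Kantor pairs\<close>

datatype sign = Neg | Pos

fun sg :: "sign \<Rightarrow> int" where
  "sg Neg = - 1"
| "sg Pos = 1"

fun opp :: "sign \<Rightarrow> sign" where
  "opp Neg = Pos"
| "opp Pos = Neg"

text \<open>
  Both spaces of a pair live as subspaces in one ambient vector space, whose scalar
  multiplication is a separate argument \<open>s\<close>. The products are only meaningful on these subspaces.
\<close>

record 'v tri_pair =
  pspace :: "sign \<Rightarrow> 'v set"
  triple :: "sign \<Rightarrow> 'v \<Rightarrow> 'v \<Rightarrow> 'v \<Rightarrow> 'v"

record 'v graded_pair = "'v tri_pair" +
  pcomp :: "sign \<Rightarrow> int \<Rightarrow> 'v set"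

definition lin_on ::
    "('k \<Rightarrow> 'v \<Rightarrow> 'v) \<Rightarrow> ('k \<Rightarrow> 'w \<Rightarrow> 'w) \<Rightarrow> 'v::ab_group_add set \<Rightarrow> ('v \<Rightarrow> 'w::ab_group_add) \<Rightarrow> bool"
  where "lin_on s t V f \<longleftrightarrow>
    (\<forall>x\<in>V. \<forall>y\<in>V. f (x + y) = f x + f y) \<and> (\<forall>c. \<forall>x\<in>V. f (s c x) = t c (f x))"

definition trilinear_pair ::
    "('k::field \<Rightarrow> 'v \<Rightarrow> 'v) \<Rightarrow> ('v::ab_group_add, 'm) tri_pair_scheme \<Rightarrow> bool"
  where "trilinear_pair s P \<longleftrightarrow>
    vector_space s \<and>
    (\<forall>\<sigma>. module.subspace s (pspace P \<sigma>)) \<and>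
    (\<forall>\<sigma>. \<forall>x\<in>pspace P \<sigma>. \<forall>y\<in>pspace P (opp \<sigma>). \<forall>z\<in>pspace P \<sigma>.
      triple P \<sigma> x y z \<in> pspace P \<sigma> \<and>
      lin_on s s (pspace P \<sigma>) (\<lambda>x'. triple P \<sigma> x' y z) \<and>
      lin_on s s (pspace P (opp \<sigma>)) (\<lambda>y'. triple P \<sigma> x y' z) \<and>
      lin_on s s (pspace P \<sigma>) (\<lambda>z'. triple P \<sigma> x y z'))"

definition D_op :: "('v, 'm) tri_pair_scheme \<Rightarrow> sign \<Rightarrow> 'v \<Rightarrow> 'v \<Rightarrow> 'v \<Rightarrow> 'v"
  where "D_op P \<sigma> x y = (\<lambda>u. triple P \<sigma> x y u)"

definition K_op :: "('v::ab_group_add, 'm) tri_pair_scheme \<Rightarrow> sign \<Rightarrow> 'v \<Rightarrow> 'v \<Rightarrow> 'v \<Rightarrow> 'v"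
  where "K_op P \<sigma> x z = (\<lambda>w. triple P \<sigma> x w z - triple P \<sigma> z w x)"

definition kantor_pair ::
    "('k::field \<Rightarrow> 'v \<Rightarrow> 'v) \<Rightarrow> ('v::ab_group_add, 'm) tri_pair_scheme \<Rightarrow> bool"
  where "kantor_pair s P \<longleftrightarrow>
    trilinear_pair s P \<and>
    (\<forall>\<sigma>. \<forall>x\<in>pspace P \<sigma>. \<forall>z\<in>pspace P \<sigma>. \<forall>y\<in>pspace P (opp \<sigma>). \<forall>w\<in>pspace P (opp \<sigma>).
      \<forall>v\<in>pspace P \<sigma>.
        D_op P \<sigma> x y (D_op P \<sigma> z w v) - D_op P \<sigma> z w (D_op P \<sigma> x y v) =
        D_op P \<sigma> (D_op P \<sigma> x y z) w v - D_op P \<sigma> z (D_op P (opp \<sigma>) y x w) v) \<and>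
    (\<forall>\<sigma>. \<forall>x\<in>pspace P \<sigma>. \<forall>z\<in>pspace P \<sigma>. \<forall>u\<in>pspace P \<sigma>. \<forall>w\<in>pspace P (opp \<sigma>).
      \<forall>v\<in>pspace P (opp \<sigma>).
        K_op P \<sigma> x z (D_op P (opp \<sigma>) w u v) + D_op P \<sigma> u w (K_op P \<sigma> x z v) =
        K_op P \<sigma> (K_op P \<sigma> x z w) u v)"

definition sp_graded_kantor_pair ::
    "('k::field \<Rightarrow> 'v \<Rightarrow> 'v) \<Rightarrow> 'v::ab_group_add graded_pair \<Rightarrow> bool"
  where "sp_graded_kantor_pair s P \<longleftrightarrow>
    kantor_pair s P \<and>
    (\<forall>\<sigma> i. module.subspace s (pcomp P \<sigma> i)) \<and>
    (\<forall>\<sigma> i. i \<noteq> 0 \<and> i \<noteq> 1 \<longrightarrow> pcomp P \<sigma> i = {0}) \<and>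
    (\<forall>\<sigma>. pspace P \<sigma> = {x + y | x y. x \<in> pcomp P \<sigma> 0 \<and> y \<in> pcomp P \<sigma> 1}) \<and>
    (\<forall>\<sigma>. pcomp P \<sigma> 0 \<inter> pcomp P \<sigma> 1 = {0}) \<and>
    (\<forall>\<sigma> i j k. \<forall>x\<in>pcomp P \<sigma> i. \<forall>y\<in>pcomp P (opp \<sigma>) j. \<forall>z\<in>pcomp P \<sigma> k.
      triple P \<sigma> x y z \<in> pcomp P \<sigma> (i - j + k))"

definition graded_isomorphic ::
    "('k::field \<Rightarrow> 'v \<Rightarrow> 'v) \<Rightarrow> 'v::ab_group_add graded_pair \<Rightarrow>
     ('k \<Rightarrow> 'w \<Rightarrow> 'w) \<Rightarrow> 'w::ab_group_add graded_pair \<Rightarrow> bool"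
  where "graded_isomorphic s P t Q \<longleftrightarrow>
    sp_graded_kantor_pair s P \<and> sp_graded_kantor_pair t Q \<and>
    (\<exists>f :: sign \<Rightarrow> 'v \<Rightarrow> 'w.
      (\<forall>\<sigma>. bij_betw (f \<sigma>) (pspace P \<sigma>) (pspace Q \<sigma>)) \<and>
      (\<forall>\<sigma>. lin_on s t (pspace P \<sigma>) (f \<sigma>)) \<and>
      (\<forall>\<sigma>. \<forall>x\<in>pspace P \<sigma>. \<forall>y\<in>pspace P (opp \<sigma>). \<forall>z\<in>pspace P \<sigma>.
        f \<sigma> (triple P \<sigma> x y z) = triple Q \<sigma> (f \<sigma> x) (f (opp \<sigma>) y) (f \<sigma> z)) \<and>
      (\<forall>\<sigma> i. f \<sigma> ` pcomp P \<sigma> i = pcomp Q \<sigma> i))"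


section \<open>Lie algebras\<close>

locale lie_algebra = vector_space s
  for s :: "'k::field \<Rightarrow> 'l::ab_group_add \<Rightarrow> 'l" +
  fixes br :: "'l \<Rightarrow> 'l \<Rightarrow> 'l"
  assumes br_add_left: "br (x + y) z = br x z + br y z"
    and br_add_right: "br x (y + z) = br x y + br x z"
    and br_scale_left: "br (s c x) y = s c (br x y)"
    and br_scale_right: "br x (s c y) = s c (br x y)"
    and br_self: "br x x = 0"
    and jacobi: "br x (br y z) + br y (br z x) + br z (br x y) = 0"

context lie_algebra
begin

lemma br_zero [simp]: "br 0 x = 0" "br x 0 = 0"
  using br_add_left[of 0 0 x] br_add_right[of x 0 0] by simp_all

lemma br_swap: "br y x = - br x y"
proof -
  have "br x y + br y x = 0"
    using br_self[of "x + y"] br_self[of x] br_self[of y] unfolding br_add_left br_add_right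
    by (simp add: add.commute)
  then show ?thesis by (metis add.inverse_unique)
qed

lemma br_minus: "br (- x) y = - br x y" "br x (- y) = - br x y"
  using br_add_left[of x "- x" y] br_add_right[of x y "- y"]
  by (simp_all add: eq_neg_iff_add_eq_0 add.commute)

lemma br_diff: "br (x - y) z = br x z - br y z" "br x (y - z) = br x y - br x z"
  using br_add_left[of x "- y" z] br_add_right[of x y "- z"] by (simp_all add: br_minus)

lemma br_br: "br (br x y) z = br x (br y z) - br y (br x z)"
  using jacobi[of x y z] br_swap[of "br x y" z] br_swap[of z x]
  by (simp add: br_minus algebra_simps add_eq_0_iff)

end

definition lie_subalgebra ::
    "('k::field \<Rightarrow> 'l \<Rightarrow> 'l) \<Rightarrow> ('l::ab_group_add \<Rightarrow> 'l \<Rightarrow> 'l) \<Rightarrow> 'l set \<Rightarrow> bool"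
  where "lie_subalgebra s br A \<longleftrightarrow> module.subspace s A \<and> (\<forall>x\<in>A. \<forall>y\<in>A. br x y \<in> A)"

definition lie_ideal ::
    "('k::field \<Rightarrow> 'l \<Rightarrow> 'l) \<Rightarrow> ('l::ab_group_add \<Rightarrow> 'l \<Rightarrow> 'l) \<Rightarrow> 'l set \<Rightarrow> bool"
  where "lie_ideal s br I \<longleftrightarrow> module.subspace s I \<and> (\<forall>x. \<forall>y\<in>I. br x y \<in> I)"

definition fd_simple_lie_algebra ::
    "('k::field \<Rightarrow> 'l \<Rightarrow> 'l) \<Rightarrow> ('l::ab_group_add \<Rightarrow> 'l \<Rightarrow> 'l) \<Rightarrow> bool"
  where "fd_simple_lie_algebra s br \<longleftrightarrow>
    lie_algebra s br \<and>
    (\<exists>B. finite B \<and> module.span s B = UNIV) \<and>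
    (\<exists>x y. br x y \<noteq> 0) \<and>
    (\<forall>I. lie_ideal s br I \<longrightarrow> I = {0} \<or> I = UNIV)"

definition bracket_span ::
    "('k::field \<Rightarrow> 'l \<Rightarrow> 'l) \<Rightarrow> ('l::ab_group_add \<Rightarrow> 'l \<Rightarrow> 'l) \<Rightarrow> 'l set \<Rightarrow> 'l set \<Rightarrow> 'l set"
  where "bracket_span s br A B = module.span s {br x y | x y. x \<in> A \<and> y \<in> B}"

primrec lower_central ::
    "('k::field \<Rightarrow> 'l \<Rightarrow> 'l) \<Rightarrow> ('l::ab_group_add \<Rightarrow> 'l \<Rightarrow> 'l) \<Rightarrow> 'l set \<Rightarrow> nat \<Rightarrow> 'l set" where
  "lower_central s br A 0 = A"
| "lower_central s br A (Suc n) = bracket_span s br A (lower_central s br A n)"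

definition cartan_subalgebra ::
    "('k::field \<Rightarrow> 'l \<Rightarrow> 'l) \<Rightarrow> ('l::ab_group_add \<Rightarrow> 'l \<Rightarrow> 'l) \<Rightarrow> 'l set \<Rightarrow> bool"
  where "cartan_subalgebra s br H \<longleftrightarrow>
    lie_subalgebra s br H \<and>
    (\<exists>n. lower_central s br H n = {0}) \<and>
    (\<forall>x. (\<forall>h\<in>H. br x h \<in> H) \<longrightarrow> x \<in> H)"


section \<open>The root system of type \<open>BC\<^sub>2\<close> and graded Lie algebras\<close>

text \<open>
  The root lattice is \<open>\<int>\<^sup>2\<close>, with \<open>\<alpha>\<^sub>1 = (1, 0)\<close> and \<open>\<alpha>\<^sub>2 = (0, 1)\<close>.
\<close>

definition bc2_pos :: "(int \<times> int) set"
  where "bc2_pos = {(1, 0), (0, 1), (1, 1), (2, 0), (2, 1), (2, 2)}"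

definition bc2_roots :: "(int \<times> int) set"
  where "bc2_roots = bc2_pos \<union> uminus ` bc2_pos"

text \<open>
  The invariant form, normalised by \<open>(\<alpha>\<^sub>1, \<alpha>\<^sub>1) = 1\<close>, \<open>(\<alpha>\<^sub>2, \<alpha>\<^sub>2) = 2\<close>, \<open>(\<alpha>\<^sub>1, \<alpha>\<^sub>2) = -1\<close>: in the
  orthonormal basis \<open>e\<^sub>1 = \<alpha>\<^sub>1 + \<alpha>\<^sub>2\<close>, \<open>e\<^sub>2 = \<alpha>\<^sub>1\<close> the roots are \<open>\<plusminus>e\<^sub>i\<close>, \<open>\<plusminus>2e\<^sub>i\<close> and \<open>\<plusminus>e\<^sub>1 \<plusminus> e\<^sub>2\<close>.
\<close>

fun bc2_form :: "int \<times> int \<Rightarrow> int \<times> int \<Rightarrow> int" where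
  "bc2_form (a, b) (c, d) = a * c + 2 * (b * d) - a * d - b * c"

text \<open>The division below is exact whenever \<open>\<beta>\<close> is a root.\<close>

definition bc2_refl :: "int \<times> int \<Rightarrow> int \<times> int \<Rightarrow> int \<times> int"
  where "bc2_refl \<beta> x =
    (let n = 2 * bc2_form x \<beta> div bc2_form \<beta> \<beta> in (fst x - n * fst \<beta>, snd x - n * snd \<beta>))"

text \<open>
  The monoid generated by a set of maps; for a set of reflections, which are
  involutions, it is the generated group.
\<close>

inductive_set generated_by :: "('a \<Rightarrow> 'a) set \<Rightarrow> ('a \<Rightarrow> 'a) set" for R where
  id: "id \<in> generated_by R"
| comp: "r \<in> R \<Longrightarrow> w \<in> generated_by R \<Longrightarrow> r \<circ> w \<in> generated_by R"

definition bc2_weyl :: "(int \<times> int \<Rightarrow> int \<times> int) set"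
  where "bc2_weyl = generated_by (bc2_refl ` bc2_roots)"

definition bc2_graded ::
    "('k::field \<Rightarrow> 'l \<Rightarrow> 'l) \<Rightarrow> ('l::ab_group_add \<Rightarrow> 'l \<Rightarrow> 'l) \<Rightarrow> (int \<times> int \<Rightarrow> 'l set) \<Rightarrow> bool"
  where "bc2_graded s br L \<longleftrightarrow>
    lie_algebra s br \<and>
    (\<forall>\<alpha>. module.subspace s (L \<alpha>)) \<and>
    (\<forall>x. \<exists>!c. (\<forall>\<alpha>. c \<alpha> \<in> L \<alpha>) \<and> finite {\<alpha>. c \<alpha> \<noteq> 0} \<and> x = (\<Sum>\<alpha> | c \<alpha> \<noteq> 0. c \<alpha>)) \<and>
    (\<forall>\<alpha> \<beta>. \<forall>x\<in>L \<alpha>. \<forall>y\<in>L \<beta>. br x y \<in> L (\<alpha> + \<beta>)) \<and>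
    (\<forall>\<alpha>. \<alpha> \<notin> bc2_roots \<union> {0} \<longrightarrow> L \<alpha> = {0})"

definition lie_pair ::
    "('l::ab_group_add \<Rightarrow> 'l \<Rightarrow> 'l) \<Rightarrow> (sign \<Rightarrow> int \<Rightarrow> 'l set) \<Rightarrow> 'l graded_pair"
  where "lie_pair br C = \<lparr>
    pspace = (\<lambda>\<sigma>. {x + y | x y. x \<in> C \<sigma> 0 \<and> y \<in> C \<sigma> 1}),
    triple = (\<lambda>\<sigma> x y z. br (br x y) z),
    pcomp = (\<lambda>\<sigma> i. if i = 0 \<or> i = 1 then C \<sigma> i else {0}) \<rparr>"

definition enveloped_pair ::
    "('l::ab_group_add \<Rightarrow> 'l \<Rightarrow> 'l) \<Rightarrow> (int \<times> int \<Rightarrow> 'l set) \<Rightarrow> 'l graded_pair"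
  where "enveloped_pair br L = lie_pair br (\<lambda>\<sigma> i. L (sg \<sigma>, sg \<sigma> * i))"

lemma ex1_eq: "\<exists>!x. P x \<Longrightarrow> P a \<Longrightarrow> P b \<Longrightarrow> a = b"
  by blast

lemma opp_opp [simp]: "opp (opp \<sigma>) = \<sigma>" by (cases \<sigma>) auto
lemma sg_opp [simp]: "sg (opp \<sigma>) = - sg \<sigma>" by (cases \<sigma>) auto

lemma bc2_gradedD:
  assumes "bc2_graded s br L"
  shows "lie_algebra s br" "module.subspace s (L \<alpha>)"
    "x \<in> L \<alpha> \<Longrightarrow> y \<in> L \<beta> \<Longrightarrow> br x y \<in> L (\<alpha> + \<beta>)"
    "\<alpha> \<notin> bc2_roots \<union> {0} \<Longrightarrow> L \<alpha> = {0}"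
proof -
  note g = assms[unfolded bc2_graded_def]
  show "lie_algebra s br" by (rule conjunct1[OF g])
  show "module.subspace s (L \<alpha>)"
    by (rule spec[OF conjunct1[OF conjunct2[OF g]]])
  show "br x y \<in> L (\<alpha> + \<beta>)" if "x \<in> L \<alpha>" "y \<in> L \<beta>"
    using conjunct1[OF conjunct2[OF conjunct2[OF conjunct2[OF g]]]] that by blast
  show "L \<alpha> = {0}" if "\<alpha> \<notin> bc2_roots \<union> {0}"
    using conjunct2[OF conjunct2[OF conjunct2[OF conjunct2[OF g]]]] that by blast
qed

lemma bc2_graded_disjoint:
  assumes "bc2_graded s br L" "\<alpha> \<noteq> \<beta>" "x \<in> L \<alpha>" "x \<in> L \<beta>"
  shows "x = 0"
proof (rule ccontr)
  assume "x \<noteq> 0"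
  interpret lie_algebra s br by (rule bc2_gradedD(1)[OF assms(1)])
  define c where "c \<gamma> = (\<lambda>\<delta>. if \<delta> = \<gamma> then x else 0)" for \<gamma> :: "int \<times> int"
  have z: "0 \<in> L \<gamma>" for \<gamma> by (rule subspace_0[OF bc2_gradedD(2)[OF assms(1)]])
  have supp: "{\<delta>. c \<gamma> \<delta> \<noteq> 0} = {\<gamma>}" for \<gamma> using \<open>x \<noteq> 0\<close> by (auto simp: c_def)
  have c: "(\<forall>\<delta>. c \<gamma> \<delta> \<in> L \<delta>) \<and> finite {\<delta>. c \<gamma> \<delta> \<noteq> 0} \<and> x = (\<Sum>\<delta> | c \<gamma> \<delta> \<noteq> 0. c \<gamma> \<delta>)"
    if "x \<in> L \<gamma>" for \<gamma>
    unfolding supp using that z by (auto simp: c_def)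
  have "\<exists>!c. (\<forall>\<alpha>. c \<alpha> \<in> L \<alpha>) \<and> finite {\<alpha>. c \<alpha> \<noteq> 0} \<and> x = (\<Sum>\<alpha> | c \<alpha> \<noteq> 0. c \<alpha>)"
    using assms(1) unfolding bc2_graded_def by (elim conjE) (erule spec)
  then have "c \<alpha> = c \<beta>" by (rule ex1_eq) (rule c[OF assms(3)], rule c[OF assms(4)])
  then have "c \<alpha> \<alpha> = c \<beta> \<alpha>" by simp
  then show False using \<open>x \<noteq> 0\<close> assms(2) by (simp add: c_def)
qed

lemma sp_graded_kantor_pair_enveloped:
  assumes g: "bc2_graded s br L"
  shows "sp_graded_kantor_pair s (enveloped_pair br L)"
proof -
  interpret lie_algebra s br by (rule bc2_gradedD(1)[OF g])
  have sub: "subspace (L \<alpha>)" for \<alpha> by (rule bc2_gradedD(2)[OF g])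
  have br: "br x y \<in> L (\<alpha> + \<beta>)" if "x \<in> L \<alpha>" "y \<in> L \<beta>" for x y \<alpha> \<beta>
    using that by (rule bc2_gradedD(3)[OF g])
  have zero: "L \<alpha> = {0}" if "\<alpha> \<notin> bc2_roots \<union> {0}" for \<alpha>
    using that by (rule bc2_gradedD(4)[OF g])
  let ?P = "enveloped_pair br L"
  define M where "M \<sigma> = pspace ?P \<sigma>" for \<sigma>
  define C where "C \<sigma> i = L (sg \<sigma>, sg \<sigma> * i)" for \<sigma> and i :: int
  have C: "pcomp ?P \<sigma> i = C \<sigma> i" for \<sigma> i
  proof (cases "i = 0 \<or> i = 1")
    case True then show ?thesis by (auto simp: enveloped_pair_def lie_pair_def C_def)
  next
    case False
    have "(sg \<sigma>, sg \<sigma> * i) \<notin> bc2_roots \<union> {0}"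
      using False by (cases \<sigma>) (auto simp: bc2_roots_def bc2_pos_def zero_prod_def)
    then show ?thesis using False zero by (simp add: enveloped_pair_def lie_pair_def C_def)
  qed
  have M: "M \<sigma> = {x + y | x y. x \<in> C \<sigma> 0 \<and> y \<in> C \<sigma> 1}" for \<sigma>
    by (auto simp: M_def enveloped_pair_def lie_pair_def C_def)
  have t: "triple ?P \<sigma> x y z = br (br x y) z" for \<sigma> x y z
    by (simp add: enveloped_pair_def lie_pair_def)
  have subC: "subspace (C \<sigma> i)" for \<sigma> i unfolding C_def by (rule sub)
  have subM: "subspace (M \<sigma>)" for \<sigma> unfolding M by (rule subspace_sums) (rule subC)+
  have C0: "C \<sigma> i = {0}" if "i \<noteq> 0" "i \<noteq> 1" for \<sigma> i
    using C[of \<sigma> i] that by (simp add: enveloped_pair_def lie_pair_def)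
  have CM: "C \<sigma> i \<subseteq> M \<sigma>" for \<sigma> i
  proof -
    consider "i = 0" | "i = 1" | "i \<noteq> 0 \<and> i \<noteq> 1" by blast
    then show ?thesis
    proof cases
      case 1 then show ?thesis unfolding M using subspace_0[OF subC, of \<sigma> 1] by force
    next
      case 2 then show ?thesis unfolding M using subspace_0[OF subC, of \<sigma> 0] by force
    next
      case 3 then show ?thesis using C0 subspace_0[OF subM] by simp
    qed
  qed
  have tC: "br (br x y) z \<in> C \<sigma> (i - j + k)"
    if "x \<in> C \<sigma> i" "y \<in> C (opp \<sigma>) j" "z \<in> C \<sigma> k" for \<sigma> i j k x y z
  proof -
    have "br (br x y) z \<in> L ((sg \<sigma>, sg \<sigma> * i) + (sg (opp \<sigma>), sg (opp \<sigma>) * j) + (sg \<sigma>, sg \<sigma> * k))"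
      using that unfolding C_def by (intro br)
    then show ?thesis unfolding C_def by (simp add: algebra_simps)
  qed
  have tM: "br (br x y) z \<in> M \<sigma>"
    if h: "x \<in> M \<sigma>" "y \<in> M (opp \<sigma>)" "z \<in> M \<sigma>" for \<sigma> x y z
  proof -
    obtain x0 x1 where x: "x = x0 + x1" "x0 \<in> C \<sigma> 0" "x1 \<in> C \<sigma> 1" using h unfolding M by blast
    obtain y0 y1 where y: "y = y0 + y1" "y0 \<in> C (opp \<sigma>) 0" "y1 \<in> C (opp \<sigma>) 1" using h unfolding M by blast
    obtain z0 z1 where z: "z = z0 + z1" "z0 \<in> C \<sigma> 0" "z1 \<in> C \<sigma> 1" using h unfolding M by blast
    have m: "br (br a b) c \<in> M \<sigma>" if "a \<in> C \<sigma> i" "b \<in> C (opp \<sigma>) j" "c \<in> C \<sigma> k" for a b c i j k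
      using tC[OF that] CM by (rule rev_subsetD)
    show ?thesis unfolding x(1) y(1) z(1) br_add_left br_add_right
      by (intro subspace_add[OF subM] m) (rule x(2,3) y(2,3) z(2,3))+
  qed
  have t3: "br (br x y) z = 0" if h: "x \<in> M \<sigma>" "y \<in> M \<sigma>" "z \<in> M \<sigma>" for \<sigma> x y z
  proof -
    obtain x0 x1 where x: "x = x0 + x1" "x0 \<in> C \<sigma> 0" "x1 \<in> C \<sigma> 1" using h unfolding M by blast
    obtain y0 y1 where y: "y = y0 + y1" "y0 \<in> C \<sigma> 0" "y1 \<in> C \<sigma> 1" using h unfolding M by blast
    obtain z0 z1 where z: "z = z0 + z1" "z0 \<in> C \<sigma> 0" "z1 \<in> C \<sigma> 1" using h unfolding M by blast
    have "br (br a b) c = 0" if "a \<in> C \<sigma> i" "b \<in> C \<sigma> j" "c \<in> C \<sigma> k" for a b c i j k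
    proof -
      have "br (br a b) c \<in> L (sg \<sigma> + sg \<sigma> + sg \<sigma>, sg \<sigma> * i + sg \<sigma> * j + sg \<sigma> * k)"
        using br[OF br, of a "(sg \<sigma>, sg \<sigma> * i)" b "(sg \<sigma>, sg \<sigma> * j)" c "(sg \<sigma>, sg \<sigma> * k)"] that
        unfolding C_def by simp
      moreover have "(sg \<sigma> + sg \<sigma> + sg \<sigma>, sg \<sigma> * i + sg \<sigma> * j + sg \<sigma> * k) \<notin> bc2_roots \<union> {0}"
        by (cases \<sigma>) (auto simp: bc2_roots_def bc2_pos_def zero_prod_def)
      ultimately show ?thesis using zero by blast
    qed
    then show ?thesis unfolding x(1) y(1) z(1) br_add_left br_add_right
      using x(2,3) y(2,3) z(2,3) by simp
  qed
  have tri: "trilinear_pair s ?P"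
    unfolding trilinear_pair_def M_def[symmetric] t
    by (intro conjI allI ballI)
      (simp_all add: vector_space_axioms subM tM lin_on_def
        br_add_left br_add_right br_scale_left br_scale_right)
  have K: "br (br x w) z - br (br z w) x = br (br x z) w" for x z w
    by (simp add: br_br[of x z w] br_swap[of z "br x w"] br_swap[of x "br z w"])
  have k2: "br (br x z) (br (br w u) v) + br (br u w) (br (br x z) v) = br (br (br (br x z) w) u) v"
    if "x \<in> M \<sigma>" "z \<in> M \<sigma>" "u \<in> M \<sigma>" for \<sigma> x z u w v
  proof -
    let ?k = "br x z"
    have 0: "br ?k u = 0" using t3 that by blast
    have "br (br ?k w) u = - br u (br ?k w)" by (rule br_swap)
    also have "\<dots> = br (br u w) ?k" using 0 br_br[of u w ?k] br_swap[of u ?k] br_swap[of w ?k]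
      by (simp add: br_minus)
    finally show ?thesis by (simp add: br_br[of "br u w" ?k v] br_swap[of w u] br_minus)
  qed
  have k1: "br (br x y) (br (br z w) v) - br (br z w) (br (br x y) v) =
      br (br (br (br x y) z) w) v - br (br z (br (br y x) w)) v" for x y z w v
  proof -
    have "br (br (br x y) z) w - br z (br (br y x) w) = br (br x y) (br z w)"
      using br_br[of "br x y" z w] by (simp add: br_swap[of y x] br_minus)
    then show ?thesis by (simp add: br_br[of "br x y" "br z w" v, symmetric] br_diff(1)[symmetric])
  qed
  have "kantor_pair s ?P"
    unfolding kantor_pair_def D_op_def K_op_def M_def[symmetric] t K
    by (intro conjI allI ballI) (rule tri, rule k1, rule k2)
  moreover have "C \<sigma> 0 \<inter> C \<sigma> 1 = {0}" for \<sigma>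
    using bc2_graded_disjoint[OF g, of "(sg \<sigma>, 0)" "(sg \<sigma>, sg \<sigma>)"] subspace_0[OF sub]
    by (cases \<sigma>) (auto simp: C_def)
  ultimately show ?thesis
    unfolding sp_graded_kantor_pair_def M_def[symmetric] C t
    by (intro conjI allI impI ballI) (simp_all add: subC C0 M tC)
qed

text \<open>Hence the requirement of being an SP-graded Kantor pair is automatic for pairs of this form.\<close>

text \<open>
  A Lie algebra may envelop a pair living in a different vector space, so that enveloping is
  understood up to graded isomorphism.
\<close>

definition envelops ::
    "('k::field \<Rightarrow> 'l \<Rightarrow> 'l) \<Rightarrow> ('l::ab_group_add \<Rightarrow> 'l \<Rightarrow> 'l) \<Rightarrow> (int \<times> int \<Rightarrow> 'l set) \<Rightarrow>
     ('k \<Rightarrow> 'v \<Rightarrow> 'v) \<Rightarrow> 'v::ab_group_add graded_pair \<Rightarrow> bool"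
  where "envelops s br L t P \<longleftrightarrow>
    bc2_graded s br L \<and> graded_isomorphic s (enveloped_pair br L) t P"

text \<open>
  For \<open>u \<in> W\<^sub>\<Delta>\<close> and any \<open>L\<close> that envelops \<open>P\<close>, the \<open>u\<close>-image of \<open>P\<close> is
  \<open>enveloped_pair br (weyl_twist u L)\<close>.
\<close>

definition weyl_twist :: "(int \<times> int \<Rightarrow> int \<times> int) \<Rightarrow> (int \<times> int \<Rightarrow> 'l set) \<Rightarrow> int \<times> int \<Rightarrow> 'l set"
  where "weyl_twist u L = (\<lambda>\<alpha>. L (inv u \<alpha>))"


section \<open>Roots of a Lie algebra relative to a Cartan subalgebra\<close>

text \<open>
  Elements of the dual space of \<open>H\<close> are represented by functions that vanish outside \<open>H\<close>, with
  the pointwise operations.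
\<close>

definition dual_space ::
    "('k::field \<Rightarrow> 'g \<Rightarrow> 'g) \<Rightarrow> 'g::ab_group_add set \<Rightarrow> ('g \<Rightarrow> 'k) set"
  where "dual_space s H = {\<mu>. lin_on s (*) H \<mu> \<and> (\<forall>x. x \<notin> H \<longrightarrow> \<mu> x = 0)}"

definition root_space ::
    "('k::field \<Rightarrow> 'g \<Rightarrow> 'g) \<Rightarrow> ('g::ab_group_add \<Rightarrow> 'g \<Rightarrow> 'g) \<Rightarrow> 'g set \<Rightarrow> ('g \<Rightarrow> 'k) \<Rightarrow> 'g set"
  where "root_space s br H \<mu> = {x. \<forall>h\<in>H. br h x = s (\<mu> h) x}"

definition roots ::
    "('k::field \<Rightarrow> 'g \<Rightarrow> 'g) \<Rightarrow> ('g::ab_group_add \<Rightarrow> 'g \<Rightarrow> 'g) \<Rightarrow> 'g set \<Rightarrow> ('g \<Rightarrow> 'k) set"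
  where "roots s br H = {\<mu> \<in> dual_space s H. \<mu> \<noteq> 0 \<and> root_space s br H \<mu> \<noteq> {0}}"

definition root_lattice ::
    "('k::field \<Rightarrow> 'g \<Rightarrow> 'g) \<Rightarrow> ('g::ab_group_add \<Rightarrow> 'g \<Rightarrow> 'g) \<Rightarrow> 'g set \<Rightarrow> ('g \<Rightarrow> 'k) set"
  where "root_lattice s br H = module.span (\<lambda>(n::int) \<mu> h. of_int n * \<mu> h) (roots s br H)"

definition coroot ::
    "('k::field \<Rightarrow> 'g \<Rightarrow> 'g) \<Rightarrow> ('g::ab_group_add \<Rightarrow> 'g \<Rightarrow> 'g) \<Rightarrow> 'g set \<Rightarrow> ('g \<Rightarrow> 'k) \<Rightarrow> 'g"
  where "coroot s br H \<alpha> =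
    (THE h. h \<in> bracket_span s br (root_space s br H \<alpha>) (root_space s br H (- \<alpha>)) \<and> \<alpha> h = 2)"

definition root_refl ::
    "('k::field \<Rightarrow> 'g \<Rightarrow> 'g) \<Rightarrow> ('g::ab_group_add \<Rightarrow> 'g \<Rightarrow> 'g) \<Rightarrow> 'g set \<Rightarrow>
     ('g \<Rightarrow> 'k) \<Rightarrow> ('g \<Rightarrow> 'k) \<Rightarrow> 'g \<Rightarrow> 'k"
  where "root_refl s br H \<alpha> \<mu> = (\<lambda>h. \<mu> h - \<mu> (coroot s br H \<alpha>) * \<alpha> h)"

definition weyl_group ::
    "('k::field \<Rightarrow> 'g \<Rightarrow> 'g) \<Rightarrow> ('g::ab_group_add \<Rightarrow> 'g \<Rightarrow> 'g) \<Rightarrow> 'g set \<Rightarrow>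
     (('g \<Rightarrow> 'k) \<Rightarrow> 'g \<Rightarrow> 'k) set"
  where "weyl_group s br H = generated_by (root_refl s br H ` roots s br H)"

definition root_base ::
    "('k::field \<Rightarrow> 'g \<Rightarrow> 'g) \<Rightarrow> ('g::ab_group_add \<Rightarrow> 'g \<Rightarrow> 'g) \<Rightarrow> 'g set \<Rightarrow> ('g \<Rightarrow> 'k) set \<Rightarrow> bool"
  where "root_base s br H \<Pi> \<longleftrightarrow>
    finite \<Pi> \<and> \<Pi> \<subseteq> roots s br H \<and>
    \<not> module.dependent (\<lambda>c \<mu> h. c * \<mu> h) \<Pi> \<and>
    (\<forall>\<beta>\<in>roots s br H. \<exists>n :: ('g \<Rightarrow> 'k) \<Rightarrow> nat.
      \<beta> = (\<lambda>h. \<Sum>\<alpha>\<in>\<Pi>. of_nat (n \<alpha>) * \<alpha> h) \<or> \<beta> = (\<lambda>h. - (\<Sum>\<alpha>\<in>\<Pi>. of_nat (n \<alpha>) * \<alpha> h)))"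


section \<open>Kantor pairs from subsets of a base\<close>

text \<open>Homomorphisms on the root lattice are extended by \<open>0\<close> outside of it.\<close>

definition chi ::
    "('k::field \<Rightarrow> 'g \<Rightarrow> 'g) \<Rightarrow> ('g::ab_group_add \<Rightarrow> 'g \<Rightarrow> 'g) \<Rightarrow> 'g set \<Rightarrow> ('g \<Rightarrow> 'k) set \<Rightarrow>
     ('g \<Rightarrow> 'k) set \<Rightarrow> ('g \<Rightarrow> 'k) \<Rightarrow> int"
  where "chi s br H \<Pi> S = (THE f.
    (\<forall>\<mu>\<in>root_lattice s br H. \<forall>\<nu>\<in>root_lattice s br H. f (\<mu> + \<nu>) = f \<mu> + f \<nu>) \<and>
    (\<forall>\<mu>. \<mu> \<notin> root_lattice s br H \<longrightarrow> f \<mu> = 0) \<and>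
    (\<forall>\<alpha>\<in>S. f \<alpha> = 1) \<and> (\<forall>\<alpha>\<in>\<Pi> - S. f \<alpha> = 0))"

definition chi2 ::
    "('k::field \<Rightarrow> 'g \<Rightarrow> 'g) \<Rightarrow> ('g::ab_group_add \<Rightarrow> 'g \<Rightarrow> 'g) \<Rightarrow> 'g set \<Rightarrow> ('g \<Rightarrow> 'k) set \<Rightarrow>
     ('g \<Rightarrow> 'k) set \<times> ('g \<Rightarrow> 'k) set \<Rightarrow> ('g \<Rightarrow> 'k) \<Rightarrow> int \<times> int"
  where "chi2 s br H \<Pi> ST = (\<lambda>\<mu>. (chi s br H \<Pi> (fst ST) \<mu>, chi s br H \<Pi> (snd ST) \<mu>))"

definition SPA ::
    "('k::field \<Rightarrow> 'g \<Rightarrow> 'g) \<Rightarrow> ('g::ab_group_add \<Rightarrow> 'g \<Rightarrow> 'g) \<Rightarrow> 'g set \<Rightarrow> ('g \<Rightarrow> 'k) set \<Rightarrow>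
     (('g \<Rightarrow> 'k) set \<times> ('g \<Rightarrow> 'k) set) set"
  where "SPA s br H \<Pi> = {ST. fst ST \<subseteq> \<Pi> \<and> snd ST \<subseteq> \<Pi> \<and>
    chi2 s br H \<Pi> ST ` roots s br H \<subseteq> bc2_roots \<union> {0} \<and>
    chi2 s br H \<Pi> ST ` roots s br H \<inter> {(1, 0), (- 1, 0), (1, 1), (- 1, - 1)} \<noteq> {}}"

definition root_pair ::
    "('k::field \<Rightarrow> 'g \<Rightarrow> 'g) \<Rightarrow> ('g::ab_group_add \<Rightarrow> 'g \<Rightarrow> 'g) \<Rightarrow> 'g set \<Rightarrow> ('g \<Rightarrow> 'k) set \<Rightarrow>
     ('g \<Rightarrow> 'k) set \<times> ('g \<Rightarrow> 'k) set \<Rightarrow> 'g graded_pair"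
  where "root_pair s br H \<Pi> ST = lie_pair br (\<lambda>\<sigma> i. module.span s
    (\<Union>\<mu>\<in>{\<mu> \<in> roots s br H. chi2 s br H \<Pi> ST \<mu> = (sg \<sigma>, sg \<sigma> * i)}. root_space s br H \<mu>))"

definition weyl_orbit ::
    "('k::field \<Rightarrow> 'g \<Rightarrow> 'g) \<Rightarrow> ('g::ab_group_add \<Rightarrow> 'g \<Rightarrow> 'g) \<Rightarrow> 'g set \<Rightarrow> ('g \<Rightarrow> 'k) set \<Rightarrow>
     (int \<times> int \<Rightarrow> int \<times> int) \<Rightarrow> ('g \<Rightarrow> 'k) set \<times> ('g \<Rightarrow> 'k) set \<Rightarrow> (('g \<Rightarrow> 'k) \<Rightarrow> int \<times> int) set"
  where "weyl_orbit s br H \<Pi> u ST =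
    {\<lambda>\<mu>. if \<mu> \<in> root_lattice s br H then (u \<circ> chi2 s br H \<Pi> ST \<circ> w) \<mu> else 0
      | w. w \<in> weyl_group s br H}"

definition weyl_act ::
    "('k::field \<Rightarrow> 'g \<Rightarrow> 'g) \<Rightarrow> ('g::ab_group_add \<Rightarrow> 'g \<Rightarrow> 'g) \<Rightarrow> 'g set \<Rightarrow> ('g \<Rightarrow> 'k) set \<Rightarrow>
     (int \<times> int \<Rightarrow> int \<times> int) \<Rightarrow> ('g \<Rightarrow> 'k) set \<times> ('g \<Rightarrow> 'k) set \<Rightarrow>
     ('g \<Rightarrow> 'k) set \<times> ('g \<Rightarrow> 'k) set"
  where "weyl_act s br H \<Pi> u ST =
    (let \<rho> = (THE \<rho>. \<rho> \<in> weyl_orbit s br H \<Pi> u ST \<and> \<rho> ` \<Pi> \<subseteq> bc2_pos \<union> {0})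
     in THE ST'. ST' \<in> SPA s br H \<Pi> \<and> chi2 s br H \<Pi> ST' = \<rho>)"

end

theory Submission
  imports Defs
begin

text \<open>
  Write \<open>(S', T') = u * (S, T)\<close>, so that \<open>\<chi>' = u \<circ> \<chi> \<circ> w\<close> on the root lattice for some \<open>w\<close> in the
  Weyl group of the Lie algebra. The product of the automorphisms \<open>exp(ad e) exp(- ad f) exp(ad e)\<close>
  over the reflections in \<open>w\<close> permutes the root spaces by \<open>w\<close>, and hence carries the grading by \<open>\<chi>'\<close>
  to the \<open>u\<close>-twist of the grading by \<open>\<chi>\<close>. For an arbitrary enveloping algebra, the components of the
  \<open>u\<close>-image are again short root spaces, and by the Jacobi identity the products \<open>[[x, y], z]\<close> of
  elements of short root spaces depend only on the original pair.

  The generalized weight spaces of \<open>H\<close> are root spaces because the Killing form is nondegenerate. Its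
  radical is an ideal, so it suffices that the form is nonzero: otherwise traces on root strings
  would make every weight vanish on \<open>H\<close>. Nondegeneracy makes derivations inner, which provides the semisimple parts of
  the elements of \<open>H\<close>; an element of \<open>H\<close> on which all weights vanish is then zero. Integrality of
  \<open>\<mu>(h\<^sub>\<alpha>)\<close> follows because the reflection automorphism maps the root space of \<open>\<mu>\<close> both to that of
  \<open>s\<^sub>\<alpha> \<mu>\<close> and into the \<open>\<alpha>\<close>-string through \<open>\<mu>\<close>.
\<close>

section \<open>Generalized eigenspaces and traces\<close>

text \<open>\<open>weyl_act\<close> is built from two definite descriptions, so the theorem has
  content only once both are resolved: the orbit of u o \<chi> must contain exactly one positive
  member, and that member must have coordinates 0 or 1 on \<Pi>. The first point amounts to the
  existence and uniqueness of dominant conjugates of additive functionals on the root lattice,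
  proved for an abstract root system through words in base reflections. For the second point the
  value with first coordinate 2 has to be excluded on \<Pi>; this needs a root that bounds all
  others in every coordinate, and a parity argument starting from the short value that membership in
  \<open>SPA\<close> provides.

  The Lie theory is shaped by two obstacles. A Cartan subalgebra is only known to be nilpotent and
  self-normalizing, so the decomposition starts from generalized weight spaces. And a sum of squares
  in the ground field may vanish without its terms vanishing, so weights are first shown to be
  rational multiples of a root on suitable elements.\<close>

locale fd_space = finite_dimensional_vector_space scale Basis
  for scale :: "'a::field \<Rightarrow> 'b::ab_group_add \<Rightarrow> 'b" (infixr "*s" 75) and Basis
begin

abbreviation endo where "endo \<equiv> Vector_Spaces.linear scale scale"

definition gen_eigenspace :: "('b \<Rightarrow> 'b) \<Rightarrow> 'a \<Rightarrow> 'b set"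
  where "gen_eigenspace f c = {x. \<exists>n. ((\<lambda>y. f y - c *s y) ^^ n) x = 0}"

text \<open>Meant as the trace of the restriction of \<open>f\<close> to \<open>span B\<close>.
  \<open>representation\<close> is 0 by default outside that span, whence the stability hypotheses
  in the lemmas about it.\<close>

definition trace_on :: "'b set \<Rightarrow> ('b \<Rightarrow> 'b) \<Rightarrow> 'a"
  where "trace_on B f = (\<Sum>b\<in>B. representation B (f b) b)"

lemma linear_funpow:
  assumes "endo f"
  shows "endo (f ^^ n)"
proof (induction n)
  case (Suc n)
  then show ?case using assms Vector_Spaces.linear_compose[of scale scale "f ^^ n" scale f] by (simp del: o_apply)
qed (simp add: linear_ident id_def)

lemma linear_minus_scale:
  assumes "endo f"
  shows "endo (\<lambda>y. f y - c *s y)"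
proof -
  interpret f: Vector_Spaces.linear scale scale f by fact
  show ?thesis
    unfolding Vector_Spaces.linear_iff using vector_space_axioms
    by (auto simp: f.add f.scale algebra_simps)
qed

lemma funpow_image_subset: "f ` V \<subseteq> V \<Longrightarrow> x \<in> V \<Longrightarrow> (f ^^ n) x \<in> V"
  by (induction n) auto

lemma funpow_zero_mono:
  assumes "endo f" "(f ^^ m) x = 0" "m \<le> n"
  shows "(f ^^ n) x = 0"
proof -
  interpret g: Vector_Spaces.linear scale scale "f ^^ (n - m)" by (rule linear_funpow) fact
  have "(f ^^ n) x = (f ^^ (n - m)) ((f ^^ m) x)"
    using assms(3) by (metis comp_apply funpow_add le_add_diff_inverse2)
  then show ?thesis using assms(2) by simp
qed

lemma gen_eigenspace_subspace:
  assumes f: "endo f"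
  shows "subspace (gen_eigenspace f c)"
proof -
  let ?T = "\<lambda>y. f y - c *s y"
  have T: "endo ?T" by (rule linear_minus_scale[OF f])
  interpret Tn: Vector_Spaces.linear scale scale "?T ^^ n" for n by (rule linear_funpow[OF T])
  show ?thesis
  proof (rule subspaceI)
    show "0 \<in> gen_eigenspace f c" unfolding gen_eigenspace_def by (auto intro: exI[of _ 0])
  next
    fix x y assume "x \<in> gen_eigenspace f c" "y \<in> gen_eigenspace f c"
    then obtain m n where "(?T ^^ m) x = 0" "(?T ^^ n) y = 0" unfolding gen_eigenspace_def by blast
    then have "(?T ^^ (max m n)) x = 0" "(?T ^^ (max m n)) y = 0"
      by (auto intro: funpow_zero_mono[OF T])
    then show "x + y \<in> gen_eigenspace f c"
      unfolding gen_eigenspace_def by (auto simp: Tn.add intro: exI[of _ "max m n"])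
  next
    fix a x assume "x \<in> gen_eigenspace f c"
    then show "a *s x \<in> gen_eigenspace f c" unfolding gen_eigenspace_def by (auto simp: Tn.scale)
  qed
qed

lemma gen_eigenspace_stable:
  assumes f: "endo f" and x: "x \<in> gen_eigenspace f c"
  shows "f x \<in> gen_eigenspace f c"
proof -
  interpret f: Vector_Spaces.linear scale scale f by fact
  let ?T = "\<lambda>y. f y - c *s y"
  have "(?T ^^ n) (f x) = f ((?T ^^ n) x)" for n
    by (induction n arbitrary: x) (simp_all add: f.diff f.scale)
  moreover obtain n where "(?T ^^ n) x = 0" using x unfolding gen_eigenspace_def by blast
  ultimately have "(?T ^^ n) (f x) = 0" by (simp add: f.zero)
  then show ?thesis unfolding gen_eigenspace_def by blast
qed

lemma funpow_minus_scale_eigen: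
  assumes f: "endo f" and "f y = d *s y"
  shows "((\<lambda>y. f y - c *s y) ^^ n) y = (d - c) ^ n *s y"
  using assms(2)
proof (induction n)
  case (Suc n)
  interpret f: Vector_Spaces.linear scale scale f by fact
  have "((\<lambda>y. f y - c *s y) ^^ Suc n) y = f ((d - c) ^ n *s y) - c *s ((d - c) ^ n *s y)"
    using Suc by simp
  also have "\<dots> = ((d - c) ^ n * d - c * (d - c) ^ n) *s y"
    by (simp only: f.scale assms(2) scale_scale scale_left_diff_distrib)
  also have "(d - c) ^ n * d - c * (d - c) ^ n = (d - c) ^ Suc n" by (simp add: algebra_simps)
  finally show ?case .
qed simp

text \<open>The last nonzero vector \<open>z\<close> among the iterates of f - c on \<open>y\<close>
  is an eigenvector for c. It is still in the generalized eigenspace of d, where powers of f - d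
  multiply it by powers of c - d, so it cannot be killed.\<close>

lemma gen_eigenspace_inj:
  assumes f: "endo f" and "c \<noteq> d" and y: "y \<in> gen_eigenspace f d"
    and "((\<lambda>y. f y - c *s y) ^^ n) y = 0"
  shows "y = 0"
proof (rule ccontr)
  assume "y \<noteq> 0"
  let ?C = "\<lambda>y. f y - c *s y" and ?D = "\<lambda>y. f y - d *s y"
  interpret f: Vector_Spaces.linear scale scale f by fact
  define k where "k = (LEAST n. (?C ^^ n) y = 0)"
  have k: "(?C ^^ k) y = 0" unfolding k_def by (rule LeastI[of _ n]) fact
  with \<open>y \<noteq> 0\<close> obtain j where j: "k = Suc j" by (cases k) auto
  define z where "z = (?C ^^ j) y"
  have "z \<noteq> 0" using not_less_Least[of j "\<lambda>n. (?C ^^ n) y = 0"] j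
    unfolding z_def k_def[symmetric] by auto
  have "f z = c *s z" using k unfolding j z_def by simp
  have "(?C ^^ i) y \<in> gen_eigenspace f d" for i
  proof (induction i)
    case (Suc i)
    show ?case unfolding funpow.simps o_apply
      by (intro subspace_diff subspace_scale gen_eigenspace_subspace[OF f]
          gen_eigenspace_stable[OF f] Suc)
  qed (simp add: y)
  then have "z \<in> gen_eigenspace f d" unfolding z_def .
  then obtain m where "(?D ^^ m) z = 0" unfolding gen_eigenspace_def by blast
  then have "(c - d) ^ m *s z = 0"
    using funpow_minus_scale_eigen[OF f \<open>f z = c *s z\<close>, where c = d and n = m] by simp
  then show False using \<open>c \<noteq> d\<close> \<open>z \<noteq> 0\<close> by simp
qed

section \<open>Polynomials in an endomorphism\<close>

lemma span_image_lessThan: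
  "x \<in> span (v ` {..<n::nat}) \<Longrightarrow> \<exists>a. x = (\<Sum>i<n. a i *s v i)"
proof (induction n arbitrary: x)
  case (Suc n)
  then obtain k where "x - k *s v n \<in> span (v ` {..<n})"
    by (auto simp: lessThan_Suc span_breakdown_eq)
  from Suc.IH[OF this] obtain a where a: "x - k *s v n = (\<Sum>i<n. a i *s v i)" by blast
  have "x = (\<Sum>i<Suc n. (if i = n then k else a i) *s v i)"
    using a by (simp add: algebra_simps)
  then show ?case by (rule exI[of _ "\<lambda>i. if i = n then k else a i"])
qed simp

definition poly_apply :: "('b \<Rightarrow> 'b) \<Rightarrow> 'a poly \<Rightarrow> 'b \<Rightarrow> 'b"
  where "poly_apply f p v = (\<Sum>i\<le>degree p. coeff p i *s (f ^^ i) v)"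

lemma poly_apply_bound:
  assumes "degree p \<le> n"
  shows "poly_apply f p v = (\<Sum>i\<le>n. coeff p i *s (f ^^ i) v)"
  unfolding poly_apply_def
  by (rule sum.mono_neutral_left) (use assms in \<open>auto simp: coeff_eq_0\<close>)

lemma poly_apply_linear_factor:
  assumes f: "endo f"
  shows "poly_apply f ([:- c, 1:] * q) v = f (poly_apply f q v) - c *s poly_apply f q v"
proof -
  interpret f: Vector_Spaces.linear scale scale f by fact
  let ?n = "degree q"
  have e: "[:- c, 1:] * q = pCons 0 q - smult c q" by simp
  have "degree (pCons 0 q - smult c q) \<le> Suc ?n"
    by (intro degree_diff_le) (auto simp: degree_pCons_le intro: le_trans[OF degree_smult_le])
  then have "poly_apply f ([:- c, 1:] * q) v
      = (\<Sum>i\<le>Suc ?n. coeff (pCons 0 q - smult c q) i *s (f ^^ i) v)"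
    unfolding e by (rule poly_apply_bound)
  also have "\<dots> = (\<Sum>i\<le>Suc ?n. coeff (pCons 0 q) i *s (f ^^ i) v)
      - (\<Sum>i\<le>Suc ?n. c *s (coeff q i *s (f ^^ i) v))"
    by (simp only: coeff_diff coeff_smult scale_left_diff_distrib sum_subtractf scale_scale)
  also have "(\<Sum>i\<le>Suc ?n. coeff (pCons 0 q) i *s (f ^^ i) v) = f (poly_apply f q v)"
    by (simp add: sum.atMost_Suc_shift poly_apply_def f.sum f.scale del: sum.atMost_Suc)
  also have "(\<Sum>i\<le>Suc ?n. c *s (coeff q i *s (f ^^ i) v)) = c *s poly_apply f q v"
    unfolding poly_apply_bound[of q "Suc ?n", OF le_SucI[OF order_refl]] scale_sum_right ..
  finally show ?thesis .
qed

lemma poly_apply_closed: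
  assumes "subspace V" "f ` V \<subseteq> V" "v \<in> V"
  shows "poly_apply f p v \<in> V"
  unfolding poly_apply_def using assms
  by (intro subspace_sum subspace_scale funpow_image_subset)

section \<open>Traces on invariant subspaces\<close>

lemma subspace_basisE:
  assumes "subspace V"
  obtains B where "B \<subseteq> V" "independent B" "span B = V"
  using basis_subspace_exists[OF assms] by metis

text \<open>Multiplication by the matrix of \<open>f\<close> relative to \<open>B\<close> and
  \<open>C\<close>. With the identity for \<open>f\<close> it is a change of basis; basis
  independence and the commutation of traces are double sums of such instances.\<close>

lemma representation_linear:
  assumes f: "endo f" and B: "independent B" "v \<in> span B"
    and C: "independent C" "\<And>b. b \<in> B \<Longrightarrow> f b \<in> span C"
  shows "representation C (f v) c = (\<Sum>b\<in>B. representation B v b * representation C (f b) c)"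
proof -
  interpret f: Vector_Spaces.linear scale scale f by fact
  have fin: "finite B" using B(1) by (rule finiteI_independent)
  have "f v = f (\<Sum>b\<in>B. representation B v b *s b)"
    using sum_representation_eq[OF B fin order_refl] by simp
  also have "\<dots> = (\<Sum>b\<in>B. representation B v b *s f b)" by (simp add: f.sum f.scale)
  finally have "representation C (f v) = representation C (\<Sum>b\<in>B. representation B v b *s f b)" by simp
  also have "\<dots> = (\<lambda>c. \<Sum>b\<in>B. representation C (representation B v b *s f b) c)"
    by (rule representation_sum) (use C in \<open>auto intro: span_scale\<close>)
  finally show ?thesis using C by (simp add: representation_scale cong: sum.cong)
qed

lemma trace_on_same_span:
  assumes f: "endo f" and "independent B" "independent C" "span B = span C"
    and "f ` span B \<subseteq> span B"
  shows "trace_on B f = trace_on C f"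
proof -
  have id: "endo (\<lambda>x. x)" by (rule linear_ident)
  have B: "b \<in> B \<Longrightarrow> b \<in> span C" for b using assms(4) span_base by blast
  have C: "c \<in> C \<Longrightarrow> c \<in> span B" for c using assms(4) span_base by blast
  have fB: "b \<in> B \<Longrightarrow> f b \<in> span C" for b using assms(4,5) span_base by blast
  have "trace_on B f = (\<Sum>b\<in>B. \<Sum>c\<in>C. representation C (f b) c * representation B c b)"
    unfolding trace_on_def using fB C
    by (intro sum.cong refl representation_linear[OF id]) (use assms(2,3) in auto)
  also have "\<dots> = (\<Sum>c\<in>C. \<Sum>b\<in>B. representation B c b * representation C (f b) c)"
    by (subst sum.swap) (simp add: mult.commute)
  also have "\<dots> = trace_on C f"
    unfolding trace_on_def using fB C
    by (intro sum.cong refl representation_linear[OF f, symmetric]) (use assms(2,3) in auto)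
  finally show ?thesis .
qed

lemma trace_on_commute:
  assumes f: "endo f" and g: "endo g" and B: "independent B"
    and "f ` span B \<subseteq> span B" "g ` span B \<subseteq> span B"
  shows "trace_on B (\<lambda>x. f (g x)) = trace_on B (\<lambda>x. g (f x))"
proof -
  have fB: "b \<in> B \<Longrightarrow> f b \<in> span B" for b using assms(4) span_base by blast
  have gB: "b \<in> B \<Longrightarrow> g b \<in> span B" for b using assms(5) span_base by blast
  have "trace_on B (\<lambda>x. f (g x)) = (\<Sum>b\<in>B. \<Sum>c\<in>B. representation B (g b) c * representation B (f c) b)"
    unfolding trace_on_def using fB gB B by (intro sum.cong refl representation_linear[OF f]) auto
  also have "\<dots> = (\<Sum>c\<in>B. \<Sum>b\<in>B. representation B (f c) b * representation B (g b) c)"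
    by (subst sum.swap) (simp add: mult.commute)
  also have "\<dots> = trace_on B (\<lambda>x. g (f x))"
    unfolding trace_on_def using fB gB B
    by (intro sum.cong refl representation_linear[OF g, symmetric]) auto
  finally show ?thesis .
qed

lemma trace_on_add:
  assumes "independent B" "\<And>b. b \<in> B \<Longrightarrow> f b \<in> span B" "\<And>b. b \<in> B \<Longrightarrow> g b \<in> span B"
  shows "trace_on B (\<lambda>x. f x + g x) = trace_on B f + trace_on B g"
  using assms by (simp add: trace_on_def representation_add sum.distrib)

lemma trace_on_diff:
  assumes "independent B" "\<And>b. b \<in> B \<Longrightarrow> f b \<in> span B" "\<And>b. b \<in> B \<Longrightarrow> g b \<in> span B"
  shows "trace_on B (\<lambda>x. f x - g x) = trace_on B f - trace_on B g"
  using assms by (simp add: trace_on_def representation_diff sum_subtractf)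

lemma trace_on_scale:
  assumes "independent B" "\<And>b. b \<in> B \<Longrightarrow> f b \<in> span B"
  shows "trace_on B (\<lambda>x. c *s f x) = c * trace_on B f"
  using assms by (simp add: trace_on_def representation_scale sum_distrib_left)

lemma trace_on_scalar: "independent B \<Longrightarrow> trace_on B (\<lambda>x. c *s x) = of_nat (card B) * c"
  by (simp add: trace_on_def representation_scale representation_basis span_base)

lemma trace_on_UN:
  assumes ind: "independent (\<Union>i\<in>I. B i)" and "finite I"
    and dis: "\<And>i j. i \<in> I \<Longrightarrow> j \<in> I \<Longrightarrow> i \<noteq> j \<Longrightarrow> B i \<inter> B j = {}"
    and st: "\<And>i b. i \<in> I \<Longrightarrow> b \<in> B i \<Longrightarrow> f b \<in> span (B i)"
  shows "trace_on (\<Union>i\<in>I. B i) f = (\<Sum>i\<in>I. trace_on (B i) f)"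
proof -
  let ?B = "\<Union>i\<in>I. B i"
  have fin: "finite (B i)" if "i \<in> I" for i
    using finiteI_independent[OF ind] that by (meson UN_upper finite_subset)
  have "trace_on ?B f = (\<Sum>i\<in>I. \<Sum>b\<in>B i. representation ?B (f b) b)"
    unfolding trace_on_def by (rule sum.UNION_disjoint) (use assms fin in auto)
  also have "\<dots> = (\<Sum>i\<in>I. trace_on (B i) f)"
    unfolding trace_on_def
    by (intro sum.cong refl fun_cong[OF representation_extend[OF ind]]) (use st in auto)
  finally show ?thesis .
qed

text \<open>Unless the span is 0, the image of \<open>f\<close> is a proper invariant subspace, for
  otherwise all powers of \<open>f\<close> would be onto. Extend a basis \<open>C\<close> of the
  image to a basis of the span: every value of \<open>f\<close> lies in \<open>span C\<close>, so
  the vectors outside \<open>C\<close> have diagonal entry 0 and the induction applies to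
  \<open>C\<close>.\<close>

lemma trace_on_nilpotent:
  assumes f: "endo f"
  shows "independent B \<Longrightarrow> f ` span B \<subseteq> span B \<Longrightarrow> (\<And>x. x \<in> span B \<Longrightarrow> (f ^^ n) x = 0) \<Longrightarrow>
    trace_on B f = 0"
proof (induction "card B" arbitrary: B rule: less_induct)
  case less
  interpret f: Vector_Spaces.linear scale scale f by fact
  let ?U = "f ` span B"
  have subU: "subspace ?U" by (rule f.subspace_image) simp
  show ?case
  proof (cases "?U = span B")
    case True
    have "(f ^^ n) ` span B = span B" for n
    proof (induction n)
      case (Suc n)
      have "(f ^^ Suc n) ` span B = f ` (f ^^ n) ` span B" by (simp add: image_comp)
      then show ?case unfolding Suc True .
    qed simp
    moreover have "(f ^^ n) ` span B \<subseteq> {0}" using less.prems(3) by blast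
    ultimately have "span B \<subseteq> {0}" by metis
    then have "B = {}" using less.prems(1) dependent_zero span_base by blast
    then show ?thesis by (simp add: trace_on_def)
  next
    case False
    from subU obtain C where C: "C \<subseteq> ?U" "independent C" "span C = ?U"
      by (rule subspace_basisE)
    obtain B' where B': "C \<subseteq> B'" "B' \<subseteq> span B" "independent B'" "span B \<subseteq> span B'"
      using maximal_independent_subset_extend[OF order_trans[OF C(1) less.prems(2)] C(2)] by blast
    have sp: "span B = span B'" using B'(4) span_minimal[OF B'(2) subspace_span] by (rule equalityI)
    have "trace_on B f = trace_on B' f"
      by (rule trace_on_same_span[OF f less.prems(1) B'(3) sp less.prems(2)])
    also have "\<dots> = (\<Sum>b\<in>B'. representation C (f b) b)"
      unfolding trace_on_def
      by (intro sum.cong refl fun_cong[OF representation_extend[OF B'(3) _ B'(1)]])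
        (use C(3) B'(2) in blast)
    also have "\<dots> = trace_on C f"
      unfolding trace_on_def using B'(1) finiteI_independent[OF B'(3)]
      by (intro sum.mono_neutral_right) (auto dest: representation_ne_zero)
    also have "\<dots> = 0"
    proof (rule less.hyps)
      have eU: "span ?U = ?U" using subU by simp
      have "card C = dim ?U" using dim_span_eq_card_independent[OF C(2)] C(3) by metis
      also have "\<dots> < dim (span B)"
        using False less.prems(2) by (intro dim_psubset, unfold eU span_span psubset_eq) simp
      also have "\<dots> = card B" using less.prems(1) by (simp add: dim_eq_card_independent)
      finally show "card C < card B" .
      show "f ` span C \<subseteq> span C" unfolding C(3) using less.prems(2) by (rule image_mono)
      show "(f ^^ n) x = 0" if "x \<in> span C" for x
        using that less.prems(2,3) unfolding C(3) by blast
    qed (rule C(2))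
    finally show ?thesis .
  qed
qed

lemma funpow_uniform:
  assumes f: "endo f" and "subspace V" and nil: "\<And>x. x \<in> V \<Longrightarrow> \<exists>n. (f ^^ n) x = 0"
  shows "\<exists>n. \<forall>x\<in>V. (f ^^ n) x = 0"
proof -
  from assms(2) obtain B where B: "B \<subseteq> V" "independent B" "span B = V"
    by (rule subspace_basisE)
  have "\<forall>b\<in>B. \<exists>n. (f ^^ n) b = 0" using nil B(1) by blast
  then obtain m where m: "\<And>b. b \<in> B \<Longrightarrow> (f ^^ m b) b = 0" by metis
  have fin: "finite B" using B(2) by (rule finiteI_independent)
  define n where "n = (\<Sum>b\<in>B. m b)"
  interpret fn: Vector_Spaces.linear scale scale "f ^^ n" by (rule linear_funpow[OF f])
  have z: "(f ^^ n) b = 0" if "b \<in> B" for b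
    using m[OF that] by (rule funpow_zero_mono[OF f]) (simp add: n_def member_le_sum fin that)
  have "\<forall>x\<in>V. (f ^^ n) x = 0"
  proof
    fix x assume "x \<in> V"
    then show "(f ^^ n) x = 0" unfolding B(3)[symmetric] by (rule fn.eq_0_on_span[of B, rotated]) (rule z)
  qed
  then show ?thesis ..
qed

text \<open>On the span of \<open>B\<close> the operator f - c is nilpotent, with one exponent for
  all vectors, so its trace vanishes.\<close>

lemma trace_on_gen_eigenspace:
  assumes f: "endo f" and B: "independent B" "f ` span B \<subseteq> span B"
    and "B \<subseteq> gen_eigenspace f c"
  shows "trace_on B f = of_nat (card B) * c"
proof -
  let ?T = "\<lambda>y. f y - c *s y"
  have T: "endo ?T" by (rule linear_minus_scale[OF f])
  have "span B \<subseteq> gen_eigenspace f c"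
    by (rule span_minimal) (use assms gen_eigenspace_subspace[OF f] in auto)
  then obtain n where n: "\<forall>x\<in>span B. (?T ^^ n) x = 0"
    using funpow_uniform[OF T subspace_span[of B]] unfolding gen_eigenspace_def by blast
  have st: "f b \<in> span B" if "b \<in> span B" for b using B(2) that by blast
  have "trace_on B ?T = 0"
    by (rule trace_on_nilpotent[OF T B(1), of n]) (use n st in \<open>auto intro: span_diff span_scale\<close>)
  moreover have "trace_on B ?T = trace_on B f - trace_on B (\<lambda>y. c *s y)"
    by (rule trace_on_diff) (use B(1) st in \<open>auto intro: span_scale span_base\<close>)
  ultimately show ?thesis using trace_on_scalar[OF B(1), of c] by simp
qed

text \<open>The images of a basis span \<open>V\<close>, so there are at least as many as the
  dimension; hence they are distinct and independent.\<close>

lemma inj_on_if_surj_on: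
  assumes f: "endo f" and "subspace V" and sur: "f ` V = V"
  shows "inj_on f V"
proof -
  interpret f: Vector_Spaces.linear scale scale f by fact
  from assms(2) obtain B where B: "B \<subseteq> V" "independent B" "span B = V"
    by (rule subspace_basisE)
  have fin: "finite B" using B(2) by (rule finiteI_independent)
  have sp: "span (f ` B) = V" using f.span_image[of B] sur B(3) by simp
  have d: "dim V = card B" using B by (metis dim_span_eq_card_independent)
  have "dim V \<le> card (f ` B)" using fin sp by (intro dim_le_card) auto
  then have c: "card (f ` B) = card B" using d card_image_le[OF fin, of f] by linarith
  then have "inj_on f B" using fin by (simp add: inj_on_iff_eq_card)
  moreover have "independent (f ` B)"
    using card_le_dim_spanning[of "f ` B" V] sp c d fin span_superset by auto
  ultimately show ?thesis using f.inj_on_span_iff_independent_image[of B] B(3) by simp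
qed

text \<open>In finite dimension some iterate of \<open>f\<close> on \<open>v\<close> depends
  linearly on the earlier ones; the dependence is read as a monic polynomial.\<close>

lemma exists_annihilating_poly:
  "\<exists>p. p \<noteq> 0 \<and> poly_apply f p v = 0"
proof -
  define w where "w = (\<lambda>i. (f ^^ i) v)"
  have "\<exists>k. w k \<in> span (w ` {..<k})"
  proof (rule ccontr)
    assume "\<not> ?thesis"
    then have n: "w k \<notin> span (w ` {..<k})" for k by simp
    have "independent (w ` {..<k}) \<and> card (w ` {..<k}) = k" for k
    proof (induction k)
      case (Suc k)
      have "w k \<notin> w ` {..<k}" using n[of k] span_base[of "w k" "w ` {..<k}"] by argo
      then have "card (insert (w k) (w ` {..<k})) = Suc k" using Suc by (subst card_insert_disjoint) auto
      moreover have "independent (insert (w k) (w ` {..<k}))"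
        by (rule independent_insertI[OF n conjunct1[OF Suc]])
      ultimately show ?case unfolding lessThan_Suc image_insert by (rule conjI[rotated])
    qed (simp add: independent_empty)
    then show False
      using independent_card_le_dim[OF subset_UNIV, of "w ` {..<Suc (dim UNIV)}"] by simp
  qed
  then obtain k where "w k \<in> span (w ` {..<k})" ..
  from span_image_lessThan[OF this] obtain a where a: "w k = (\<Sum>i<k. a i *s w i)" ..
  define p where "p = monom 1 k - (\<Sum>i<k. monom (a i) i)"
  have c: "coeff p i = (if i = k then 1 else if i < k then - a i else 0)" for i
  proof -
    have "coeff (\<Sum>i<k. monom (a i) i) i = (\<Sum>j<k. if j = i then a j else 0)"
      by (simp add: coeff_sum)
    then show ?thesis by (auto simp: p_def)
  qed
  have p0: "p \<noteq> 0" using c[of k] by auto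
  have "degree p \<le> k" using c by (intro degree_le) auto
  then have "poly_apply f p v = (\<Sum>i\<le>k. coeff p i *s w i)" by (simp add: poly_apply_bound w_def)
  then have "poly_apply f p v = (\<Sum>i<k. coeff p i *s w i) + coeff p k *s w k"
    unfolding lessThan_Suc_atMost[symmetric] sum.lessThan_Suc .
  also have "(\<Sum>i<k. coeff p i *s w i) = (\<Sum>i<k. - (a i *s w i))"
    by (rule sum.cong) (auto simp: c)
  finally have "poly_apply f p v = 0" using a by (simp add: sum_negf c)
  with p0 show ?thesis by blast
qed

end

section \<open>Primary decomposition over an algebraically closed field\<close>

locale acf_space = fd_space scale Basis
  for scale :: "'a::alg_closed_field \<Rightarrow> 'b::ab_group_add \<Rightarrow> 'b" (infixr "*s" 75) and Basis
begin

text \<open>Take an annihilating polynomial of \<open>v\<close> of least degree and split off a root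
  c, leaving the factor \<open>q\<close>. Applying \<open>q\<close> to \<open>f\<close> and then to
  \<open>v\<close> gives a vector that is nonzero by minimality and killed by f - c.\<close>

lemma exists_eigenvector:
  assumes f: "endo f" and V: "subspace V" "f ` V \<subseteq> V" and "v \<in> V" "v \<noteq> 0"
  shows "\<exists>c. \<exists>x\<in>V. x \<noteq> 0 \<and> f x = c *s x"
proof -
  from exists_annihilating_poly[of f v] obtain p0 where "p0 \<noteq> 0 \<and> poly_apply f p0 v = 0" ..
  from ex_has_least_nat[of "\<lambda>p. p \<noteq> 0 \<and> poly_apply f p v = 0" p0 degree, OF this]
  obtain p where pm: "(p \<noteq> 0 \<and> poly_apply f p v = 0) \<and>
    (\<forall>q. q \<noteq> 0 \<and> poly_apply f q v = 0 \<longrightarrow> degree p \<le> degree q)" ..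
  note p = conjunct1[OF pm] and min = conjunct2[OF pm, rule_format]
  have "degree p \<noteq> 0"
  proof
    assume "degree p = 0"
    then obtain a where "p = [:a:]" by (rule degree_eq_zeroE)
    then show False using p \<open>v \<noteq> 0\<close> by (simp add: poly_apply_def)
  qed
  then obtain c where "poly p c = 0" using alg_closed_imp_poly_has_root[of p] by auto
  then have "[:- c, 1:] dvd p" by (simp add: poly_eq_0_iff_dvd)
  then obtain q where q: "p = [:- c, 1:] * q" by (rule dvdE)
  with p have "q \<noteq> 0" by auto
  have "degree p = degree [:- c, 1:] + degree q"
    unfolding q by (rule degree_mult_eq) (use \<open>q \<noteq> 0\<close> in auto)
  then have "\<not> degree p \<le> degree q" by simp
  with min[of q] \<open>q \<noteq> 0\<close> have n0: "poly_apply f q v \<noteq> 0" by metis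
  have "f (poly_apply f q v) = c *s poly_apply f q v"
    using p poly_apply_linear_factor[OF f, of c q v] q by simp
  then show ?thesis using n0 poly_apply_closed[OF V \<open>v \<in> V\<close>, of q] by metis
qed

text \<open>Fitting decomposition. The images \<open>R n\<close> of the powers of T = f - c, for an
  eigenvalue c on \<open>V\<close>, stabilize at some \<open>R N\<close>. There \<open>T\<close> is
  injective, so the eigenvector \<open>x\<close> is not in it, and the induction applies to
  \<open>R N\<close>; the complement is killed by a power of \<open>T\<close>.\<close>

lemma gen_eigenspace_decomposition:
  assumes f: "endo f"
  shows "subspace V \<Longrightarrow> f ` V \<subseteq> V \<Longrightarrow> V \<subseteq> span (\<Union>c. V \<inter> gen_eigenspace f c)"
proof (induction "dim V" arbitrary: V rule: less_induct)
  case less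
  show ?case
  proof (cases "V \<subseteq> {0}")
    case True
    then show ?thesis using span_zero by blast
  next
    case False
    then obtain v where "v \<in> V" "v \<noteq> 0" by blast
    from exists_eigenvector[OF f less.prems this] obtain c x where
      x: "x \<in> V" "x \<noteq> 0" "f x = c *s x" by blast
    define T where "T = (\<lambda>y. f y - c *s y)"
    have T: "endo T" unfolding T_def by (rule linear_minus_scale[OF f])
    interpret T: Vector_Spaces.linear scale scale T by (rule T)
    interpret Tn: Vector_Spaces.linear scale scale "T ^^ n" for n by (rule linear_funpow[OF T])
    have TV: "T ` V \<subseteq> V" unfolding T_def
      using less.prems by (auto intro: subspace_diff subspace_scale)
    define R where "R n = (T ^^ n) ` V" for n
    have subR: "subspace (R n)" for n unfolding R_def by (rule Tn.subspace_image) (rule less.prems)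
    have Rsuc: "R (Suc n) = T ` R n" for n by (auto simp: R_def)
    have Rle: "R (Suc n) \<subseteq> R n" for n
    proof (induction n)
      case 0 show ?case using TV by (simp add: R_def)
    next
      case (Suc n) then show ?case using Rsuc by (metis image_mono)
    qed
    have "\<exists>n. R (Suc n) = R n"
    proof (rule ccontr)
      assume "\<nexists>n. R (Suc n) = R n"
      then have ps: "R (Suc n) \<subset> R n" for n using Rle by blast
      have "dim (R n) + n \<le> dim (R 0)" for n
      proof (induction n)
        case (Suc n)
        have "dim (R (Suc n)) < dim (R n)"
          using ps[of n] subR by (intro dim_psubset) (simp add: span_eq_iff[THEN iffD2])
        then show ?case using Suc by linarith
      qed simp
      from this[of "Suc (dim (R 0))"] show False by linarith
    qed
    then obtain N where N: "R (Suc N) = R N" ..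
    have RN: "R (k + N) = R N" for k
    proof (induction k)
      case (Suc k) then show ?case using Rsuc N by (metis add_Suc)
    qed simp
    have RV: "R n \<subseteq> V" for n
    proof (induction n)
      case (Suc n)
      then show ?case by (rule order_trans[OF Rle])
    qed (simp add: R_def)
    have "x \<notin> R N"
    proof
      assume "x \<in> R N"
      have "inj_on T (R N)" by (rule inj_on_if_surj_on[OF T subR]) (use Rsuc N in simp)
      moreover have "T x = T 0" unfolding T.zero using x(3) by (simp add: T_def)
      ultimately show False
        using \<open>x \<in> R N\<close> subspace_0[OF subR] x(2) by (metis inj_onD)
    qed
    have "dim (R N) < dim V"
      using RV[of N] \<open>x \<notin> R N\<close> x(1) subR less.prems(1)
      by (intro dim_psubset) (metis psubsetI span_eq_iff)
    moreover have "f ` R N \<subseteq> R N"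
    proof
      fix y assume "y \<in> f ` R N"
      then obtain z where z: "z \<in> R N" "y = f z" by blast
      then have "T z \<in> R N" using Rsuc N by blast
      moreover have "y = T z + c *s z" using z by (simp add: T_def)
      ultimately show "y \<in> R N" using z subR by (simp add: subspace_add subspace_scale)
    qed
    ultimately have IH: "R N \<subseteq> span (\<Union>c. R N \<inter> gen_eigenspace f c)"
      using less.hyps subR by blast
    also have "\<dots> \<subseteq> span (\<Union>c. V \<inter> gen_eigenspace f c)" by (rule span_mono) (use RV in blast)
    finally have R_sub: "R N \<subseteq> span (\<Union>c. V \<inter> gen_eigenspace f c)" .
    show ?thesis
    proof
      fix y assume y: "y \<in> V"
      \<comment> \<open>Stability turns the N-th power of \<open>T\<close> at \<open>y\<close> into
        a 2N-th power at some \<open>z\<close>, so \<open>y\<close> differs from an element of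
        \<open>R N\<close> by a vector killed by the N-th power.\<close>
      have "(T ^^ N) y \<in> R (N + N)" using y RN by (auto simp: R_def)
      then obtain z where z: "z \<in> V" "(T ^^ N) y = (T ^^ N) ((T ^^ N) z)"
        by (auto simp: R_def funpow_add)
      have "(T ^^ N) (y - (T ^^ N) z) = 0" using z by (simp add: Tn.diff)
      moreover have "y - (T ^^ N) z \<in> V"
        using y z RV by (intro subspace_diff less.prems) (auto simp: R_def)
      ultimately have "y - (T ^^ N) z \<in> V \<inter> gen_eigenspace f c"
        unfolding gen_eigenspace_def T_def by blast
      then have "y - (T ^^ N) z \<in> span (\<Union>c. V \<inter> gen_eigenspace f c)" by (intro span_base) blast
      moreover have "(T ^^ N) z \<in> span (\<Union>c. V \<inter> gen_eigenspace f c)"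
        using R_sub z(1) by (auto simp: R_def)
      ultimately show "y \<in> span (\<Union>c. V \<inter> gen_eigenspace f c)"
        using span_add by fastforce
    qed
  qed
qed

end

section \<open>Weight spaces of a Cartan subalgebra\<close>

locale fd_lie_algebra = lie_algebra s br + acf_space s Basis
  for s :: "'k::{alg_closed_field,field_char_0} \<Rightarrow> 'g::ab_group_add \<Rightarrow> 'g" (infixr "*s" 75)
    and br :: "'g \<Rightarrow> 'g \<Rightarrow> 'g" and Basis
begin

lemma linear_br: "endo (br x)"
  unfolding Vector_Spaces.linear_iff using vector_space_axioms
  by (auto simp: br_add_right br_scale_right)

lemma br_sum_left: "br (\<Sum>i\<in>I. f i) x = (\<Sum>i\<in>I. br (f i) x)"
  by (induction I rule: infinite_finite_induct) (simp_all add: br_add_left)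

lemma br_sum_right: "br x (\<Sum>i\<in>I. f i) = (\<Sum>i\<in>I. br x (f i))"
  by (induction I rule: infinite_finite_induct) (simp_all add: br_add_right)

lemma gen_eigenspace_step:
  assumes "f z - c *s z \<in> gen_eigenspace f c"
  shows "z \<in> gen_eigenspace f c"
proof -
  obtain n where "((\<lambda>y. f y - c *s y) ^^ n) (f z - c *s z) = 0"
    using assms unfolding gen_eigenspace_def by blast
  then have "((\<lambda>y. f y - c *s y) ^^ Suc n) z = 0"
    unfolding funpow_Suc_right o_apply .
  then show ?thesis unfolding gen_eigenspace_def by blast
qed

text \<open>ad h - (a + b) maps [x, y] to [(ad h - a) x, y] + [x, (ad h - b) y]. Each summand has a
  smaller total exponent m + n, and \<open>gen_eigenspace_step\<close> returns from the image to
  [x, y].\<close>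

lemma gen_eigenspace_br:
  assumes "x \<in> gen_eigenspace (br h) a" "y \<in> gen_eigenspace (br h) b"
  shows "br x y \<in> gen_eigenspace (br h) (a + b)"
proof -
  let ?T = "\<lambda>c y. br h y - c *s y"
  note sub = gen_eigenspace_subspace[OF linear_br]
  have "br x y \<in> gen_eigenspace (br h) (a + b)"
    if "(?T a ^^ m) x = 0" "(?T b ^^ n) y = 0" for m n
    using that
  proof (induction "m + n" arbitrary: m n x y rule: less_induct)
    case less
    show ?case
    proof (cases "m = 0 \<or> n = 0")
      case True
      then show ?thesis using less.prems subspace_0[OF sub] by auto
    next
      case False
      then obtain i j where ij: "m = Suc i" "n = Suc j" by (metis not0_implies_Suc)
      have "br (?T a x) y \<in> gen_eigenspace (br h) (a + b)"
        by (rule less.hyps[of i n]) (use less.prems ij in \<open>simp_all del: funpow.simps add: funpow_Suc_right\<close>)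
      moreover have "br x (?T b y) \<in> gen_eigenspace (br h) (a + b)"
        by (rule less.hyps[of m j]) (use less.prems ij in \<open>simp_all del: funpow.simps add: funpow_Suc_right\<close>)
      ultimately have "br (?T a x) y + br x (?T b y) \<in> gen_eigenspace (br h) (a + b)"
        by (rule subspace_add[OF sub])
      also have "br (?T a x) y + br x (?T b y) = br h (br x y) - (a + b) *s br x y"
        by (simp add: br_diff br_scale_left br_scale_right br_br scale_left_distrib)
      finally show ?thesis by (rule gen_eigenspace_step)
    qed
  qed
  then show ?thesis using assms unfolding gen_eigenspace_def by blast
qed

end

section \<open>The weight decomposition for a nilpotent self-normalizing subalgebra\<close>

locale cartan_lie_algebra = fd_lie_algebra s br Basis
  for s :: "'k::{alg_closed_field,field_char_0} \<Rightarrow> 'g::ab_group_add \<Rightarrow> 'g" (infixr "*s" 75)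
    and br Basis +
  fixes H
  assumes cartan: "cartan_subalgebra s br H"
begin

lemma H_subspace: "subspace H" and H_br: "x \<in> H \<Longrightarrow> y \<in> H \<Longrightarrow> br x y \<in> H"
  using cartan unfolding cartan_subalgebra_def lie_subalgebra_def by blast+

lemma H_self_normalizing: "(\<And>h. h \<in> H \<Longrightarrow> br x h \<in> H) \<Longrightarrow> x \<in> H"
  using cartan unfolding cartan_subalgebra_def by blast

abbreviation LC where "LC \<equiv> lower_central s br H"

lemma LC_eventually_zero: "\<exists>n. LC n = {0}"
  using cartan unfolding cartan_subalgebra_def by blast

lemma br_LC: "x \<in> H \<Longrightarrow> y \<in> LC n \<Longrightarrow> br x y \<in> LC (Suc n)"
  by (auto simp: bracket_span_def intro!: span_base)

lemma LC_subset_H: "LC n \<subseteq> H"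
proof (induction n)
  case (Suc n)
  then show ?case
    unfolding lower_central.simps bracket_span_def
    by (intro span_minimal H_subspace) (use H_br in blast)
qed simp

lemma H_subset_gen_eigenspace:
  assumes "h \<in> H" "h' \<in> H"
  shows "h' \<in> gen_eigenspace (br h) 0"
proof -
  have "(br h ^^ n) h' \<in> LC n" for n
  proof (induction n)
    case (Suc n)
    from br_LC[OF assms(1) Suc] show ?case by simp
  qed (simp add: assms)
  then obtain n where "(br h ^^ n) h' = 0" using LC_eventually_zero by blast
  then show ?thesis unfolding gen_eigenspace_def by auto
qed

text \<open>A generalized weight space, since elements of \<open>H\<close> are not yet known to act
  diagonalizably; \<open>wsp_root_space\<close> later identifies it with a root space. Only the
  values of \<open>l\<close> on \<open>H\<close> matter.\<close>

definition wsp :: "('g \<Rightarrow> 'k) \<Rightarrow> 'g set"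
  where "wsp l = {x. \<forall>h\<in>H. x \<in> gen_eigenspace (br h) (l h)}"

text \<open>Vanishing outside \<open>H\<close> is a normalization: distinct members then differ at
  some element of \<open>H\<close>. The zero functional is not excluded.\<close>

definition weights :: "('g \<Rightarrow> 'k) set"
  where "weights = {l. (\<forall>x. x \<notin> H \<longrightarrow> l x = 0) \<and> wsp l \<noteq> {0}}"

lemma wsp_subspace: "subspace (wsp l)"
proof -
  have "wsp l = (\<Inter>h\<in>H. gen_eigenspace (br h) (l h))" by (auto simp: wsp_def)
  then show ?thesis by (simp add: subspace_Int gen_eigenspace_subspace[OF linear_br])
qed

lemma wsp_0: "0 \<in> wsp l" by (rule subspace_0[OF wsp_subspace])

lemma wsp_br: "x \<in> wsp l \<Longrightarrow> y \<in> wsp m \<Longrightarrow> br x y \<in> wsp (l + m)"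
  by (simp add: wsp_def gen_eigenspace_br)

lemma H_subset_wsp: "H \<subseteq> wsp 0"
  by (auto simp: wsp_def intro: H_subset_gen_eigenspace)

lemma wsp_stable: "h \<in> H \<Longrightarrow> x \<in> wsp l \<Longrightarrow> br h x \<in> wsp l"
  using wsp_br[of h 0 x l] H_subset_wsp by auto

lemma gen_eigenspace_stable_H:
  assumes "h \<in> H" "h' \<in> H" "x \<in> gen_eigenspace (br h) c"
  shows "br h' x \<in> gen_eigenspace (br h) c"
  using gen_eigenspace_br[OF H_subset_gen_eigenspace[OF assms(1,2)] assms(3)] by simp

text \<open>Either some \<open>h\<close> cuts \<open>V\<close> into strictly smaller generalized
  eigenspaces, which are again stable under \<open>H\<close> because \<open>H\<close> has
  generalized eigenvalue 0 under ad h, or every \<open>h\<close> has a single eigenvalue on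
  \<open>V\<close>, which then lies in one weight space.\<close>

lemma wsp_decomposition_stable:
  "subspace V \<Longrightarrow> (\<And>h x. h \<in> H \<Longrightarrow> x \<in> V \<Longrightarrow> br h x \<in> V) \<Longrightarrow>
    V \<subseteq> span (\<Union>l\<in>{l. \<forall>x. x \<notin> H \<longrightarrow> l x = 0}. V \<inter> wsp l)"
proof (induction "dim V" arbitrary: V rule: less_induct)
  case less
  let ?E = "{l :: 'g \<Rightarrow> 'k. \<forall>x. x \<notin> H \<longrightarrow> l x = 0}"
  let ?S = "span (\<Union>l\<in>?E. V \<inter> wsp l)"
  show ?case
  proof (cases "\<exists>h\<in>H. \<forall>c. \<not> V \<subseteq> gen_eigenspace (br h) c")
    case True
    then obtain h where h: "h \<in> H" "\<And>c. \<not> V \<subseteq> gen_eigenspace (br h) c" by blast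
    have "V \<inter> gen_eigenspace (br h) c \<subseteq> ?S" for c
    proof -
      let ?V = "V \<inter> gen_eigenspace (br h) c"
      have sub: "subspace ?V"
        by (rule subspace_inter[OF less.prems(1) gen_eigenspace_subspace[OF linear_br]])
      have "?V \<subset> V" using h(2) by blast
      then have "span ?V \<subset> span V" using sub less.prems(1) by (metis span_eq_iff)
      then have "dim ?V < dim V" by (rule dim_psubset)
      then have "?V \<subseteq> span (\<Union>l\<in>?E. ?V \<inter> wsp l)"
        by (rule less.hyps) (use sub less.prems(2) gen_eigenspace_stable_H h(1) in auto)
      also have "\<dots> \<subseteq> ?S" by (rule span_mono) auto
      finally show ?thesis .
    qed
    then have "span (\<Union>c. V \<inter> gen_eigenspace (br h) c) \<subseteq> ?S"
      by (intro span_minimal) auto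
    moreover have "V \<subseteq> span (\<Union>c. V \<inter> gen_eigenspace (br h) c)"
      by (rule gen_eigenspace_decomposition[OF linear_br less.prems(1)]) (use less.prems(2) h(1) in auto)
    ultimately show ?thesis by (rule order_trans[rotated])
  next
    case False
    then have "\<forall>h\<in>H. \<exists>c. V \<subseteq> gen_eigenspace (br h) c" by blast
    then obtain l where l: "\<And>h. h \<in> H \<Longrightarrow> V \<subseteq> gen_eigenspace (br h) (l h)" by metis
    let ?l = "\<lambda>h. if h \<in> H then l h else 0"
    have "V \<inter> wsp ?l = V" using l by (auto simp: wsp_def)
    then have "V \<subseteq> (\<Union>l\<in>?E. V \<inter> wsp l)" by (intro subset_trans[OF _ UN_upper[of ?l]]) auto
    then show ?thesis using span_superset by (rule order_trans)
  qed
qed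

text \<open>For \<open>m\<close> in \<open>F\<close> choose \<open>h\<close> separating
  \<open>m\<close> from \<open>l0\<close>. A power of ad h - l0 h kills the term at
  \<open>l0\<close> and keeps the others in their weight spaces, so the hypothesis gives 0 at
  \<open>m\<close>; on the weight space of \<open>m\<close> this operator is injective.\<close>

lemma wsp_independent:
  assumes "finite F"
  shows "(\<And>l x. l \<in> F \<Longrightarrow> x \<notin> H \<Longrightarrow> l x = 0) \<Longrightarrow> (\<And>l. l \<in> F \<Longrightarrow> c l \<in> wsp l) \<Longrightarrow>
    (\<Sum>l\<in>F. c l) = 0 \<Longrightarrow> l \<in> F \<Longrightarrow> c l = 0"
  using assms
proof (induction F arbitrary: c l rule: finite_induct)
  case (insert l0 F)
  have z: "c m = 0" if m: "m \<in> F" for m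
  proof -
    have "m \<noteq> l0" using insert.hyps m by blast
    then obtain h where h: "m h \<noteq> l0 h" by blast
    then have hH: "h \<in> H" using insert.prems(1) m by (metis insertCI)
    let ?T = "\<lambda>y. br h y - l0 h *s y"
    have T: "endo ?T" by (rule linear_minus_scale[OF linear_br])
    have "c l0 \<in> gen_eigenspace (br h) (l0 h)"
      using insert.prems(2)[of l0] hH by (simp add: wsp_def)
    then obtain n where n: "(?T ^^ n) (c l0) = 0" unfolding gen_eigenspace_def by blast
    interpret Tn: Vector_Spaces.linear s s "?T ^^ n" by (rule linear_funpow[OF T])
    have w: "(?T ^^ k) x \<in> wsp p" if "x \<in> wsp p" for x p k
    proof (induction k)
      case (Suc k)
      then show ?case
        by (simp add: subspace_diff subspace_scale wsp_subspace wsp_stable[OF hH])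
    qed (simp add: that)
    have "(?T ^^ n) (\<Sum>l\<in>insert l0 F. c l) = 0" using insert.prems(3) by simp
    then have "(\<Sum>l\<in>F. (?T ^^ n) (c l)) = 0"
      using insert.hyps n by (simp add: Tn.sum Tn.add)
    then have "(?T ^^ n) (c m) = 0"
      by (intro insert.IH[where c = "\<lambda>l. (?T ^^ n) (c l)"] w insert.prems(1,2) m) auto
    moreover have "c m \<in> gen_eigenspace (br h) (m h)"
      using insert.prems(2)[of m] m hH by (simp add: wsp_def)
    ultimately show ?thesis using gen_eigenspace_inj[OF linear_br h[symmetric]] by blast
  qed
  moreover have "c l0 = 0" using insert.prems(3) insert.hyps z by simp
  ultimately show ?case using insert.prems(4) by blast
qed simp

lemma wsp_disjoint:
  assumes "\<And>x. x \<notin> H \<Longrightarrow> l x = 0" "\<And>x. x \<notin> H \<Longrightarrow> m x = 0" "l \<noteq> m" "x \<in> wsp l" "x \<in> wsp m"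
  shows "x = 0"
proof -
  let ?c = "\<lambda>p. if p = l then x else - x"
  have "?c l = 0"
    by (rule wsp_independent[of "{l, m}" ?c]) (use assms subspace_neg[OF wsp_subspace] in auto)
  then show ?thesis by simp
qed

lemma weights_outside: "l \<in> weights \<Longrightarrow> x \<notin> H \<Longrightarrow> l x = 0"
  by (simp add: weights_def)

lemma wsp_nonweight: "(\<And>x. x \<notin> H \<Longrightarrow> l x = 0) \<Longrightarrow> l \<notin> weights \<Longrightarrow> wsp l = {0}"
  by (auto simp: weights_def)

lemma weights_finite: "finite weights"
proof -
  have "\<forall>l\<in>weights. \<exists>x. x \<in> wsp l \<and> x \<noteq> 0"
    unfolding weights_def using wsp_0 by blast
  then obtain v where v: "\<And>l. l \<in> weights \<Longrightarrow> v l \<in> wsp l \<and> v l \<noteq> 0" by metis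
  have inj: "inj_on v weights"
  proof (rule inj_onI, rule ccontr)
    fix l m assume a: "l \<in> weights" "m \<in> weights" "v l = v m" "l \<noteq> m"
    have "v l = 0" by (rule wsp_disjoint[of l m]) (use a v weights_outside in metis)+
    then show False using v a by blast
  qed
  have "card F \<le> dim (UNIV :: 'g set)" if F: "finite F" "F \<subseteq> weights" for F
  proof -
    have i: "inj_on v F" using inj F(2) by (rule inj_on_subset)
    have "independent (v ` F)"
    proof (rule independent_if_scalars_zero)
      show "finite (v ` F)" using F by simp
      fix f x assume "(\<Sum>x\<in>v ` F. f x *s x) = 0" "x \<in> v ` F"
      then obtain l where l: "l \<in> F" "x = v l" and "(\<Sum>l\<in>F. f (v l) *s v l) = 0"
        using i by (auto simp: sum.reindex)
      then have "f (v l) *s v l = 0"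
        using F v by (intro wsp_independent[of F "\<lambda>l. f (v l) *s v l"])
          (auto intro: subspace_scale[OF wsp_subspace] weights_outside)
      then show "f x = 0" using v l F by auto
    qed
    then have "card (v ` F) \<le> dim (UNIV :: 'g set)" by (rule independent_card_le_dim[OF subset_UNIV])
    then show ?thesis using card_image[OF i] by simp
  qed
  then show ?thesis by (metis finite_if_finite_subsets_card_bdd)
qed

lemma span_wsp: "span (\<Union>l\<in>weights. wsp l) = UNIV"
proof -
  have "UNIV \<subseteq> span (\<Union>l\<in>{l. \<forall>x. x \<notin> H \<longrightarrow> l x = 0}. UNIV \<inter> wsp l)"
    by (rule wsp_decomposition_stable) auto
  also have "\<dots> \<subseteq> span (\<Union>l\<in>weights. wsp l)"
  proof (rule span_minimal)
    show "(\<Union>l\<in>{l. \<forall>x. x \<notin> H \<longrightarrow> l x = 0}. UNIV \<inter> wsp l) \<subseteq> span (\<Union>l\<in>weights. wsp l)"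
    proof
      fix x assume "x \<in> (\<Union>l\<in>{l. \<forall>x. x \<notin> H \<longrightarrow> l x = 0}. UNIV \<inter> wsp l)"
      then obtain l where l: "\<And>x. x \<notin> H \<Longrightarrow> l x = 0" "x \<in> wsp l" by blast
      show "x \<in> span (\<Union>l\<in>weights. wsp l)"
      proof (cases "l \<in> weights")
        case True then show ?thesis using l by (intro span_base) blast
      next
        case False then show ?thesis using wsp_nonweight[of l] l span_zero by auto
      qed
    qed
  qed simp
  finally show ?thesis by blast
qed

section \<open>Traces on weight spaces and linearity of weights\<close>

definition wbasis :: "('g \<Rightarrow> 'k) \<Rightarrow> 'g set"
  where "wbasis l = (SOME B. B \<subseteq> wsp l \<and> independent B \<and> span B = wsp l)"

lemma wbasis: "wbasis l \<subseteq> wsp l" "independent (wbasis l)" "span (wbasis l) = wsp l"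
proof -
  obtain B where "B \<subseteq> wsp l" "independent B" "span B = wsp l"
    by (rule subspace_basisE[OF wsp_subspace])
  then have "\<exists>B. B \<subseteq> wsp l \<and> independent B \<and> span B = wsp l" by (intro exI conjI)
  then have "wbasis l \<subseteq> wsp l \<and> independent (wbasis l) \<and> span (wbasis l) = wsp l"
    unfolding wbasis_def by (rule someI_ex)
  then show "wbasis l \<subseteq> wsp l" "independent (wbasis l)" "span (wbasis l) = wsp l" by simp_all
qed

definition wdim :: "('g \<Rightarrow> 'k) \<Rightarrow> nat"
  where "wdim l = card (wbasis l)"

lemma wbasis_finite: "finite (wbasis l)" by (rule finiteI_independent[OF wbasis(2)])

lemma wdim_pos: "l \<in> weights \<Longrightarrow> 0 < wdim l"
  using wbasis(3)[of l] wbasis_finite[of l] by (auto simp: wdim_def weights_def card_gt_0_iff)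

lemma wbasis_disjoint:
  assumes "l \<in> weights" "m \<in> weights" "l \<noteq> m"
  shows "wbasis l \<inter> wbasis m = {}"
proof (rule ccontr)
  assume "wbasis l \<inter> wbasis m \<noteq> {}"
  then obtain x where x: "x \<in> wbasis l" "x \<in> wbasis m" by blast
  have "x = 0"
    by (rule wsp_disjoint[of l m]) (use assms weights_outside x wbasis(1) in blast)+
  then show False using dependent_zero wbasis(2) x(1) by blast
qed

lemma wbasis_UN_independent:
  assumes J: "J \<subseteq> weights"
  shows "independent (\<Union>l\<in>J. wbasis l)"
proof -
  have fJ: "finite J" using J weights_finite by (rule finite_subset)
  show ?thesis
  proof (rule independent_if_scalars_zero)
    show "finite (\<Union>l\<in>J. wbasis l)" using fJ wbasis_finite by blast
    fix f x assume z: "(\<Sum>x\<in>(\<Union>l\<in>J. wbasis l). f x *s x) = 0" and x: "x \<in> (\<Union>l\<in>J. wbasis l)"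
    from x obtain l where l: "l \<in> J" "x \<in> wbasis l" by blast
    define c where "c l = (\<Sum>x\<in>wbasis l. f x *s x)" for l
    have "(\<Sum>l\<in>J. c l) = (\<Sum>x\<in>(\<Union>l\<in>J. wbasis l). f x *s x)"
      unfolding c_def
      by (rule sum.UNION_disjoint[symmetric]) (use fJ wbasis_finite wbasis_disjoint J in blast)+
    then have s0: "(\<Sum>l\<in>J. c l) = 0" using z by simp
    have cw: "c l \<in> wsp l" for l
      unfolding c_def using wbasis(1)[of l] by (intro subspace_sum subspace_scale wsp_subspace) auto
    have out: "\<And>l x. l \<in> J \<Longrightarrow> x \<notin> H \<Longrightarrow> l x = 0" using J weights_outside by blast
    have "c l = 0"
      by (rule wsp_independent[where F = J and c = c]) (use fJ out cw s0 l(1) in auto)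
    then have "(\<Sum>x\<in>wbasis l. f x *s x) = 0" by (simp add: c_def)
    then show "f x = 0" by (rule independentD[OF wbasis(2) wbasis_finite order_refl _ l(2)])
  qed
qed

lemma span_wbasis_UN: "span (\<Union>l\<in>J. wbasis l) = span (\<Union>l\<in>J. wsp l)"
proof (rule equalityI)
  show "span (\<Union>l\<in>J. wbasis l) \<subseteq> span (\<Union>l\<in>J. wsp l)" using wbasis(1) by (intro span_mono) blast
  have "wsp l \<subseteq> span (\<Union>l\<in>J. wbasis l)" if "l \<in> J" for l
    unfolding wbasis(3)[symmetric] using that by (intro span_mono) blast
  then show "span (\<Union>l\<in>J. wsp l) \<subseteq> span (\<Union>l\<in>J. wbasis l)" by (intro span_minimal) auto
qed

lemma trace_wbasis:
  assumes "h \<in> H"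
  shows "trace_on (wbasis l) (br h) = of_nat (wdim l) * l h"
  unfolding wdim_def
proof (rule trace_on_gen_eigenspace[OF linear_br wbasis(2)])
  show "br h ` span (wbasis l) \<subseteq> span (wbasis l)" using wsp_stable[OF assms] wbasis(3) by auto
  show "wbasis l \<subseteq> gen_eigenspace (br h) (l h)" using wbasis(1)[of l] assms by (auto simp: wsp_def)
qed

lemma trace_wbasis_UN:
  assumes "h \<in> H" and J: "J \<subseteq> weights"
  shows "trace_on (\<Union>l\<in>J. wbasis l) (br h) = (\<Sum>l\<in>J. of_nat (wdim l) * l h)"
proof -
  have "trace_on (\<Union>l\<in>J. wbasis l) (br h) = (\<Sum>l\<in>J. trace_on (wbasis l) (br h))"
  proof (rule trace_on_UN[OF wbasis_UN_independent[OF J]])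
    show "finite J" using J weights_finite by (rule finite_subset)
    show "wbasis i \<inter> wbasis j = {}" if "i \<in> J" "j \<in> J" "i \<noteq> j" for i j
      using that J wbasis_disjoint by blast
    show "br h b \<in> span (wbasis i)" if "b \<in> wbasis i" for i b
      using that wbasis(1)[of i] wsp_stable[OF assms(1)] wbasis(3) by blast
  qed
  then show ?thesis using trace_wbasis[OF assms(1)] by simp
qed

lemma br_wbasis: "h \<in> H \<Longrightarrow> b \<in> wbasis l \<Longrightarrow> br h b \<in> span (wbasis l)"
  unfolding wbasis(3) using wbasis(1) by (intro wsp_stable) auto

text \<open>The trace of ad h on the weight space is the dimension times l h. Traces are linear and
  vanish on commutators, and the dimension is invertible in characteristic 0.\<close>

lemma weight_linear:
  assumes "l \<in> weights" "h \<in> H" "h' \<in> H"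
  shows "l (h + h') = l h + l h'" "l (c *s h) = c * l h" "l (br h h') = 0"
proof -
  have d: "of_nat (wdim l) \<noteq> (0::'k)" using wdim_pos[OF assms(1)] by simp
  note t = trace_wbasis[of _ l]
  have "br (h + h') = (\<lambda>x. br h x + br h' x)" "br (c *s h) = (\<lambda>x. c *s br h x)"
    "br (br h h') = (\<lambda>x. br h (br h' x) - br h' (br h x))"
    by (auto simp: br_add_left br_scale_left br_br)
  note e = this
  have H: "h + h' \<in> H" "c *s h \<in> H" using assms H_subspace by (auto intro: subspace_add subspace_scale)
  have "of_nat (wdim l) * l (h + h') = of_nat (wdim l) * (l h + l h')"
    using trace_on_add[OF wbasis(2), of l "br h" "br h'"] br_wbasis assms
    unfolding e(1)[symmetric] t[OF H(1)] t[OF assms(2)] t[OF assms(3)] by (simp add: algebra_simps)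
  then show "l (h + h') = l h + l h'" using d by simp
  have "of_nat (wdim l) * l (c *s h) = of_nat (wdim l) * (c * l h)"
    using trace_on_scale[OF wbasis(2), of l "br h" c] br_wbasis assms
    unfolding e(2)[symmetric] t[OF H(2)] t[OF assms(2)] by (simp add: algebra_simps)
  then show "l (c *s h) = c * l h" using d by simp
  have st: "br k ` span (wbasis l) \<subseteq> span (wbasis l)" if "k \<in> H" for k
    using wsp_stable[OF that] wbasis(3) by auto
  have "of_nat (wdim l) * l (br h h') = 0"
    unfolding t[OF H_br[OF assms(2,3)], symmetric] e(3)
    using trace_on_commute[OF linear_br linear_br wbasis(2) st[OF assms(2)] st[OF assms(3)]]
    by (subst trace_on_diff[OF wbasis(2)])
      (use st assms(2,3) span_base[of _ "wbasis l"] in \<open>auto simp: image_subset_iff\<close>)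
  then show "l (br h h') = 0" using d by simp
qed

text \<open>
  Enlarge an ideal \<open>A\<close> of \<open>H\<close> one dimension at a time while keeping an element outside
  \<open>H\<close> that \<open>A\<close> maps into \<open>H\<close>; for \<open>A = H\<close> such an element contradicts self-normalization.
\<close>

lemma wsp_zero: "wsp 0 = H"
proof (rule ccontr)
  assume "wsp 0 \<noteq> H"
  then obtain x0 where x0: "x0 \<in> wsp 0" "x0 \<notin> H" using H_subset_wsp by blast
  define Q where "Q A \<longleftrightarrow> subspace A \<and> A \<subseteq> H \<and> (\<forall>h\<in>H. \<forall>a\<in>A. br h a \<in> A) \<and>
    (\<exists>x. x \<in> wsp 0 \<and> x \<notin> H \<and> (\<forall>a\<in>A. br a x \<in> H))" for A
  have "Q {0}" unfolding Q_def using x0 subspace_0[OF H_subspace] by auto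
  moreover have "\<forall>A. Q A \<longrightarrow> dim A < Suc dimension"
    by (simp add: less_Suc_eq_le dim_subset_UNIV)
  ultimately obtain A where A: "Q A" and mx: "\<And>A'. Q A' \<Longrightarrow> dim A' \<le> dim A"
    using ex_has_greatest_nat[of Q "{0}" dim] by metis
  then have sub: "subspace A" and AH: "A \<subseteq> H" and id: "\<And>h a. h \<in> H \<Longrightarrow> a \<in> A \<Longrightarrow> br h a \<in> A"
    unfolding Q_def by blast+
  obtain x where x: "x \<in> wsp 0" "x \<notin> H" "\<And>a. a \<in> A \<Longrightarrow> br a x \<in> H"
    using A unfolding Q_def by blast
  have "\<not> H \<subseteq> A"
  proof
    assume "H \<subseteq> A"
    have "x \<in> H"
    proof (rule H_self_normalizing)
      fix h assume "h \<in> H"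
      then have "br h x \<in> H" using x(3) \<open>H \<subseteq> A\<close> by blast
      then show "br x h \<in> H" unfolding br_swap[of x h] by (rule subspace_neg[OF H_subspace])
    qed
    then show False using x(2) by blast
  qed
  \<comment> \<open>The new element \<open>a\<close> comes from the last term of the lower central
    series not inside \<open>A\<close>. Then [H, a] lies in \<open>A\<close>, and adjoining
    \<open>a\<close> gives an ideal of \<open>H\<close> again.\<close>
  have "\<exists>k. \<not> LC k \<subseteq> A \<and> LC (Suc k) \<subseteq> A"
  proof (rule ccontr)
    assume n: "\<nexists>k. \<not> LC k \<subseteq> A \<and> LC (Suc k) \<subseteq> A"
    have "\<not> LC k \<subseteq> A" for k
    proof (induction k)
      case 0 show ?case using \<open>\<not> H \<subseteq> A\<close> by simp
    next
      case (Suc k) then show ?case using n by blast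
    qed
    then show False using LC_eventually_zero subspace_0[OF sub] by (metis empty_subsetI insert_subset)
  qed
  then obtain k a where a: "a \<in> LC k" "a \<notin> A" and k: "LC (Suc k) \<subseteq> A" by blast
  have aH: "a \<in> H" using a(1) LC_subset_H by blast
  have ha: "br h a \<in> A" if "h \<in> H" for h using br_LC[OF that a(1)] k by blast
  have "x \<in> gen_eigenspace (br a) 0" using x(1) aH by (simp add: wsp_def)
  then obtain n where "(br a ^^ n) x = 0" unfolding gen_eigenspace_def by auto
  then have ex: "(br a ^^ n) x \<in> H" using subspace_0[OF H_subspace] by simp
  \<comment> \<open>The last iterate \<open>y\<close> of ad a on \<open>x\<close> outside
    \<open>H\<close> is carried into \<open>H\<close> by \<open>a\<close>. Elements \<open>b\<close>
    of \<open>A\<close> still carry every iterate into \<open>H\<close>, because [b, a] is in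
    \<open>A\<close>.\<close>
  define m where "m = (LEAST n. (br a ^^ n) x \<in> H)"
  have m: "(br a ^^ m) x \<in> H" unfolding m_def by (rule LeastI[of _ n]) (rule ex)
  with x(2) obtain j where j: "m = Suc j" by (cases m) auto
  have mj: "(br a ^^ j) x \<notin> H"
    using not_less_Least[of j "\<lambda>n. (br a ^^ n) x \<in> H"] j unfolding m_def[symmetric] by simp
  define y where "y = (br a ^^ j) x"
  have y: "(br a ^^ i) x \<in> wsp 0 \<and> (\<forall>b\<in>A. br b ((br a ^^ i) x) \<in> H)" for i
  proof (induction i)
    case 0
    show ?case unfolding funpow_0 using x(1,3) by blast
  next
    case (Suc i)
    let ?z = "(br a ^^ i) x"
    have "br b (br a ?z) \<in> H" if b: "b \<in> A" for b
    proof -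
      have "br b a \<in> A"
        unfolding br_swap[of b a] by (rule subspace_neg[OF sub id[OF aH b]])
      then have "br (br b a) ?z \<in> H" using Suc by blast
      moreover have "br a (br b ?z) \<in> H" by (rule H_br[OF aH]) (use Suc b in blast)
      ultimately have "br (br b a) ?z + br a (br b ?z) \<in> H"
        by (rule subspace_add[OF H_subspace])
      then show ?thesis by (simp add: br_br)
    qed
    then show ?case using Suc wsp_stable[OF aH] by simp
  qed
  have ay: "br a y \<in> H" using m unfolding j y_def by simp
  define A' where "A' = span (insert a A)"
  have A'el: "\<exists>b t. b \<in> A \<and> z = b + t *s a" if "z \<in> A'" for z
  proof -
    from that obtain t where "z - t *s a \<in> span A" unfolding A'_def span_breakdown_eq by blast
    then have "z - t *s a \<in> A" using sub by (metis span_eq_iff)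
    then show ?thesis by (intro exI[of _ "z - t *s a"] exI[of _ t]) simp
  qed
  have AA': "A \<subseteq> A'" unfolding A'_def using span_superset by blast
  have "Q A'" unfolding Q_def
  proof (intro conjI)
    show "subspace A'" by (simp add: A'_def)
    show "A' \<subseteq> H" unfolding A'_def using aH AH by (intro span_minimal H_subspace) auto
    show "\<forall>h\<in>H. \<forall>z\<in>A'. br h z \<in> A'"
    proof (intro ballI)
      fix h z assume h: "h \<in> H" and "z \<in> A'"
      then obtain b t where b: "b \<in> A" "z = b + t *s a" using A'el by blast
      have "br h z \<in> A" unfolding b(2) br_add_right br_scale_right
        by (intro subspace_add subspace_scale sub id h b ha)
      then show "br h z \<in> A'" using AA' by blast
    qed
    have "\<forall>z\<in>A'. br z y \<in> H"
    proof
      fix z assume "z \<in> A'"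
      then obtain b t where b: "b \<in> A" "z = b + t *s a" using A'el by blast
      have "br b y \<in> H" using y b(1) unfolding y_def by blast
      then show "br z y \<in> H" unfolding b(2) br_add_left br_scale_left
        by (intro subspace_add subspace_scale H_subspace ay)
    qed
    moreover have "y \<in> wsp 0" "y \<notin> H" using y mj unfolding y_def by blast+
    ultimately show "\<exists>x. x \<in> wsp 0 \<and> x \<notin> H \<and> (\<forall>a\<in>A'. br a x \<in> H)" by (intro exI[of _ y] conjI)
  qed
  then have "dim A' \<le> dim A" by (rule mx)
  moreover have "a \<in> A'" unfolding A'_def by (rule span_base) simp
  then have "span A \<subset> span A'"
    using AA' a(2) sub span_mono[OF AA'] unfolding A'_def span_span by (metis psubsetI span_eq_iff)
  then have "dim A < dim A'" by (rule dim_psubset)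
  ultimately show False by simp
qed

section \<open>Sums of weight spaces and weight components\<close>

lemma br_span:
  assumes "subspace S" "\<And>a. a \<in> A \<Longrightarrow> br z a \<in> S" "v \<in> span A"
  shows "br z v \<in> S"
  using assms(3)
proof (induction rule: span_induct)
  case base
  show ?case
    using assms(1) by (auto intro!: subspaceI
        simp: br_add_right br_scale_right subspace_0 subspace_add subspace_scale)
qed (rule assms(2))

lemma br_span2:
  assumes S: "subspace S" and ab: "\<And>a b. a \<in> A \<Longrightarrow> b \<in> B \<Longrightarrow> br a b \<in> S"
    and "u \<in> span A" "v \<in> span B"
  shows "br u v \<in> S"
proof -
  have "br a v \<in> S" if "a \<in> A" for a by (rule br_span[OF S ab[OF that] assms(4)])
  then have "br v a \<in> S" if "a \<in> A" for a
    unfolding br_swap[of v a] using that by (intro subspace_neg[OF S])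
  then have "br v u \<in> S" by (rule br_span[OF S _ assms(3)])
  then show ?thesis unfolding br_swap[of u v] by (rule subspace_neg[OF S])
qed

lemma span_wsp_sum:
  assumes J: "J \<subseteq> weights" and "v \<in> span (\<Union>l\<in>J. wsp l)"
  shows "\<exists>c. (\<forall>l\<in>J. c l \<in> wsp l) \<and> v = (\<Sum>l\<in>J. c l)"
proof -
  have "finite J" using J weights_finite by (rule finite_subset)
  then show ?thesis using assms(2)
  proof (induction J arbitrary: v rule: finite_induct)
    case (insert l J)
    have "span (\<Union>l\<in>insert l J. wsp l) = {x + y |x y. x \<in> wsp l \<and> y \<in> span (\<Union>l\<in>J. wsp l)}"
      using span_Un[of "wsp l" "\<Union>l\<in>J. wsp l"]
      unfolding iffD2[OF span_eq_iff wsp_subspace[of l]] by simp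
    then obtain x y where xy: "v = x + y" "x \<in> wsp l" "y \<in> span (\<Union>l\<in>J. wsp l)"
      using insert.prems by blast
    from insert.IH[OF xy(3)] obtain c where c: "\<forall>l\<in>J. c l \<in> wsp l" "y = (\<Sum>l\<in>J. c l)" by blast
    let ?c = "c(l := x)"
    have "(\<Sum>l\<in>J. ?c l) = y" unfolding c(2) by (rule sum.cong) (use insert.hyps in auto)
    then have "v = (\<Sum>l\<in>insert l J. ?c l)" using insert.hyps xy(1) by simp
    moreover have "\<forall>m\<in>insert l J. ?c m \<in> wsp m" using c(1) xy(2) by auto
    ultimately show ?case by blast
  qed simp
qed

lemma wsp_span_disjoint:
  assumes J: "J \<subseteq> weights" and "v \<in> span (\<Union>l\<in>J. wsp l)" "v \<in> wsp m" "m \<notin> J"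
    and m: "\<And>x. x \<notin> H \<Longrightarrow> m x = 0"
  shows "v = 0"
proof -
  from span_wsp_sum[OF assms(1,2)] obtain c where
    c: "\<forall>l\<in>J. c l \<in> wsp l" "v = (\<Sum>l\<in>J. c l)" by blast
  have fin: "finite J" using J weights_finite by (rule finite_subset)
  let ?c = "c(m := - v)"
  have "(\<Sum>l\<in>J. ?c l) = v" unfolding c(2) by (rule sum.cong) (use assms(4) in auto)
  then have s0: "(\<Sum>l\<in>insert m J. ?c l) = 0" using assms(4) fin by simp
  have out: "l x = 0" if "l \<in> insert m J" "x \<notin> H" for l x
    using that weights_outside J m by blast
  have w: "?c l \<in> wsp l" if "l \<in> insert m J" for l
    using that c(1) assms(3) by (auto simp: subspace_neg[OF wsp_subspace])
  have "?c m = 0"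
    by (rule wsp_independent[where F = "insert m J" and c = ?c]) (use fin out w s0 in auto)
  then show ?thesis by simp
qed

definition wcomp :: "'g \<Rightarrow> ('g \<Rightarrow> 'k) \<Rightarrow> 'g"
  where "wcomp x = (SOME c. (\<forall>l\<in>weights. c l \<in> wsp l) \<and> (\<forall>l. l \<notin> weights \<longrightarrow> c l = 0) \<and>
    (\<Sum>l\<in>weights. c l) = x)"

lemma wcomp: "l \<in> weights \<Longrightarrow> wcomp x l \<in> wsp l" "l \<notin> weights \<Longrightarrow> wcomp x l = 0"
    "(\<Sum>l\<in>weights. wcomp x l) = x"
proof -
  from span_wsp_sum[OF order_refl, of x] span_wsp obtain c where
    c: "\<forall>l\<in>weights. c l \<in> wsp l" "x = (\<Sum>l\<in>weights. c l)" by auto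
  let ?c = "\<lambda>l. if l \<in> weights then c l else 0"
  have "(\<forall>l\<in>weights. ?c l \<in> wsp l) \<and> (\<forall>l. l \<notin> weights \<longrightarrow> ?c l = 0) \<and> (\<Sum>l\<in>weights. ?c l) = x"
    using c by simp
  then have "\<exists>c. (\<forall>l\<in>weights. c l \<in> wsp l) \<and> (\<forall>l. l \<notin> weights \<longrightarrow> c l = 0) \<and> (\<Sum>l\<in>weights. c l) = x"
    by (rule exI[of _ ?c])
  from someI_ex[OF this, folded wcomp_def]
  show "l \<in> weights \<Longrightarrow> wcomp x l \<in> wsp l" "l \<notin> weights \<Longrightarrow> wcomp x l = 0"
    "(\<Sum>l\<in>weights. wcomp x l) = x" by simp_all
qed

lemma wcomp_unique:
  assumes "\<And>l. l \<in> weights \<Longrightarrow> c l \<in> wsp l" "\<And>l. l \<notin> weights \<Longrightarrow> c l = 0" "x = (\<Sum>l\<in>weights. c l)"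
  shows "wcomp x = c"
proof
  fix l
  show "wcomp x l = c l"
  proof (cases "l \<in> weights")
    case True
    have "wcomp x l - c l = 0"
    proof (rule wsp_independent[OF weights_finite, where c = "\<lambda>l. wcomp x l - c l"])
      show "(\<Sum>l\<in>weights. wcomp x l - c l) = 0" using assms(3) wcomp(3) by (simp add: sum_subtractf)
    qed (use assms wcomp True in \<open>auto simp: weights_outside subspace_diff[OF wsp_subspace]\<close>)
    then show ?thesis by simp
  qed (use assms wcomp in simp)
qed

lemma wcomp_wsp:
  assumes "l \<in> weights" "x \<in> wsp l"
  shows "wcomp x = (\<lambda>m. if m = l then x else 0)"
  by (rule wcomp_unique) (use assms weights_finite wsp_0 in auto)

lemma wcomp_add: "wcomp (x + y) = (\<lambda>l. wcomp x l + wcomp y l)"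
  by (rule wcomp_unique) (auto simp: wcomp sum.distrib subspace_add[OF wsp_subspace])

lemma wcomp_scale: "wcomp (c *s x) = (\<lambda>l. c *s wcomp x l)"
  by (rule wcomp_unique)
    (auto simp: wcomp scale_sum_right[symmetric] subspace_scale[OF wsp_subspace])

section \<open>The Killing form\<close>

text \<open>Adapted to the weight decomposition, so that operators shifting all weights have zero
  diagonal.\<close>

definition total_basis :: "'g set"
  where "total_basis = (\<Union>l\<in>weights. wbasis l)"

lemma total_basis: "independent total_basis" "span total_basis = UNIV"
  unfolding total_basis_def span_wbasis_UN by (simp_all add: wbasis_UN_independent span_wsp)

definition tr :: "('g \<Rightarrow> 'g) \<Rightarrow> 'k"
  where "tr = trace_on total_basis"

lemma tr_add: "tr (\<lambda>x. f x + g x) = tr f + tr g"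
  and tr_diff: "tr (\<lambda>x. f x - g x) = tr f - tr g"
  and tr_scale: "tr (\<lambda>x. c *s f x) = c * tr f"
  unfolding tr_def by (simp_all add: trace_on_add trace_on_diff trace_on_scale total_basis)

lemma tr_commute:
  "endo f \<Longrightarrow> endo g \<Longrightarrow> tr (\<lambda>x. f (g x)) = tr (\<lambda>x. g (f x))"
  unfolding tr_def by (rule trace_on_commute) (simp_all add: total_basis)

lemma tr_nilpotent: "endo f \<Longrightarrow> (\<And>x. (f ^^ n) x = 0) \<Longrightarrow> tr f = 0"
  unfolding tr_def by (rule trace_on_nilpotent) (simp_all add: total_basis)

definition killing :: "'g \<Rightarrow> 'g \<Rightarrow> 'k"
  where "killing x y = tr (\<lambda>z. br x (br y z))"

lemma killing_sym: "killing x y = killing y x"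
  unfolding killing_def by (rule tr_commute[OF linear_br linear_br])

lemma killing_add: "killing (x + y) z = killing x z + killing y z"
    "killing z (x + y) = killing z x + killing z y"
  by (simp_all add: killing_def br_add_left br_add_right tr_add)

lemma killing_scale: "killing (c *s x) z = c * killing x z" "killing z (c *s x) = c * killing z x"
  by (simp_all add: killing_def br_scale_left br_scale_right tr_scale)

lemma killing_0: "killing 0 x = 0" "killing x 0 = 0"
  using killing_scale[of 0 0 x] killing_scale(2)[of x 0 0] by simp_all

lemma killing_sum: "killing (\<Sum>i\<in>I. f i) z = (\<Sum>i\<in>I. killing (f i) z)"
  by (induction I rule: infinite_finite_induct) (simp_all add: killing_0 killing_add)

lemma linear_br_br: "endo (\<lambda>z. br x (br y z))"
  using Vector_Spaces.linear_compose[OF linear_br linear_br] by (simp add: o_def)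

lemma killing_invariant: "killing (br x y) z = killing x (br y z)"
proof -
  have "killing (br x y) z = tr (\<lambda>w. br x (br y (br z w))) - tr (\<lambda>w. br y (br x (br z w)))"
    unfolding killing_def br_br by (rule tr_diff)
  also have "tr (\<lambda>w. br y (br x (br z w))) = tr (\<lambda>w. br x (br z (br y w)))"
    by (rule tr_commute[OF linear_br linear_br_br])
  also have "tr (\<lambda>w. br x (br y (br z w))) - tr (\<lambda>w. br x (br z (br y w))) = killing x (br y z)"
    unfolding killing_def br_br br_diff(2) by (rule tr_diff[symmetric])
  finally show ?thesis .
qed

lemma representation_wsp_zero:
  assumes "v \<in> wsp q" "\<And>x. x \<notin> H \<Longrightarrow> q x = 0" "p \<in> weights" "b \<in> wbasis p" "q \<noteq> p"
  shows "representation total_basis v b = 0"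
proof (cases "q \<in> weights")
  case True
  have "representation total_basis v = representation (wbasis q) v"
    by (rule representation_extend[OF total_basis(1)])
      (use True assms(1) wbasis(3) in \<open>auto simp: total_basis_def\<close>)
  moreover have "b \<notin> wbasis q" using wbasis_disjoint[OF True assms(3,5)] assms(4) by blast
  ultimately show ?thesis using representation_ne_zero by fastforce
next
  case False
  then have "v = 0" using wsp_nonweight[of q] assms(1,2) by auto
  then show ?thesis by (simp add: representation_zero)
qed

text \<open>The product of ad x and ad y shifts every weight by l + m, hence has zero diagonal on
  the adapted basis.\<close>

lemma killing_wsp:
  assumes "x \<in> wsp l" "y \<in> wsp m" "\<And>x. x \<notin> H \<Longrightarrow> l x = 0" "\<And>x. x \<notin> H \<Longrightarrow> m x = 0" "l + m \<noteq> 0"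
  shows "killing x y = 0"
proof -
  have "representation total_basis (br x (br y b)) b = 0" if b: "b \<in> total_basis" for b
  proof -
    obtain p where p: "p \<in> weights" "b \<in> wbasis p" using b by (auto simp: total_basis_def)
    have "br x (br y b) \<in> wsp (l + (m + p))"
      using p wbasis(1) by (intro wsp_br assms) auto
    moreover have "l + (m + p) \<noteq> p" using assms(5) by (simp add: add.assoc[symmetric])
    ultimately show ?thesis
      by (intro representation_wsp_zero[of _ "l + (m + p)" p]) (use p assms weights_outside in auto)
  qed
  then show ?thesis unfolding killing_def tr_def trace_on_def by simp
qed

text \<open>The square of ad h minus c * c factors as ad h - c followed by (ad h - c) + 2c, and
  these commute; one application therefore lowers the exponent \<open>n\<close>.\<close>

lemma gen_eigenspace_square:
  assumes "((\<lambda>y. br h y - c *s y) ^^ n) y = 0"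
  shows "y \<in> gen_eigenspace (\<lambda>z. br h (br h z)) (c * c)"
  using assms
proof (induction n arbitrary: y)
  case 0
  then show ?case using subspace_0[OF gen_eigenspace_subspace[OF linear_br_br]] by simp
next
  case (Suc n)
  let ?T = "\<lambda>y. br h y - c *s y"
  have T: "endo ?T" by (rule linear_minus_scale[OF linear_br])
  interpret T: Vector_Spaces.linear s s ?T by (rule T)
  interpret Tn: Vector_Spaces.linear s s "?T ^^ n" by (rule linear_funpow[OF T])
  have e: "br h (br h y) - (c * c) *s y = ?T (?T y + (2 * c) *s y)"
  proof -
    have "(2 * c) *s y = c *s y + c *s y" using scale_left_distrib[of c c y] by simp
    then show ?thesis by (simp add: br_add_right br_diff br_scale_right algebra_simps)
  qed
  have z: "(?T ^^ n) (?T y) = 0" using Suc.prems unfolding funpow_Suc_right o_apply .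
  have "(?T ^^ n) (?T (?T y + (2 * c) *s y)) = (?T ^^ n) (?T (?T y)) + (2 * c) *s ((?T ^^ n) (?T y))"
    unfolding T.add T.scale Tn.add Tn.scale ..
  also have "(?T ^^ n) (?T (?T y)) = ?T ((?T ^^ n) (?T y))"
    by (rule funpow_swap1[of ?T n "?T y", symmetric])
  finally have "(?T ^^ n) (?T (?T y + (2 * c) *s y)) = 0" unfolding z by simp
  then have "br h (br h y) - (c * c) *s y \<in> gen_eigenspace (\<lambda>z. br h (br h z)) (c * c)"
    unfolding e by (rule Suc.IH)
  then show ?case by (rule gen_eigenspace_step[where f = "\<lambda>z. br h (br h z)"])
qed

lemma killing_square:
  assumes h: "h \<in> H"
  shows "killing h h = (\<Sum>l\<in>weights. of_nat (wdim l) * (l h * l h))"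
proof -
  have st: "br h (br h b) \<in> span (wbasis l)" if "b \<in> span (wbasis l)" for b l
    using that unfolding wbasis(3) by (intro wsp_stable h)
  have "killing h h = (\<Sum>l\<in>weights. trace_on (wbasis l) (\<lambda>z. br h (br h z)))"
    unfolding killing_def tr_def total_basis_def
    by (rule trace_on_UN[OF wbasis_UN_independent])
      (use weights_finite wbasis_disjoint st span_base in auto)
  also have "\<dots> = (\<Sum>l\<in>weights. of_nat (wdim l) * (l h * l h))"
  proof (rule sum.cong[OF refl])
    fix l
    have "wbasis l \<subseteq> gen_eigenspace (br h) (l h)" using wbasis(1)[of l] h by (auto simp: wsp_def)
    then have "wbasis l \<subseteq> gen_eigenspace (\<lambda>z. br h (br h z)) (l h * l h)"
      using gen_eigenspace_square unfolding gen_eigenspace_def[of "br h"] by blast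
    then show "trace_on (wbasis l) (\<lambda>z. br h (br h z)) = of_nat (wdim l) * (l h * l h)"
      unfolding wdim_def
      by (intro trace_on_gen_eigenspace[OF linear_br_br wbasis(2)]) (use st in auto)
  qed
  finally show ?thesis .
qed

section \<open>Strings of weights and rationality\<close>

definition wstring :: "('g \<Rightarrow> 'k) \<Rightarrow> ('g \<Rightarrow> 'k) \<Rightarrow> ('g \<Rightarrow> 'k) set"
  where "wstring a l = {m \<in> weights. \<exists>j::int. m = (\<lambda>z. l z + of_int j * a z)}"

text \<open>The bracket moves along the string, and where the string leaves \<open>weights\<close>
  the weight space is 0. The integer \<open>i\<close> makes one statement serve both signs of
  \<open>a\<close>.\<close>

lemma wstring_stable:
  assumes a: "\<And>x. x \<notin> H \<Longrightarrow> a x = 0" and l: "l \<in> weights"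
    and z: "z \<in> wsp (\<lambda>z. of_int i * a z)" and v: "v \<in> span (\<Union>m\<in>wstring a l. wsp m)"
  shows "br z v \<in> span (\<Union>m\<in>wstring a l. wsp m)"
proof (rule br_span[OF subspace_span _ v])
  fix b assume "b \<in> (\<Union>m\<in>wstring a l. wsp m)"
  then obtain m j where m: "b \<in> wsp m" "m = (\<lambda>z. l z + of_int j * a z)"
    by (auto simp: wstring_def)
  let ?n = "(\<lambda>z. of_int i * a z) + m"
  have n: "br z b \<in> wsp ?n" by (rule wsp_br[OF z m(1)])
  show "br z b \<in> span (\<Union>m\<in>wstring a l. wsp m)"
  proof (cases "?n \<in> weights")
    case True
    have "?n = (\<lambda>z. l z + of_int (i + j) * a z)" by (auto simp: m(2) algebra_simps)
    then have "?n \<in> wstring a l" using True unfolding wstring_def by blast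
    then show ?thesis using n by (intro span_base) blast
  next
    case False
    have "?n x = 0" if "x \<notin> H" for x using that a weights_outside[OF l] by (simp add: m(2))
    then have "br z b = 0" using wsp_nonweight[of ?n] False n by auto
    then show ?thesis by (simp add: span_zero)
  qed
qed

lemma wstring_self: "l \<in> weights \<Longrightarrow> l \<in> wstring a l"
  unfolding wstring_def by (auto intro!: exI[of _ 0])

lemma wsp_minus: "wsp (- a) = wsp (\<lambda>z. of_int (- 1) * a z)"
  by (rule arg_cong[of _ _ wsp]) auto

text \<open>The trace of \<open>[x, y]\<close> on an \<open>a\<close>-string of weight spaces vanishes.\<close>

lemma weight_rational_multiple:
  assumes a: "\<And>x. x \<notin> H \<Longrightarrow> a x = 0" and xy: "x \<in> wsp a" "y \<in> wsp (- a)" and l: "l \<in> weights"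
  shows "\<exists>q::rat. l (br x y) = of_rat q * a (br x y)"
proof -
  define h where "h = br x y"
  have h: "h \<in> H" using wsp_br[OF xy] wsp_zero by (simp add: h_def)
  define J where "J = wstring a l"
  have JW: "J \<subseteq> weights" by (auto simp: J_def wstring_def)
  have fJ: "finite J" using JW weights_finite by (rule finite_subset)
  have x': "x \<in> wsp (\<lambda>z. of_int 1 * a z)" using xy by simp
  have y': "y \<in> wsp (\<lambda>z. of_int (- 1) * a z)" using xy(2) by (simp only: wsp_minus)
  let ?M = "\<Union>l\<in>J. wbasis l"
  have stx: "br x v \<in> span ?M" if "v \<in> span ?M" for v
    using that unfolding span_wbasis_UN J_def by (rule wstring_stable[OF _ l x', rotated]) (rule a)
  have sty: "br y v \<in> span ?M" if "v \<in> span ?M" for v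
    using that unfolding span_wbasis_UN J_def by (rule wstring_stable[OF _ l y', rotated]) (rule a)
  note ind = wbasis_UN_independent[OF JW]
  have "trace_on ?M (br h) = trace_on ?M (\<lambda>z. br x (br y z) - br y (br x z))"
    by (simp add: h_def br_br[abs_def])
  also have "\<dots> = trace_on ?M (\<lambda>z. br x (br y z)) - trace_on ?M (\<lambda>z. br y (br x z))"
    by (rule trace_on_diff[OF ind]) (use stx sty span_base in blast)+
  also have "\<dots> = 0"
    using trace_on_commute[OF linear_br linear_br ind, of x y] stx sty by (simp add: image_subset_iff)
  finally have t: "(\<Sum>m\<in>J. of_nat (wdim m) * m h) = 0" using trace_wbasis_UN[OF h JW] by simp
  have "\<forall>m\<in>J. \<exists>j::int. m = (\<lambda>z. l z + of_int j * a z)" by (auto simp: J_def wstring_def)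
  then obtain j :: "('g \<Rightarrow> 'k) \<Rightarrow> int" where j: "\<And>m. m \<in> J \<Longrightarrow> m = (\<lambda>z. l z + of_int (j m) * a z)" by metis
  have "(\<Sum>m\<in>J. of_nat (wdim m) * m h) = (\<Sum>m\<in>J. of_nat (wdim m) * (l h + of_int (j m) * a h))"
  proof (rule sum.cong[OF refl])
    fix m assume "m \<in> J"
    from fun_cong[OF j[OF this], of h] show "of_nat (wdim m) * m h = of_nat (wdim m) * (l h + of_int (j m) * a h)"
      by simp
  qed
  also have "\<dots> = of_nat (\<Sum>m\<in>J. wdim m) * l h + of_int (\<Sum>m\<in>J. int (wdim m) * j m) * a h"
    by (simp add: sum.distrib sum_distrib_left algebra_simps)
  finally have e: "of_nat (\<Sum>m\<in>J. wdim m) * l h = - of_int (\<Sum>m\<in>J. int (wdim m) * j m) * a h"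
    using t by (simp add: eq_neg_iff_add_eq_0)
  define N where "N = (\<Sum>m\<in>J. wdim m)"
  \<comment> \<open>\<open>l\<close> lies on its own string, so the total dimension
    \<open>N\<close>, which is the coefficient of l h, is positive and can be divided by.\<close>
  have "l \<in> J" unfolding J_def by (rule wstring_self[OF l])
  then have "wdim l \<le> N" unfolding N_def by (intro member_le_sum) (use fJ in auto)
  then have N: "of_nat N \<noteq> (0::'k)" using wdim_pos[OF l] by simp
  let ?q = "- of_int (\<Sum>m\<in>J. int (wdim m) * j m) / of_nat N :: rat"
  have "l h = of_rat ?q * a h"
    using e N unfolding N_def[symmetric] of_rat_divide of_rat_minus of_rat_of_int_eq of_rat_of_nat_eq
    by (simp add: field_simps)
  then show ?thesis unfolding h_def by blast
qed

end

section \<open>Nondegeneracy of the Killing form\<close>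

locale simple_cartan_lie_algebra = cartan_lie_algebra s br Basis H
  for s :: "'k::{alg_closed_field,field_char_0} \<Rightarrow> 'g::ab_group_add \<Rightarrow> 'g" (infixr "*s" 75)
    and br Basis H +
  assumes ideals: "lie_ideal s br I \<Longrightarrow> I = {0} \<or> I = UNIV"
    and nonabelian: "\<exists>x y. br x y \<noteq> 0"
begin

lemma derived_algebra: "span {br x y |x y. True} = UNIV"
proof -
  let ?I = "span {br x y |x y. True}"
  have "lie_ideal s br ?I"
    unfolding lie_ideal_def
  proof (intro conjI allI ballI)
    show "br x y \<in> ?I" for x y by (rule span_base) blast
  qed simp
  moreover have "?I \<noteq> {0}"
  proof -
    obtain x y where "br x y \<noteq> 0" using nonabelian by blast
    moreover have "br x y \<in> ?I" by (rule span_base) blast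
    ultimately show ?thesis by (metis singletonD)
  qed
  ultimately show ?thesis using ideals by blast
qed

text \<open>If all weights vanished on \<open>H\<close>, the whole algebra would be the weight space
  of 0, that is \<open>H\<close>, and so nilpotent; but it equals its derived algebra.\<close>

lemma weights_nonzero: "\<exists>l\<in>weights. \<exists>h\<in>H. l h \<noteq> 0"
proof (rule ccontr)
  assume n: "\<not> ?thesis"
  have "l = 0" if "l \<in> weights" for l
    using n that weights_outside[OF that] by (auto simp: fun_eq_iff)
  then have "(\<Union>l\<in>weights. wsp l) \<subseteq> wsp 0" by auto
  then have "span (\<Union>l\<in>weights. wsp l) \<subseteq> wsp 0" by (rule span_minimal) (rule wsp_subspace)
  then have HU: "H = UNIV" using span_wsp wsp_zero by auto
  have "LC n = UNIV" for n
  proof (induction n)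
    case (Suc n)
    then show ?case using derived_algebra by (simp add: bracket_span_def HU)
  qed (simp add: HU)
  then have "UNIV = {0::'g}" using LC_eventually_zero by metis
  then show False using nonabelian by (metis UNIV_I singletonD)
qed

text \<open>The algebra is its own derived algebra and weights add under brackets, so the part of
  weight 0, which is \<open>H\<close>, arises from pairs of opposite weights only.\<close>

lemma H_spanned_by_brackets:
  "H = span {br x y |x y l. l \<in> weights \<and> x \<in> wsp l \<and> y \<in> wsp (- l)}" (is "_ = span ?A")
proof
  have "?A \<subseteq> H"
  proof
    fix z assume "z \<in> ?A"
    then obtain x y l where z: "z = br x y" "x \<in> wsp l" "y \<in> wsp (- l)" by blast
    from wsp_br[OF z(2,3)] show "z \<in> H" using z(1) wsp_zero by simp
  qed
  then show AH: "span ?A \<subseteq> H" by (rule span_minimal) (rule H_subspace)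
  let ?J = "weights - {0}"
  let ?R = "\<Union>l\<in>?J. wsp l"
  have "br x y \<in> span (?A \<union> ?R)" for x y
  proof (rule br_span2[OF subspace_span, of "\<Union>l\<in>weights. wsp l" "\<Union>l\<in>weights. wsp l"])
    fix a b assume "a \<in> (\<Union>l\<in>weights. wsp l)" "b \<in> (\<Union>l\<in>weights. wsp l)"
    then obtain l m where lm: "l \<in> weights" "m \<in> weights" "a \<in> wsp l" "b \<in> wsp m" by blast
    have ab: "br a b \<in> wsp (l + m)" by (rule wsp_br[OF lm(3,4)])
    show "br a b \<in> span (?A \<union> ?R)"
    proof (cases "l + m = 0")
      case True
      then have "m = - l" by (simp add: eq_neg_iff_add_eq_0 add.commute)
      then have "br a b \<in> ?A" using lm by blast
      then show ?thesis by (intro span_base) blast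
    next
      case False
      show ?thesis
      proof (cases "l + m \<in> weights")
        case True
        then have "br a b \<in> ?R" using False ab by blast
        then show ?thesis by (intro span_base) blast
      next
        case f: False
        have "(l + m) x = 0" if "x \<notin> H" for x
          using weights_outside[OF lm(1) that] weights_outside[OF lm(2) that] by simp
        then have "br a b = 0" using wsp_nonweight[of "l + m"] f ab by blast
        then show ?thesis by (simp add: span_zero)
      qed
    qed
  qed (simp_all add: span_wsp)
  then have "span {br x y |x y. True} \<subseteq> span (?A \<union> ?R)" by (intro span_minimal) auto
  then have U: "span (?A \<union> ?R) = UNIV" using derived_algebra by auto
  show "H \<subseteq> span ?A"
  proof
    fix h assume h: "h \<in> H"
    have "h \<in> span (?A \<union> ?R)" using U by simp
    then obtain a r where ar: "h = a + r" "a \<in> span ?A" "r \<in> span ?R"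
      unfolding span_Un by blast
    have "r = h - a" using ar(1) by simp
    then have "r \<in> H" using h AH ar(2) subspace_diff[OF H_subspace] by auto
    then have "r \<in> wsp 0" by (simp add: wsp_zero)
    then have "r = 0" by (intro wsp_span_disjoint[of ?J r 0]) (use ar(3) in auto)
    then show "h \<in> span ?A" using ar by simp
  qed
qed

text \<open>With h = [x, y] as in \<open>H_spanned_by_brackets\<close>,
  \<open>weight_rational_multiple\<close> turns \<open>killing_square\<close> into a rational sum of
  squares times the square of l h. Over the rationals such a sum vanishes only termwise, so all
  weights would vanish on these brackets, hence on \<open>H\<close>.\<close>

lemma killing_nonzero: "\<exists>x y. killing x y \<noteq> 0"
proof (rule ccontr)
  assume "\<not> ?thesis"
  then have k0: "killing x y = 0" for x y by blast
  have g0: "m (br x y) = 0" if l: "l \<in> weights" and x: "x \<in> wsp l" and y: "y \<in> wsp (- l)"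
    and m: "m \<in> weights" for l x y m
  proof (rule ccontr)
    let ?h = "br x y"
    assume mh: "m ?h \<noteq> 0"
    have h: "?h \<in> H" using wsp_br[OF x y] wsp_zero by simp
    have "\<forall>p\<in>weights. \<exists>q::rat. p ?h = of_rat q * l ?h"
      using weight_rational_multiple[OF weights_outside[OF l] x y] by blast
    then obtain q where q: "\<And>p. p \<in> weights \<Longrightarrow> p ?h = of_rat (q p) * l ?h" by metis
    have lh: "l ?h \<noteq> 0" using q[OF m] mh by auto
    have "killing ?h ?h = (\<Sum>p\<in>weights. of_nat (wdim p) * (p ?h * p ?h))" by (rule killing_square[OF h])
    also have "\<dots> = (\<Sum>p\<in>weights. of_rat (of_nat (wdim p) * (q p * q p)) * (l ?h * l ?h))"
      by (intro sum.cong refl) (simp add: q of_rat_mult algebra_simps)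
    also have "\<dots> = of_rat (\<Sum>p\<in>weights. of_nat (wdim p) * (q p * q p)) * (l ?h * l ?h)"
      by (simp add: of_rat_sum sum_distrib_right)
    finally have z: "(\<Sum>p\<in>weights. of_nat (wdim p) * (q p * q p)) = 0" using k0 lh by simp
    have "of_nat (wdim l) * (q l * q l) = 0"
      using z l weights_finite by (subst (asm) sum_nonneg_eq_0_iff) auto
    then have "q l = 0" using wdim_pos[OF l] by simp
    then show False using q[OF l] lh by simp
  qed
  have "m h = 0" if m: "m \<in> weights" and h: "h \<in> H" for m h
  proof -
    let ?A = "{br x y |x y l. l \<in> weights \<and> x \<in> wsp l \<and> y \<in> wsp (- l)}"
    have AH: "span ?A = H" using H_spanned_by_brackets by simp
    have "h \<in> span ?A" using h AH by simp
    then have "h \<in> H \<and> m h = 0"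
    proof (induction rule: span_induct)
      case base
      have m0: "m 0 = 0" using weight_linear(2)[OF m subspace_0[OF H_subspace] subspace_0[OF H_subspace], of 0] by simp
      show ?case
        by (rule subspaceI)
          (auto simp: m0 weight_linear[OF m] subspace_0 subspace_add subspace_scale H_subspace)
    next
      case (step z)
      then show ?case using g0[OF _ _ _ m] AH span_base[of z ?A] by blast
    qed
    then show ?thesis by blast
  qed
  then show False using weights_nonzero by blast
qed

lemma killing_nondegenerate:
  assumes "\<And>y. killing x y = 0"
  shows "x = 0"
proof -
  let ?I = "{x. \<forall>y. killing x y = 0}"
  have "lie_ideal s br ?I"
    unfolding lie_ideal_def
  proof (intro conjI allI ballI)
    show "subspace ?I" by (rule subspaceI) (auto simp: killing_0 killing_add killing_scale)
    fix x y assume "y \<in> ?I"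
    then have "killing (br y x) z = 0" for z unfolding killing_invariant by simp
    then have "killing (br x y) z = 0" for z
      unfolding br_swap[of x y] using killing_scale(1)[of "- 1" "br y x" z] by simp
    then show "br x y \<in> ?I" by simp
  qed
  moreover have "?I \<noteq> UNIV" using killing_nonzero by blast
  ultimately have "?I = {0}" using ideals by blast
  then show ?thesis using assms by blast
qed

section \<open>Derivations and semisimple parts\<close>

lemma killing_represents:
  assumes f: "\<And>x y. f (x + y) = f x + f y" "\<And>c x. f (c *s x) = c * f x"
  shows "\<exists>d. \<forall>x. killing d x = f x"
proof -
  note fin = finiteI_independent[OF total_basis(1)]
  \<comment> \<open>\<open>T d\<close> has the values of the functional of \<open>d\<close> on the
    basis as coordinates. Nondegeneracy makes \<open>T\<close> injective, hence onto, so every list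
    of values is attained.\<close>
  define T where "T d = (\<Sum>b\<in>total_basis. killing d b *s b)" for d
  have T: "endo T"
    unfolding Vector_Spaces.linear_iff T_def using vector_space_axioms
    by (auto simp: killing_add killing_scale scale_left_distrib sum.distrib scale_sum_right)
  interpret T: Vector_Spaces.linear s s T by (rule T)
  have ext: "killing d x = g x" if g: "\<And>x y. g (x + y) = g x + g y" "\<And>c x. g (c *s x) = c * g x"
      and b: "\<And>b. b \<in> total_basis \<Longrightarrow> killing d b = g b" for d x g
  proof -
    have "x \<in> span total_basis" by (simp add: total_basis)
    then show ?thesis
    proof (induction rule: span_induct)
      case base
      have "g 0 = 0" using g(2)[of 0 0] by simp
      then show ?case by (intro subspaceI) (auto simp: killing_0 killing_add killing_scale g)
    qed (rule b)
  qed
  have coeff: "killing d b = c b" if "T d = (\<Sum>b\<in>total_basis. c b *s b)" "b \<in> total_basis" for d c b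
  proof -
    have "(\<Sum>b\<in>total_basis. (killing d b - c b) *s b) = 0"
      using that(1) by (simp add: T_def scale_left_diff_distrib sum_subtractf)
    from independentD[OF total_basis(1) fin order_refl this that(2)] show ?thesis by simp
  qed
  have "inj T"
    unfolding T.inj_iff_eq_0
  proof (intro allI impI)
    fix d assume "T d = 0"
    then have "killing d b = 0" if "b \<in> total_basis" for b
      using coeff[of d "\<lambda>_. 0"] that by simp
    then show "d = 0" using ext[of "\<lambda>_. 0"] by (intro killing_nondegenerate) simp
  qed
  then have "surj T" by (rule linear_inj_imp_surj[OF T])
  then obtain d where "T d = (\<Sum>b\<in>total_basis. f b *s b)" by (metis surjD)
  from ext[OF f coeff[OF this]] show ?thesis by blast
qed

text \<open>Choose \<open>d\<close> representing the functional that sends x to the trace of D after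
  ad x. For E = D - ad d all traces of E after ad x vanish. Since ad (E x) is the commutator of E
  with ad x, the Killing product of E x and y is the trace of E after ad [x, y], so E x = 0.\<close>

lemma derivation_inner:
  assumes D: "endo D" and der: "\<And>x y. D (br x y) = br (D x) y + br x (D y)"
  shows "\<exists>d. \<forall>x. D x = br d x"
proof -
  interpret D: Vector_Spaces.linear s s D by (rule D)
  have "\<exists>d. \<forall>x. killing d x = tr (\<lambda>z. D (br x z))"
    by (rule killing_represents)
      (simp_all add: br_add_left br_scale_left D.add D.scale tr_add tr_scale)
  then obtain d where d: "\<And>x. killing d x = tr (\<lambda>z. D (br x z))" by blast
  define E where "E x = D x - br d x" for x
  have E: "endo E"
    unfolding Vector_Spaces.linear_iff E_def using vector_space_axioms
    by (auto simp: D.add D.scale br_add_right br_scale_right algebra_simps)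
  interpret E: Vector_Spaces.linear s s E by (rule E)
  have eder: "E (br x y) = br (E x) y + br x (E y)" for x y
    using br_br[of d x y] by (simp add: E_def der br_diff algebra_simps)
  have t0: "tr (\<lambda>z. E (br x z)) = 0" for x
  proof -
    have "tr (\<lambda>z. E (br x z)) = tr (\<lambda>z. D (br x z)) - killing d x"
      unfolding E_def killing_def by (rule tr_diff)
    then show ?thesis by (simp add: d)
  qed
  have "E x = 0" for x
  proof (rule killing_nondegenerate)
    fix y
    have lin: "endo (\<lambda>z. E (br y z))"
      using Vector_Spaces.linear_compose[OF linear_br E] by (simp add: o_def)
    have ex: "br (E x) z = E (br x z) - br x (E z)" for z by (simp add: eder)
    have "killing (E x) y = tr (\<lambda>z. E (br x (br y z)) - br x (E (br y z)))"
      unfolding killing_def ex ..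
    also have "\<dots> = tr (\<lambda>z. E (br x (br y z))) - tr (\<lambda>z. br x (E (br y z)))" by (rule tr_diff)
    also have "tr (\<lambda>z. br x (E (br y z))) = tr (\<lambda>z. E (br y (br x z)))"
      by (rule tr_commute[OF linear_br lin])
    also have "tr (\<lambda>z. E (br x (br y z))) - \<dots> = tr (\<lambda>z. E (br (br x y) z))"
      unfolding br_br E.diff by (rule tr_diff[symmetric])
    also have "\<dots> = 0" by (rule t0)
    finally show "killing (E x) y = 0" .
  qed
  then have "\<forall>x. D x = br d x" by (simp add: E_def)
  then show ?thesis ..
qed

text \<open>\<open>D\<close> scales each weight space by the value of its weight at
  \<open>h\<close>. Weights add under brackets, so \<open>D\<close> is a derivation, hence some ad
  d. It kills \<open>H\<close>, the weight space of 0, so \<open>d\<close> normalizes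
  \<open>H\<close> and belongs to it. Comparing the eigenvalue l h of ad d with its generalized
  eigenvalue l d gives the last claim.\<close>

lemma semisimple_part:
  assumes h: "h \<in> H"
  shows "\<exists>d\<in>H. (\<forall>l\<in>weights. \<forall>x\<in>wsp l. br d x = l h *s x) \<and> (\<forall>l\<in>weights. l (h - d) = 0)"
proof -
  define D where "D x = (\<Sum>l\<in>weights. l h *s wcomp x l)" for x
  have D: "endo D"
    unfolding Vector_Spaces.linear_iff D_def using vector_space_axioms
    by (auto simp: wcomp_add wcomp_scale scale_right_distrib sum.distrib scale_sum_right mult.commute)
  interpret D: Vector_Spaces.linear s s D by (rule D)
  have Dw: "D x = l h *s x" if "x \<in> wsp l" "\<And>x. x \<notin> H \<Longrightarrow> l x = 0" for l x
  proof (cases "l \<in> weights")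
    case True
    show ?thesis unfolding D_def wcomp_wsp[OF True that(1)]
      using True weights_finite by (simp add: if_distrib[of "\<lambda>x. _ *s x"] cong: if_cong)
  next
    case False
    then have "x = 0" using wsp_nonweight[of l] that by auto
    then show ?thesis by simp
  qed
  have "D (br x y) = br (D x) y + br x (D y)" for x y
  proof -
    have 1: "D (br x b) = br (D x) b + br x (D b)" if b: "b \<in> wsp m" "m \<in> weights" for b m
    proof -
      have "x \<in> span (\<Union>l\<in>weights. wsp l)" by (simp add: span_wsp)
      then show ?thesis
      proof (induction rule: span_induct)
        case base
        show ?case
          by (rule subspaceI)
            (auto simp: br_add_left br_scale_left D.add D.scale algebra_simps)
      next
        case (step a)
        then obtain l where a: "l \<in> weights" "a \<in> wsp l" by blast
        have "(l + m) x = 0" if "x \<notin> H" for x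
          using weights_outside[OF a(1) that] weights_outside[OF b(2) that] by simp
        then have "D (br a b) = (l + m) h *s br a b" by (rule Dw[OF wsp_br[OF a(2) b(1)]])
        then show ?case
          using Dw[OF a(2) weights_outside[OF a(1)]] Dw[OF b(1) weights_outside[OF b(2)]]
          by (simp add: br_scale_left br_scale_right scale_left_distrib)
      qed
    qed
    have "y \<in> span (\<Union>l\<in>weights. wsp l)" by (simp add: span_wsp)
    then show ?thesis
    proof (induction rule: span_induct)
      case base
      show ?case
        by (rule subspaceI)
          (auto simp: br_add_right br_scale_right D.add D.scale algebra_simps)
    next
      case (step b)
      then show ?case using 1 by blast
    qed
  qed
  from derivation_inner[OF D this] obtain d where d: "\<And>x. D x = br d x" by blast
  have e: "br d x = l h *s x" if "l \<in> weights" "x \<in> wsp l" for l x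
    using Dw[OF that(2) weights_outside[OF that(1)]] d by simp
  have "d \<in> H"
  proof (rule H_self_normalizing)
    fix k assume "k \<in> H"
    then have "k \<in> wsp 0" by (simp add: wsp_zero)
    then have "br d k = 0" using Dw[of k 0] d by simp
    then show "br d k \<in> H" using subspace_0[OF H_subspace] by simp
  qed
  moreover have "l (h - d) = 0" if l: "l \<in> weights" for l
  proof -
    obtain x where x: "x \<in> wsp l" "x \<noteq> 0" using l wsp_0 unfolding weights_def by blast
    have "l d = l h"
    proof (rule ccontr)
      assume "l d \<noteq> l h"
      have "x = 0"
        by (rule gen_eigenspace_inj[OF linear_br, of "l h" "l d" _ d 1])
          (use \<open>l d \<noteq> l h\<close> x e[OF l] \<open>d \<in> H\<close> in \<open>auto simp: wsp_def\<close>)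
      then show False using x by simp
    qed
    moreover have "- 1 *s d \<in> H" by (rule subspace_scale[OF H_subspace \<open>d \<in> H\<close>])
    ultimately show ?thesis
      using weight_linear(1)[OF l h, of "- 1 *s d"] weight_linear(2)[OF l \<open>d \<in> H\<close> h, of "- 1"] by simp
  qed
  ultimately show ?thesis using e by (intro bexI[of _ d] conjI ballI)
qed

text \<open>ad z and ad h commute, so their product inherits nilpotency from ad z and has trace
  0.\<close>

lemma killing_nilpotent_commuting:
  assumes comm: "br z h = 0" and nil: "\<And>x. \<exists>n. (br z ^^ n) x = 0"
  shows "killing z h = 0"
proof -
  obtain n where n: "\<forall>x\<in>UNIV. (br z ^^ n) x = 0"
    using funpow_uniform[OF linear_br subspace_UNIV nil] by blast
  have c: "br z (br h x) = br h (br z x)" for x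
    using br_br[of z h x] comm by simp
  have cn: "(br z ^^ k) (br h x) = br h ((br z ^^ k) x)" for k x
    by (induction k) (simp_all add: c)
  have "((\<lambda>x. br z (br h x)) ^^ k) x = (br z ^^ k) ((br h ^^ k) x)" for k x
    by (induction k) (simp_all add: cn c)
  then show ?thesis unfolding killing_def
    by (intro tr_nilpotent[OF linear_br_br, of n]) (use n in auto)
qed

text \<open>Let \<open>N\<close> be the common kernel of the weights in \<open>H\<close>, and
  \<open>z\<close> nonzero in its last nonzero intersection with the lower central series, so that
  \<open>N\<close> centralizes \<open>z\<close>. Semisimple parts act on \<open>H\<close> by 0, so
  all of \<open>H\<close> centralizes \<open>z\<close>. As ad z is nilpotent, \<open>z\<close> is
  orthogonal to \<open>H\<close>; by weights it is orthogonal to the rest as well.\<close>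

lemma nilpotent_part_zero:
  assumes n: "n \<in> H" "\<And>l. l \<in> weights \<Longrightarrow> l n = 0"
  shows "n = 0"
proof (rule ccontr)
  assume "n \<noteq> 0"
  define N where "N = {n \<in> H. \<forall>l\<in>weights. l n = 0}"
  have "\<exists>k. \<not> N \<inter> LC k \<subseteq> {0} \<and> N \<inter> LC (Suc k) \<subseteq> {0}"
  proof (rule ccontr)
    assume c: "\<nexists>k. \<not> N \<inter> LC k \<subseteq> {0} \<and> N \<inter> LC (Suc k) \<subseteq> {0}"
    have "\<not> N \<inter> LC k \<subseteq> {0}" for k
    proof (induction k)
      case 0 show ?case using \<open>n \<noteq> 0\<close> n by (auto simp: N_def)
    next
      case (Suc k) then show ?case using c by blast
    qed
    then show False using LC_eventually_zero by blast
  qed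
  then obtain k z where z: "z \<in> N" "z \<in> LC k" "z \<noteq> 0" and k: "N \<inter> LC (Suc k) \<subseteq> {0}" by blast
  have zH: "z \<in> H" using z(1) by (simp add: N_def)
  have mz: "br m z = 0" if m: "m \<in> N" for m
  proof -
    have mH: "m \<in> H" using m by (simp add: N_def)
    have "br m z \<in> N" unfolding N_def using weight_linear(3) mH zH H_br by blast
    moreover have "br m z \<in> LC (Suc k)" by (rule br_LC[OF mH z(2)])
    ultimately show ?thesis using k by blast
  qed
  have hz: "br h z = 0" if h: "h \<in> H" for h
  proof -
    obtain d where d: "d \<in> H" "\<And>l x. l \<in> weights \<Longrightarrow> x \<in> wsp l \<Longrightarrow> br d x = l h *s x"
      "\<And>l. l \<in> weights \<Longrightarrow> l (h - d) = 0"
      using semisimple_part[OF h] by blast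
    have "h - d \<in> N" unfolding N_def using d(1,3) subspace_diff[OF H_subspace h d(1)] by blast
    then have "br (h - d) z = 0" by (rule mz)
    moreover have "br d z = 0"
    proof (cases "(0 :: 'g \<Rightarrow> 'k) \<in> weights")
      case True
      then show ?thesis using d(2)[of 0 z] zH wsp_zero by simp
    next
      case False
      then show ?thesis using wsp_nonweight[of 0] zH wsp_zero z(3) by auto
    qed
    ultimately show ?thesis by (simp add: br_diff)
  qed
  have nil: "\<exists>n. (br z ^^ n) x = 0" for x
  proof -
    have "wsp l \<subseteq> gen_eigenspace (br z) 0" if l: "l \<in> weights" for l
    proof -
      have "l z = 0" using z(1) l by (simp add: N_def)
      then show ?thesis using zH by (auto simp: wsp_def)
    qed
    then have "span (\<Union>l\<in>weights. wsp l) \<subseteq> gen_eigenspace (br z) 0"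
      by (intro span_minimal gen_eigenspace_subspace[OF linear_br]) blast
    then have "x \<in> gen_eigenspace (br z) 0" using span_wsp by blast
    then show ?thesis by (simp add: gen_eigenspace_def)
  qed
  have "killing z y = 0" for y
  proof -
    have "killing z (wcomp y l) = 0" if l: "l \<in> weights" for l
    proof (cases "l = 0")
      case True
      then have "wcomp y l \<in> H" using wcomp(1)[OF l, of y] wsp_zero by simp
      then have "br z (wcomp y l) = 0" using hz br_swap[of z "wcomp y l"] by simp
      then show ?thesis by (rule killing_nilpotent_commuting) (rule nil)
    next
      case False
      show ?thesis
        by (rule killing_wsp[of z 0 _ l])
          (use False wcomp(1)[OF l] zH wsp_zero weights_outside[OF l] in auto)
    qed
    then have "(\<Sum>l\<in>weights. killing (wcomp y l) z) = 0" by (simp add: killing_sym)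
    then show ?thesis using killing_sum[of "wcomp y" weights z] wcomp(3)[of y] by (simp add: killing_sym)
  qed
  then have "z = 0" by (rule killing_nondegenerate)
  then show False using z(3) by simp
qed

text \<open>All weights vanish on the difference of \<open>h\<close> and its semisimple part, so the
  two agree.\<close>

lemma wsp_eigenvector:
  assumes l: "l \<in> weights" and "x \<in> wsp l" and h: "h \<in> H"
  shows "br h x = l h *s x"
proof -
  obtain d where d: "d \<in> H" "\<And>l x. l \<in> weights \<Longrightarrow> x \<in> wsp l \<Longrightarrow> br d x = l h *s x"
    "\<And>l. l \<in> weights \<Longrightarrow> l (h - d) = 0"
    using semisimple_part[OF h] by blast
  have "h - d = 0"
    by (intro nilpotent_part_zero subspace_diff[OF H_subspace h d(1)] d(3))
  then show ?thesis using d(2)[OF l assms(2)] by simp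
qed

lemma wsp_root_space:
  assumes "\<And>x. x \<notin> H \<Longrightarrow> l x = 0"
  shows "wsp l = root_space s br H l"
proof
  show "wsp l \<subseteq> root_space s br H l"
  proof (cases "l \<in> weights")
    case True
    then show ?thesis by (auto simp: root_space_def wsp_eigenvector)
  next
    case False
    then show ?thesis using wsp_nonweight[OF assms] by (auto simp: root_space_def)
  qed
  show "root_space s br H l \<subseteq> wsp l"
    unfolding wsp_def root_space_def gen_eigenspace_def
    by (auto intro!: exI[of _ 1])
qed

end

section \<open>Coroots and reflection automorphisms\<close>

context fd_lie_algebra
begin

definition divpow :: "('g \<Rightarrow> 'g) \<Rightarrow> nat \<Rightarrow> 'g \<Rightarrow> 'g"
  where "divpow d n x = inverse (fact n) *s (d ^^ n) x"

text \<open>All terms of the exponential series outside the index set vanish.\<close>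

definition nexp :: "('g \<Rightarrow> 'g) \<Rightarrow> 'g \<Rightarrow> 'g"
  where "nexp d x = (\<Sum>n | (d ^^ n) x \<noteq> 0. divpow d n x)"

lemma nexp_eq:
  assumes "endo d" "(d ^^ N) x = 0"
  shows "nexp d x = (\<Sum>n<N. divpow d n x)"
  unfolding nexp_def
proof (rule sum.mono_neutral_left)
  show "{n. (d ^^ n) x \<noteq> 0} \<subseteq> {..<N}"
  proof
    fix n assume "n \<in> {n. (d ^^ n) x \<noteq> 0}"
    then have "\<not> N \<le> n" using funpow_zero_mono[OF assms, of n] by auto
    then show "n \<in> {..<N}" by simp
  qed
  show "\<forall>n\<in>{..<N} - {n. (d ^^ n) x \<noteq> 0}. divpow d n x = 0" by (auto simp: divpow_def)
qed simp

lemma divpow_Suc: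
  assumes "endo d"
  shows "d (divpow d n x) = of_nat (Suc n) *s divpow d (Suc n) x"
proof -
  interpret d: Vector_Spaces.linear s s d by fact
  have "of_nat (Suc n) * inverse (fact (Suc n)) = (inverse (fact n) :: 'k)"
    by (simp add: field_simps del: of_nat_Suc)
  then show ?thesis by (simp add: divpow_def d.scale del: of_nat_Suc)
qed

lemma divpow_0 [simp]: "divpow d 0 x = x"
  by (simp add: divpow_def)

text \<open>Leibniz rule with divided powers. The induction compares both sides multiplied by n + 1,
  which cancels in characteristic 0: letting d act on either factor produces the same term with
  coefficients i and n + 1 - i.\<close>

lemma divpow_br:
  assumes d: "endo d" and der: "\<And>x y. d (br x y) = br (d x) y + br x (d y)"
  shows "divpow d n (br x y) = (\<Sum>i\<le>n. br (divpow d i x) (divpow d (n - i) y))"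
proof (induction n)
  case (Suc n)
  interpret d: Vector_Spaces.linear s s d by (rule d)
  let ?B = "\<lambda>i. br (divpow d i x) (divpow d (Suc n - i) y)"
  have "of_nat (Suc n) *s divpow d (Suc n) (br x y) = d (\<Sum>i\<le>n. br (divpow d i x) (divpow d (n - i) y))"
    unfolding Suc[symmetric] by (rule divpow_Suc[OF d, symmetric])
  also have "\<dots> = (\<Sum>i\<le>n. of_nat (Suc i) *s br (divpow d (Suc i) x) (divpow d (n - i) y))
      + (\<Sum>i\<le>n. of_nat (Suc (n - i)) *s br (divpow d i x) (divpow d (Suc (n - i)) y))"
    unfolding d.sum der divpow_Suc[OF d] br_scale_left br_scale_right sum.distrib ..
  also have "(\<Sum>i\<le>n. of_nat (Suc i) *s br (divpow d (Suc i) x) (divpow d (n - i) y)) = (\<Sum>i\<le>Suc n. of_nat i *s ?B i)"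
    by (simp add: sum.atMost_Suc_shift del: sum.atMost_Suc of_nat_Suc)
  also have "(\<Sum>i\<le>n. of_nat (Suc (n - i)) *s br (divpow d i x) (divpow d (Suc (n - i)) y)) = (\<Sum>i\<le>Suc n. of_nat (Suc n - i) *s ?B i)"
    by (simp add: Suc_diff_le del: of_nat_Suc of_nat_diff)
  also have "(\<Sum>i\<le>Suc n. of_nat i *s ?B i) + (\<Sum>i\<le>Suc n. of_nat (Suc n - i) *s ?B i) = (\<Sum>i\<le>Suc n. of_nat (Suc n) *s ?B i)"
    unfolding sum.distrib[symmetric] scale_left_distrib[symmetric] of_nat_add[symmetric]
    by (intro sum.cong refl) simp
  also have "\<dots> = of_nat (Suc n) *s (\<Sum>i\<le>Suc n. ?B i)" by (rule scale_sum_right[symmetric])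
  finally show ?case by (simp del: of_nat_Suc sum.atMost_Suc)
qed simp

lemma nexp_br:
  assumes d: "endo d" and der: "\<And>x y. d (br x y) = br (d x) y + br x (d y)"
    and nil: "\<And>x. (d ^^ N) x = 0"
  shows "nexp d (br x y) = br (nexp d x) (nexp d y)"
proof -
  have z: "divpow d n x = 0" if "N \<le> n" for n x
    using funpow_zero_mono[OF d nil that] by (simp add: divpow_def)
  let ?g = "\<lambda>i j. br (divpow d i x) (divpow d j y)"
  \<comment> \<open>With the bound N + N the triangle of index pairs contains the square with side
    N, outside of which a factor vanishes.\<close>
  have "nexp d (br x y) = (\<Sum>n<N+N. divpow d n (br x y))"
    by (rule nexp_eq[OF d]) (rule funpow_zero_mono[OF d nil], simp)
  also have "\<dots> = (\<Sum>n<N+N. \<Sum>i\<le>n. ?g i (n - i))" unfolding divpow_br[OF d der] ..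
  also have "\<dots> = (\<Sum>(i,j)\<in>{(i,j). i + j < N + N}. ?g i j)" by (rule sum.triangle_reindex[symmetric])
  also have "\<dots> = (\<Sum>(i,j)\<in>{..<N} \<times> {..<N}. ?g i j)"
  proof (rule sum.mono_neutral_right)
    show "finite {(i, j). i + j < N + N}"
      by (rule finite_subset[of _ "{..<N+N} \<times> {..<N+N}"]) auto
    show "\<forall>p\<in>{(i, j). i + j < N + N} - {..<N} \<times> {..<N}. (case p of (i, j) \<Rightarrow> ?g i j) = 0"
    proof
      fix p assume p: "p \<in> {(i, j). i + j < N + N} - {..<N} \<times> {..<N}"
      obtain i j where ij: "p = (i, j)" by (cases p)
      with p have "N \<le> i \<or> N \<le> j" by auto
      then show "(case p of (i, j) \<Rightarrow> ?g i j) = 0" using z ij by auto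
    qed
  qed auto
  also have "\<dots> = (\<Sum>i<N. \<Sum>j<N. ?g i j)" by (rule sum.cartesian_product[symmetric])
  also have "\<dots> = br (nexp d x) (nexp d y)"
    unfolding nexp_eq[OF d nil] br_sum_left br_sum_right by (rule sum.swap)
  finally show ?thesis .
qed

lemma nexp_linear:
  assumes d: "endo d" and nil: "\<And>x. (d ^^ N) x = 0"
  shows "endo (nexp d)"
proof -
  interpret dn: Vector_Spaces.linear s s "d ^^ n" for n by (rule linear_funpow[OF d])
  show ?thesis
    unfolding Vector_Spaces.linear_iff nexp_eq[OF d nil] divpow_def using vector_space_axioms
    by (auto simp: dn.add dn.scale scale_right_distrib sum.distrib scale_sum_right mult.commute)
qed

lemma nexp_stable:
  assumes "endo d" "subspace S" "\<And>x. x \<in> S \<Longrightarrow> d x \<in> S" "x \<in> S"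
  shows "nexp d x \<in> S"
  unfolding nexp_def divpow_def using assms
  by (intro subspace_sum subspace_scale funpow_image_subset) auto

lemma derivation_br: "br z (br x y) = br (br z x) y + br x (br z y)"
  by (simp add: br_br)

end

section \<open>Roots, duality on the Cartan subalgebra and coroots\<close>

context simple_cartan_lie_algebra
begin

abbreviation R where "R \<equiv> roots s br H"

lemma zero_weight: "0 \<in> weights"
proof (rule ccontr)
  assume "0 \<notin> weights"
  then have "H = {0}" using wsp_nonweight[of 0] wsp_zero by auto
  obtain l h where l: "l \<in> weights" "h \<in> H" "l h \<noteq> 0" using weights_nonzero by blast
  have "l 0 = 0" using weight_linear(2)[OF l(1,2,2), of 0] by simp
  then show False using \<open>H = {0}\<close> l by simp
qed

lemma roots_eq: "R = weights - {0}"
proof -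
  have "l \<in> dual_space s H" if "l \<in> weights" for l
    using weight_linear[OF that] weights_outside[OF that] by (auto simp: dual_space_def lin_on_def)
  moreover have "l \<in> weights \<longleftrightarrow> root_space s br H l \<noteq> {0}" if "l \<in> dual_space s H" for l
  proof -
    have "\<And>x. x \<notin> H \<Longrightarrow> l x = 0" using that by (simp add: dual_space_def)
    then show ?thesis using wsp_root_space[of l] by (simp add: weights_def)
  qed
  ultimately show ?thesis unfolding roots_def by blast
qed

lemma root_weight: "a \<in> R \<Longrightarrow> a \<in> weights" and root_nonzero: "a \<in> R \<Longrightarrow> a \<noteq> 0"
  by (auto simp: roots_eq)

lemma root_space_wsp: "l \<in> weights \<Longrightarrow> root_space s br H l = wsp l"
  using wsp_root_space weights_outside by metis

text \<open>Weight spaces of non-opposite weights are orthogonal, so \<open>x\<close> sees only one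
  component of \<open>y\<close>.\<close>

lemma killing_wcomp:
  assumes "l \<in> weights" "x \<in> wsp l"
  shows "killing x y = killing x (wcomp y (- l))"
proof -
  have "killing x (wcomp y m) = 0" if m: "m \<in> weights" "m \<noteq> - l" for m
    by (rule killing_wsp[OF assms(2) wcomp(1)[OF m(1)]])
      (use m assms weights_outside in \<open>auto simp: add_eq_0_iff\<close>)
  then have z: "killing (wcomp y m) x = (if m = - l then killing (wcomp y (- l)) x else 0)" if "m \<in> weights" for m
    using that killing_sym by auto
  have "killing y x = (\<Sum>m\<in>weights. killing (wcomp y m) x)"
    unfolding killing_sum[symmetric] wcomp(3) ..
  also have "\<dots> = (\<Sum>m\<in>weights. if m = - l then killing (wcomp y (- l)) x else 0)"
    by (rule sum.cong) (use z in auto)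
  also have "\<dots> = killing (wcomp y (- l)) x"
    using weights_finite by (auto simp: wcomp(2) killing_0)
  finally show ?thesis by (simp add: killing_sym)
qed

text \<open>Extend \<open>a\<close> to the whole algebra through the projection to weight 0 and
  represent the extension; the component of weight 0 of the representing element does the job on
  \<open>H\<close>.\<close>

lemma killing_H_represents:
  assumes a: "a \<in> weights"
  shows "\<exists>t\<in>H. \<forall>h\<in>H. killing t h = a h"
proof -
  have aH: "x \<in> H \<Longrightarrow> y \<in> H \<Longrightarrow> a (x + y) = a x + a y" "x \<in> H \<Longrightarrow> a (c *s x) = c * a x" for x y c
    using weight_linear[OF a] by blast+
  have w0: "wcomp x 0 \<in> H" for x using wcomp(1)[OF zero_weight] wsp_zero by blast
  have "\<exists>d. \<forall>x. killing d x = a (wcomp x 0)"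
    by (rule killing_represents) (simp_all add: wcomp_add wcomp_scale aH w0)
  then obtain d where d: "\<And>x. killing d x = a (wcomp x 0)" by blast
  have "killing (wcomp d 0) h = a h" if h: "h \<in> H" for h
  proof -
    have hw: "h \<in> wsp 0" using h wsp_zero by simp
    have "killing h d = killing h (wcomp d 0)" using killing_wcomp[OF zero_weight hw, of d] by simp
    moreover have "wcomp h 0 = h" by (simp add: wcomp_wsp[OF zero_weight hw])
    ultimately show ?thesis using d[of h] by (simp add: killing_sym)
  qed
  then show ?thesis using w0 by blast
qed

lemma killing_H_nondegenerate:
  assumes "t \<in> H" "\<And>h. h \<in> H \<Longrightarrow> killing t h = 0"
  shows "t = 0"
proof (rule killing_nondegenerate)
  fix y
  have "wcomp y 0 \<in> H" using wcomp(1)[OF zero_weight] wsp_zero by blast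
  then show "killing t y = 0"
    using killing_wcomp[OF zero_weight, of t y] assms wsp_zero by simp
qed

text \<open>By invariance, [x, y] for opposite weight vectors is the multiple
  \<open>killing x y\<close> of the element \<open>t\<close> dual to \<open>a\<close>. If a t were
  0, all weights, being rational multiples of \<open>a\<close> at [x, y] = t, would vanish at
  \<open>t\<close>, and \<open>nilpotent_part_zero\<close> would give t = 0. So the coroot is
  \<open>t\<close> scaled by 2 / a t, and it is unique because all these brackets lie on one
  line.\<close>

lemma sl2_triple:
  assumes a: "a \<in> R"
  shows "\<exists>e f. e \<in> wsp a \<and> f \<in> wsp (- a) \<and> br e f = coroot s br H a \<and> coroot s br H a \<in> H \<and>
    a (coroot s br H a) = 2 \<and> - a \<in> R"
    and coroot_unique: "k \<in> bracket_span s br (root_space s br H a) (root_space s br H (- a)) \<Longrightarrow>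
      a k = 2 \<Longrightarrow> coroot s br H a = k"
proof -
  have aw: "a \<in> weights" and an: "a \<noteq> 0" using a root_weight root_nonzero by auto
  obtain t where t: "t \<in> H" "\<And>h. h \<in> H \<Longrightarrow> killing t h = a h"
    using killing_H_represents[OF aw] by blast
  have xy: "br x y = killing x y *s t" if x: "x \<in> wsp a" and y: "y \<in> wsp (- a)" for x y
  proof -
    have H: "br x y \<in> H" using wsp_br[OF x y] wsp_zero by simp
    have kH: "killing x y *s t \<in> H" by (rule subspace_scale[OF H_subspace t(1)])
    have "br x y - killing x y *s t = 0"
    proof (rule killing_H_nondegenerate)
      show "br x y - killing x y *s t \<in> H" by (rule subspace_diff[OF H_subspace H kH])
      fix h assume h: "h \<in> H"
      have "wsp (- a) = root_space s br H (- a)"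
        by (rule wsp_root_space) (simp add: weights_outside[OF aw])
      then have "br h y = (- a) h *s y" using y h by (simp add: root_space_def)
      then have "br h y = - (a h *s y)" by simp
      then have "br y h = a h *s y" using br_swap[of y h] by simp
      then have "killing (br x y) h = a h * killing x y"
        unfolding killing_invariant by (simp add: killing_scale)
      moreover have "killing (br x y) h = killing (br x y - killing x y *s t) h + killing x y * killing t h"
        unfolding killing_scale(1)[symmetric] killing_add(1)[symmetric] by simp
      ultimately show "killing (br x y - killing x y *s t) h = 0" using t(2)[OF h] by simp
    qed
    then show ?thesis by simp
  qed
  obtain x where x: "x \<in> wsp a" "x \<noteq> 0" using aw wsp_0 unfolding weights_def by blast
  have "\<exists>y0. killing x y0 \<noteq> 0" using killing_nondegenerate x(2) by blast
  then obtain y0 where "killing x y0 \<noteq> 0" ..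
  then have y0: "killing x (wcomp y0 (- a)) \<noteq> 0" using killing_wcomp[OF aw x(1)] by simp
  then have mw: "- a \<in> weights" using wcomp(2)[of "- a" y0] killing_0(2) by metis
  have mR: "- a \<in> R" using mw an by (simp add: roots_eq)
  define y where "y = inverse (killing x (wcomp y0 (- a))) *s wcomp y0 (- a)"
  have y: "y \<in> wsp (- a)" unfolding y_def by (intro subspace_scale wsp_subspace wcomp(1) mw)
  have "killing x y = 1" using y0 by (simp add: y_def killing_scale)
  then have txy: "br x y = t" using xy[OF x(1) y] by simp
  have at: "a t \<noteq> 0"
  proof
    assume at: "a t = 0"
    have "l t = 0" if "l \<in> weights" for l
      using weight_rational_multiple[OF weights_outside[OF aw] x(1) y that] at txy by auto
    then have "t = 0" by (rule nilpotent_part_zero[OF t(1)])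
    then have "a h = 0" for h using t(2)[of h] weights_outside[OF aw, of h] by (cases "h \<in> H") (auto simp: killing_0)
    then show False using an by (auto simp: fun_eq_iff)
  qed
  define h where "h = (2 / a t) *s t"
  have hH: "h \<in> H" unfolding h_def by (rule subspace_scale[OF H_subspace t(1)])
  have ah: "a h = 2" using weight_linear(2)[OF aw t(1) t(1), of "2 / a t"] at by (simp add: h_def)
  define f where "f = (2 / a t) *s y"
  have f: "f \<in> wsp (- a)" unfolding f_def by (rule subspace_scale[OF wsp_subspace y])
  have ef: "br x f = h" by (simp add: f_def h_def br_scale_right txy)
  have bs: "bracket_span s br (root_space s br H a) (root_space s br H (- a)) \<subseteq> span {t}"
    unfolding bracket_span_def root_space_wsp[OF aw] root_space_wsp[OF mw]
  proof (rule span_minimal)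
    show "{br x y |x y. x \<in> wsp a \<and> y \<in> wsp (- a)} \<subseteq> span {t}"
      using xy by (auto simp: span_singleton)
  qed simp
  have u: "k = h" if k: "k \<in> bracket_span s br (root_space s br H a) (root_space s br H (- a)) \<and> a k = 2" for k
  proof -
    obtain c where c: "k = c *s t" using bs k unfolding span_singleton by blast
    then have "c * a t = 2" using k weight_linear(2)[OF aw t(1) t(1), of c] by simp
    then have "c = 2 / a t" using at by (simp add: field_simps)
    then show "k = h" using c h_def by simp
  qed
  have ch: "coroot s br H a = h"
    unfolding coroot_def
  proof (rule the_equality)
    have "br x f \<in> bracket_span s br (root_space s br H a) (root_space s br H (- a))"
      unfolding bracket_span_def root_space_wsp[OF aw] root_space_wsp[OF mw]
      by (rule span_base) (use x f in blast)
    then show "h \<in> bracket_span s br (root_space s br H a) (root_space s br H (- a)) \<and> a h = 2"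
      using ef ah by simp
  qed (rule u)
  then show "\<exists>e f. e \<in> wsp a \<and> f \<in> wsp (- a) \<and> br e f = coroot s br H a \<and> coroot s br H a \<in> H \<and>
    a (coroot s br H a) = 2 \<and> - a \<in> R"
    using x(1) f ef hH ah mR by blast
  show "coroot s br H a = k"
    if "k \<in> bracket_span s br (root_space s br H a) (root_space s br H (- a))" "a k = 2"
    using u[of k] ch that by simp
qed

lemma root_string_leaves_weights:
  assumes a: "a \<in> R"
  shows "\<exists>n::nat. (\<lambda>z. l z + of_nat n * a z) \<notin> weights"
proof (rule ccontr)
  assume "\<not> ?thesis"
  then have sub: "range (\<lambda>(n::nat) z. l z + of_nat n * a z) \<subseteq> weights" by auto
  obtain z where z: "a z \<noteq> 0" using root_nonzero[OF a] by (auto simp: fun_eq_iff)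
  have "inj (\<lambda>(n::nat) z. l z + of_nat n * a z)"
  proof (rule injI)
    fix m n :: nat
    assume "(\<lambda>z. l z + of_nat m * a z) = (\<lambda>z. l z + of_nat n * a z)"
    from fun_cong[OF this, of z] show "m = n" using z by simp
  qed
  then have "infinite (range (\<lambda>(n::nat) z. l z + of_nat n * a z))" by (rule range_inj_infinite)
  then show False using finite_subset[OF sub weights_finite] by blast
qed

lemma root_vector_nilpotent:
  assumes a: "a \<in> R" and e: "e \<in> wsp a"
  shows "\<exists>N. \<forall>x. (br e ^^ N) x = 0"
proof -
  have "wsp l \<subseteq> gen_eigenspace (br e) 0" if l: "l \<in> weights" for l
  proof
    fix x assume x: "x \<in> wsp l"
    have n: "(br e ^^ n) x \<in> wsp (\<lambda>z. l z + of_nat n * a z)" for n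
    proof (induction n)
      case 0
      then show ?case using x by simp
    next
      case (Suc n)
      have "a + (\<lambda>z. l z + of_nat n * a z) = (\<lambda>z. l z + of_nat (Suc n) * a z)"
        by (auto simp: algebra_simps)
      then show ?case using wsp_br[OF e Suc] by simp
    qed
    obtain n :: nat where out: "(\<lambda>z. l z + of_nat n * a z) \<notin> weights"
      using root_string_leaves_weights[OF a] by blast
    have "wsp (\<lambda>z. l z + of_nat n * a z) = {0}"
      by (rule wsp_nonweight[OF _ out]) (simp add: weights_outside l root_weight[OF a])
    then have "(br e ^^ n) x = 0" using n[of n] by simp
    then show "x \<in> gen_eigenspace (br e) 0" by (auto simp: gen_eigenspace_def)
  qed
  then have "span (\<Union>l\<in>weights. wsp l) \<subseteq> gen_eigenspace (br e) 0"
    by (intro span_minimal gen_eigenspace_subspace[OF linear_br]) blast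
  then have nil: "\<exists>n. (br e ^^ n) x = 0" for x
    unfolding span_wsp by (auto simp: gen_eigenspace_def)
  obtain N where "\<forall>x\<in>UNIV. (br e ^^ N) x = 0"
    using funpow_uniform[OF linear_br subspace_UNIV nil] by blast
  then show ?thesis by auto
qed

section \<open>Automorphisms attached to roots\<close>

definition automorphism :: "('g \<Rightarrow> 'g) \<Rightarrow> bool"
  where "automorphism f \<longleftrightarrow> endo f \<and> bij f \<and> (\<forall>x y. f (br x y) = br (f x) (f y))"

text \<open>The kernel is an ideal, hence 0 by simplicity, and bijectivity follows by dimension; no
  inverse has to be written down.\<close>

lemma automorphismI:
  assumes f: "endo f" and hom: "\<And>x y. f (br x y) = br (f x) (f y)"
    and "f z \<noteq> 0"
  shows "automorphism f"
proof -
  interpret f: Vector_Spaces.linear s s f by (rule f)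
  have "lie_ideal s br {x. f x = 0}"
    unfolding lie_ideal_def using f.subspace_kernel by (simp add: hom)
  moreover have "{x. f x = 0} \<noteq> UNIV" using assms(3) by auto
  ultimately have "{x. f x = 0} = {0}" using ideals by blast
  then have "inj f" unfolding f.inj_iff_eq_0 by blast
  then have "bij f" using linear_inj_imp_surj[OF f] by (simp add: bij_def)
  then show ?thesis using f hom by (simp add: automorphism_def)
qed

lemma automorphism_comp: "automorphism f \<Longrightarrow> automorphism g \<Longrightarrow> automorphism (f \<circ> g)"
  using Vector_Spaces.linear_compose[of s s g s f] by (auto simp: automorphism_def bij_comp)

lemma automorphism_id: "automorphism id"
  using linear_ident bij_id by (simp add: automorphism_def id_def)

lemma nexp_automorphism:
  assumes a: "a \<in> R" and e: "e \<in> wsp a"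
  shows "automorphism (nexp (br e))"
proof -
  obtain N where N: "\<And>x. (br e ^^ N) x = 0" using root_vector_nilpotent[OF assms] by blast
  show ?thesis
  proof (cases "e = 0")
    case True
    then have "nexp (br e) x = x" for x using nexp_eq[of "br e" 1 x, OF linear_br] by simp
    then have "nexp (br e) = id" by auto
    then show ?thesis using automorphism_id by simp
  next
    case False
    \<comment> \<open>A nonzero fixed vector, which is the nonzero value that
      \<open>automorphismI\<close> asks for.\<close>
    have "nexp (br e) e = e" using nexp_eq[of "br e" 1 e, OF linear_br] by (simp add: br_self)
    then show ?thesis
      using False by (intro automorphismI[of _ e] nexp_linear[OF linear_br N] nexp_br[OF linear_br derivation_br N]) auto
  qed
qed

text \<open>The witness is \<open>exp(ad e) exp(- ad f) exp(ad e)\<close> for an \<open>sl\<^sub>2\<close>-triple \<open>(e, f)\<close>.\<close>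

lemma reflection_automorphism:
  assumes a: "a \<in> R"
  shows "\<exists>t. automorphism t \<and> (\<forall>h\<in>H. t h = h - a h *s coroot s br H a) \<and>
    (\<forall>l\<in>weights. \<forall>x\<in>wsp l. t x \<in> span (\<Union>m\<in>wstring a l. wsp m))"
proof -
  note aw = root_weight[OF a]
  let ?k = "coroot s br H a"
  obtain e f where e: "e \<in> wsp a" and f: "f \<in> wsp (- a)" and ef: "br e f = ?k" and kH: "?k \<in> H"
    and ak: "a ?k = 2" and mR: "- a \<in> R"
    using sl2_triple[OF a] by blast
  \<comment> \<open>The sign makes \<open>?F\<close> the exponential of - ad f, and [g, e] the
    coroot.\<close>
  define g where "g = - f"
  have g: "g \<in> wsp (- a)" unfolding g_def by (rule subspace_neg[OF wsp_subspace f])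
  have he: "br h e = a h *s e" if "h \<in> H" for h by (rule wsp_eigenvector[OF aw e that])
  have hg: "br h g = - (a h *s g)" if "h \<in> H" for h
    using wsp_eigenvector[OF root_weight[OF mR] g that] by simp
  have eg: "br g e = ?k" unfolding g_def by (simp add: br_minus br_swap[of f e] ef)
  let ?E = "nexp (br e)" and ?F = "nexp (br g)"
  have E: "automorphism ?E" by (rule nexp_automorphism[OF a e])
  have F: "automorphism ?F" by (rule nexp_automorphism[OF mR g])
  interpret E: Vector_Spaces.linear s s ?E using E by (simp add: automorphism_def)
  interpret F: Vector_Spaces.linear s s ?F using F by (simp add: automorphism_def)
  have eh: "br e h = - (a h *s e)" if "h \<in> H" for h using he[OF that] br_swap[of e h] by simp
  have gh: "br g h = a h *s g" if "h \<in> H" for h using hg[OF that] br_swap[of g h] by simp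
  have Ee: "?E e = e" using nexp_eq[of "br e" 1 e, OF linear_br] by (simp add: br_self)
  have Eh: "?E h = h - a h *s e" if h: "h \<in> H" for h
    using nexp_eq[of "br e" 2 h, OF linear_br] by (simp add: eh[OF h] br_minus br_scale_right br_self numeral_2_eq_2 divpow_def)
  have Fg: "?F h = h + a h *s g" if h: "h \<in> H" for h
    using nexp_eq[of "br g" 2 h, OF linear_br] by (simp add: gh[OF h] br_scale_right br_self numeral_2_eq_2 divpow_def)
  \<comment> \<open>[g, [g, e]] = [g, k] = 2 g for the coroot k, so the quadratic term with factor
    1/2 is \<open>g\<close>, and the cubic one vanishes.\<close>
  have Fe: "?F e = e + ?k + g"
    using nexp_eq[of "br g" 3 e, OF linear_br]
    by (simp add: eg gh[OF kH] ak br_scale_right br_self numeral_3_eq_3 numeral_2_eq_2 divpow_def)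
  have th: "?E (?F (?E h)) = h - a h *s ?k" if h: "h \<in> H" for h
  proof -
    have "?F (?E h) = h - a h *s ?k - a h *s e"
      unfolding Eh[OF h] F.diff F.scale Fg[OF h] Fe by (simp add: scale_right_distrib)
    then have "?E (?F (?E h)) = ?E h - a h *s ?E ?k - a h *s ?E e" by (simp add: E.diff E.scale)
    also have "\<dots> = h - a h *s e - a h *s (?k - 2 *s e) - a h *s e" by (simp add: Eh h kH ak Ee)
    also have "a h *s (?k - 2 *s e) = a h *s ?k - (a h *s e + a h *s e)"
      using scale_left_distrib[of "a h" "a h" e] by (simp add: scale_right_diff_distrib mult_2_right)
    finally show ?thesis by simp
  qed
  have st: "?E (?F (?E x)) \<in> span (\<Union>m\<in>wstring a l. wsp m)" if l: "l \<in> weights" and x: "x \<in> wsp l" for l x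
  proof -
    let ?S = "span (\<Union>m\<in>wstring a l. wsp m)"
    have out: "\<And>x. x \<notin> H \<Longrightarrow> a x = 0" by (rule weights_outside[OF aw])
    have e': "e \<in> wsp (\<lambda>z. of_int 1 * a z)" using e by simp
    have g': "g \<in> wsp (\<lambda>z. of_int (- 1) * a z)" using g by (simp only: wsp_minus)
    have es: "br e v \<in> ?S" if "v \<in> ?S" for v by (rule wstring_stable[OF out l e' that])
    have gs: "br g v \<in> ?S" if "v \<in> ?S" for v by (rule wstring_stable[OF out l g' that])
    have Es: "?E v \<in> ?S" if "v \<in> ?S" for v by (rule nexp_stable[OF linear_br subspace_span es that])
    have Fs: "?F v \<in> ?S" if "v \<in> ?S" for v by (rule nexp_stable[OF linear_br subspace_span gs that])
    have "x \<in> ?S" using x wstring_self[OF l] by (intro span_base) blast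
    then show ?thesis by (intro Es Fs)
  qed
  have "automorphism (?E \<circ> (?F \<circ> ?E))" by (intro automorphism_comp E F)
  then show ?thesis using th st by (intro exI[of _ "?E \<circ> (?F \<circ> ?E)"]) auto
qed

definition refl_aut :: "('g \<Rightarrow> 'k) \<Rightarrow> 'g \<Rightarrow> 'g"
  where "refl_aut a = (SOME t. automorphism t \<and> (\<forall>h\<in>H. t h = h - a h *s coroot s br H a) \<and>
    (\<forall>l\<in>weights. \<forall>x\<in>wsp l. t x \<in> span (\<Union>m\<in>wstring a l. wsp m)))"

lemma refl_aut:
  assumes a: "a \<in> R"
  shows "automorphism (refl_aut a)" "h \<in> H \<Longrightarrow> refl_aut a h = h - a h *s coroot s br H a"
    "l \<in> weights \<Longrightarrow> x \<in> wsp l \<Longrightarrow> refl_aut a x \<in> span (\<Union>m\<in>wstring a l. wsp m)"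
  using someI_ex[OF reflection_automorphism[OF a], folded refl_aut_def] by blast+

section \<open>Reflections of weights and of coroots\<close>

abbreviation cor where "cor \<equiv> coroot s br H"
abbreviation refl where "refl \<equiv> root_refl s br H"

lemma cor_H: "a \<in> R \<Longrightarrow> cor a \<in> H" and root_cor: "a \<in> R \<Longrightarrow> a (cor a) = 2"
  and uminus_root: "a \<in> R \<Longrightarrow> - a \<in> R"
  using sl2_triple by blast+

lemma weight_diff_scale:
  assumes "l \<in> weights" "h \<in> H" "k \<in> H"
  shows "l (h - c *s k) = l h - c * l k"
  using weight_linear(1)[OF assms(1,2), of "(- c) *s k"] weight_linear(2)[OF assms(1,3,3), of "- c"]
    subspace_scale[OF H_subspace assms(3), of "- c"] by simp

lemma refl_outside: "a \<in> R \<Longrightarrow> l \<in> weights \<Longrightarrow> x \<notin> H \<Longrightarrow> refl a l x = 0"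
  by (simp add: root_refl_def weights_outside root_weight)

lemma refl_aut_H:
  assumes "a \<in> R" "h \<in> H"
  shows "refl_aut a h \<in> H"
  unfolding refl_aut(2)[OF assms] using assms by (intro subspace_diff subspace_scale H_subspace cor_H)

lemma refl_apply_refl_aut:
  assumes a: "a \<in> R" and l: "l \<in> weights" and h: "h \<in> H"
  shows "refl a l (refl_aut a h) = l h"
  unfolding refl_aut(2)[OF a h] root_refl_def
  by (simp add: weight_diff_scale cor_H[OF a] root_weight[OF a] l h root_cor[OF a] algebra_simps)

text \<open>An automorphism preserving \<open>H\<close> permutes weight spaces by composing weights
  with its inverse on \<open>H\<close>. Here it is an involution on \<open>H\<close>, and the
  composed weight is \<open>refl a l\<close>.\<close>

lemma refl_aut_wsp:
  assumes a: "a \<in> R" and l: "l \<in> weights"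
  shows "refl_aut a ` wsp l = wsp (refl a l)"
proof -
  let ?t = "refl_aut a"
  interpret t: Vector_Spaces.linear s s ?t using refl_aut(1)[OF a] by (simp add: automorphism_def)
  have hom: "?t (br x y) = br (?t x) (?t y)" for x y
    using refl_aut(1)[OF a] by (simp add: automorphism_def)
  have bij: "bij ?t" using refl_aut(1)[OF a] by (simp add: automorphism_def)
  have inv: "?t (?t h) = h" if h: "h \<in> H" for h
  proof -
    have "a (?t h) = - a h"
      unfolding refl_aut(2)[OF a h] weight_diff_scale[OF root_weight[OF a] h cor_H[OF a]] root_cor[OF a]
      by simp
    then have "?t (?t h) = ?t h + a h *s cor a"
      using refl_aut(2)[OF a refl_aut_H[OF a h]] by simp
    then show ?thesis unfolding refl_aut(2)[OF a h] by simp
  qed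
  have W: "wsp (refl a l) = root_space s br H (refl a l)"
    by (rule wsp_root_space) (rule refl_outside[OF a l])
  show ?thesis
  proof
    show "?t ` wsp l \<subseteq> wsp (refl a l)"
    proof
      fix y assume "y \<in> ?t ` wsp l"
      then obtain x where x: "x \<in> wsp l" "y = ?t x" by blast
      have "br h y = refl a l h *s y" if h: "h \<in> H" for h
      proof -
        have "br h y = ?t (br (?t h) x)" unfolding hom inv[OF h] x(2) ..
        also have "\<dots> = l (?t h) *s y"
          unfolding wsp_eigenvector[OF l x(1) refl_aut_H[OF a h]] t.scale x(2) ..
        also have "l (?t h) = refl a l h"
          using refl_apply_refl_aut[OF a l refl_aut_H[OF a h]] inv[OF h] by simp
        finally show ?thesis .
      qed
      then show "y \<in> wsp (refl a l)" unfolding W root_space_def by simp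
    qed
    show "wsp (refl a l) \<subseteq> ?t ` wsp l"
    proof
      fix y assume y: "y \<in> wsp (refl a l)"
      obtain x where x: "y = ?t x" using bij by (metis bij_pointE)
      have "x \<in> root_space s br H l" unfolding root_space_def
      proof (intro CollectI ballI)
        fix h assume h: "h \<in> H"
        have "?t (br h x) = br (?t h) y" unfolding hom x ..
        also have "\<dots> = refl a l (?t h) *s y"
          using y refl_aut_H[OF a h] unfolding W root_space_def by simp
        also have "\<dots> = ?t (l h *s x)" unfolding refl_apply_refl_aut[OF a l h] t.scale x ..
        finally show "br h x = l h *s x" using bij by (simp add: bij_def inj_eq)
      qed
      then show "y \<in> ?t ` wsp l" using x root_space_wsp[OF l] by blast
    qed
  qed
qed

lemma refl_weight:
  assumes a: "a \<in> R" and l: "l \<in> weights"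
  shows "refl a l \<in> weights"
proof -
  have "inj (refl_aut a)" using refl_aut(1)[OF a] by (simp add: automorphism_def bij_def)
  interpret t: Vector_Spaces.linear s s "refl_aut a" using refl_aut(1)[OF a] by (simp add: automorphism_def)
  obtain x where x: "x \<in> wsp l" "x \<noteq> 0" using l wsp_0 unfolding weights_def by blast
  have "refl_aut a x \<noteq> 0" using \<open>inj (refl_aut a)\<close> x(2) t.inj_iff_eq_0 by blast
  moreover have "refl_aut a x \<in> wsp (refl a l)" using refl_aut_wsp[OF a l] x(1) by blast
  ultimately have "wsp (refl a l) \<noteq> {0}" by blast
  then show ?thesis unfolding weights_def using refl_outside[OF a l] by blast
qed

lemma weight_cor_integer:
  assumes a: "a \<in> R" and l: "l \<in> weights"
  shows "\<exists>j::int. l (cor a) = of_int j"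
proof -
  interpret t: Vector_Spaces.linear s s "refl_aut a" using refl_aut(1)[OF a] by (simp add: automorphism_def)
  have "inj (refl_aut a)" using refl_aut(1)[OF a] by (simp add: automorphism_def bij_def)
  obtain x where x: "x \<in> wsp l" "x \<noteq> 0" using l wsp_0 unfolding weights_def by blast
  have n0: "refl_aut a x \<noteq> 0" using \<open>inj (refl_aut a)\<close> x(2) t.inj_iff_eq_0 by blast
  have "refl a l \<in> wstring a l"
  proof (rule ccontr)
    assume n: "refl a l \<notin> wstring a l"
    have "refl_aut a x = 0"
    proof (rule wsp_span_disjoint[of "wstring a l" _ "refl a l"])
      show "wstring a l \<subseteq> weights" by (auto simp: wstring_def)
      show "refl_aut a x \<in> span (\<Union>m\<in>wstring a l. wsp m)" by (rule refl_aut(3)[OF a l x(1)])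
      show "refl_aut a x \<in> wsp (refl a l)" using refl_aut_wsp[OF a l] x(1) by blast
    qed (use n refl_outside[OF a l] in auto)
    then show False using n0 by simp
  qed
  then obtain j :: int where "refl a l = (\<lambda>z. l z + of_int j * a z)" by (auto simp: wstring_def)
  from fun_cong[OF this, of "cor a"] have "l (cor a) - l (cor a) * 2 = l (cor a) + of_int j * 2"
    unfolding root_refl_def root_cor[OF a] .
  then have "2 * (l (cor a) + of_int j) = 0" by (simp add: algebra_simps)
  then have "l (cor a) = of_int (- j)" by (simp add: add_eq_0_iff)
  then show ?thesis ..
qed

lemma refl_root: "a \<in> R \<Longrightarrow> b \<in> R \<Longrightarrow> refl a b \<in> R"
proof -
  assume a: "a \<in> R" and b: "b \<in> R"
  have "refl a b \<noteq> 0"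
  proof
    assume z: "refl a b = 0"
    have "b h = 0" if "h \<in> H" for h
      using refl_apply_refl_aut[OF a root_weight[OF b] that] z by simp
    then have "b = 0" using weights_outside[OF root_weight[OF b]] by (auto simp: fun_eq_iff)
    then show False using root_nonzero[OF b] by simp
  qed
  then show ?thesis using refl_weight[OF a root_weight[OF b]] by (simp add: roots_eq)
qed

text \<open>The reflection automorphism carries the coroot of \<open>b\<close> to an element with
  the two properties that characterize the coroot of \<open>refl a b\<close>.\<close>

lemma cor_refl:
  assumes a: "a \<in> R" and b: "b \<in> R"
  shows "cor (refl a b) = cor b - a (cor b) *s cor a"
proof -
  let ?t = "refl_aut a" and ?c = "refl a b"
  have cR: "?c \<in> R" by (rule refl_root[OF a b])
  note cw = root_weight[OF cR] and bw = root_weight[OF b]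
  have hom: "?t (br x y) = br (?t x) (?t y)" for x y
    using refl_aut(1)[OF a] by (simp add: automorphism_def)
  have neg: "refl a (- b) = - ?c" by (auto simp: root_refl_def)
  obtain e f where e: "e \<in> wsp b" and f: "f \<in> wsp (- b)" and ef: "br e f = cor b"
    using sl2_triple[OF b] by blast
  have "?t (cor b) = br (?t e) (?t f)" by (simp add: ef[symmetric] hom)
  moreover have te: "?t e \<in> wsp ?c" using refl_aut_wsp[OF a bw] e by blast
  moreover have tf: "?t f \<in> wsp (- ?c)"
    using refl_aut_wsp[OF a root_weight[OF uminus_root[OF b]]] f neg by auto
  ultimately have "?t (cor b) \<in> bracket_span s br (root_space s br H ?c) (root_space s br H (- ?c))"
    unfolding bracket_span_def root_space_wsp[OF cw] root_space_wsp[OF root_weight[OF uminus_root[OF cR]]]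
    by (intro span_base) blast
  moreover have "?c (?t (cor b)) = 2"
    using refl_apply_refl_aut[OF a bw cor_H[OF b]] root_cor[OF b] by simp
  ultimately have "?t (cor b) = cor ?c" by (intro coroot_unique[OF cR, symmetric]) auto
  then show ?thesis using refl_aut(2)[OF a cor_H[OF b]] by simp
qed

end

section \<open>Integral root systems\<close>

text \<open>\<open>c \<mu> \<beta>\<close> stands for the pairing of \<mu> with the coroot of
  \<beta>, additive in \<mu> only; how coroots reflect is encoded in \<open>c_refl\<close>. Proper
  multiples of a root may be roots, whence the second alternative in \<open>positive_refl\<close>
  and the lemma \<open>refl_multiple\<close>.\<close>

locale integral_root_system = module sc
  for sc :: "int \<Rightarrow> 'v::ab_group_add \<Rightarrow> 'v" +
  fixes R \<Pi> :: "'v set" and c :: "'v \<Rightarrow> 'v \<Rightarrow> int"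
  assumes finite_R: "finite R" and base_R: "\<Pi> \<subseteq> R" and zero_R: "0 \<notin> R"
    and base_independent: "(\<Sum>\<alpha>\<in>\<Pi>. sc (n \<alpha>) \<alpha>) = 0 \<Longrightarrow> \<alpha> \<in> \<Pi> \<Longrightarrow> n \<alpha> = 0"
    and base_combination: "\<beta> \<in> R \<Longrightarrow> \<exists>n :: 'v \<Rightarrow> nat.
      \<beta> = (\<Sum>\<alpha>\<in>\<Pi>. sc (int (n \<alpha>)) \<alpha>) \<or> \<beta> = - (\<Sum>\<alpha>\<in>\<Pi>. sc (int (n \<alpha>)) \<alpha>)"
    and c_add: "\<mu> \<in> span R \<Longrightarrow> \<nu> \<in> span R \<Longrightarrow> \<beta> \<in> R \<Longrightarrow> c (\<mu> + \<nu>) \<beta> = c \<mu> \<beta> + c \<nu> \<beta>"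
    and c_self: "\<beta> \<in> R \<Longrightarrow> c \<beta> \<beta> = 2"
    and refl_R: "\<beta> \<in> R \<Longrightarrow> \<gamma> \<in> R \<Longrightarrow> \<gamma> - sc (c \<gamma> \<beta>) \<beta> \<in> R"
    and c_refl: "\<mu> \<in> span R \<Longrightarrow> \<beta> \<in> R \<Longrightarrow> \<gamma> \<in> R \<Longrightarrow>
      c (\<mu> - sc (c \<mu> \<beta>) \<beta>) (\<gamma> - sc (c \<gamma> \<beta>) \<beta>) = c \<mu> \<gamma>"
begin

section \<open>Additive functionals and coordinates relative to a base\<close>

abbreviation Q where "Q \<equiv> span R"

definition additive_on_Q :: "('v \<Rightarrow> int) \<Rightarrow> bool"
  where "additive_on_Q g \<longleftrightarrow> (\<forall>\<mu>\<in>Q. \<forall>\<nu>\<in>Q. g (\<mu> + \<nu>) = g \<mu> + g \<nu>)"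

lemma R_Q: "\<beta> \<in> R \<Longrightarrow> \<beta> \<in> Q" by (rule span_base)

lemma base_Q: "\<alpha> \<in> \<Pi> \<Longrightarrow> \<alpha> \<in> Q" using base_R R_Q by blast

lemma finite_base: "finite \<Pi>" using base_R finite_R by (rule finite_subset)

lemma additive_zero: "additive_on_Q g \<Longrightarrow> g 0 = 0"
  unfolding additive_on_Q_def using span_zero by force

lemma additive_minus:
  assumes g: "additive_on_Q g" and \<mu>: "\<mu> \<in> Q"
  shows "g (- \<mu>) = - g \<mu>"
proof -
  have "g (\<mu> + - \<mu>) = g \<mu> + g (- \<mu>)"
    using g \<mu> span_neg[OF \<mu>] unfolding additive_on_Q_def by blast
  then show ?thesis using additive_zero[OF g] by simp
qed

lemma additive_scale:
  assumes g: "additive_on_Q g" and \<mu>: "\<mu> \<in> Q"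
  shows "g (sc n \<mu>) = n * g \<mu>"
proof -
  have nat: "g (sc (int k) \<mu>) = int k * g \<mu>" for k
  proof (induction k)
    case (Suc k)
    have "g (sc (int k) \<mu> + \<mu>) = g (sc (int k) \<mu>) + g \<mu>"
      using g \<mu> span_scale[OF \<mu>] unfolding additive_on_Q_def by blast
    then show ?case using Suc by (simp add: scale_left_distrib algebra_simps)
  qed (simp add: additive_zero[OF g])
  show ?thesis
  proof (cases "0 \<le> n")
    case True
    then show ?thesis using nat[of "nat n"] by simp
  next
    case False
    then have "g (- sc (int (nat (- n))) \<mu>) = n * g \<mu>"
      using nat[of "nat (- n)"] additive_minus[OF g span_scale[OF \<mu>]] by simp
    then show ?thesis using False by simp
  qed
qed

lemma additive_sum:
  assumes g: "additive_on_Q g" and \<mu>: "\<And>i. i \<in> I \<Longrightarrow> \<mu> i \<in> Q"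
  shows "g (\<Sum>i\<in>I. \<mu> i) = (\<Sum>i\<in>I. g (\<mu> i))"
  using \<mu>
proof (induction I rule: infinite_finite_induct)
  case (insert i I)
  have "g (\<mu> i + (\<Sum>i\<in>I. \<mu> i)) = g (\<mu> i) + g (\<Sum>i\<in>I. \<mu> i)"
    using g insert.prems span_sum[of I \<mu> R] unfolding additive_on_Q_def by blast
  then show ?case using insert by simp
qed (simp_all add: additive_zero[OF g])

lemma additive_diff_scale:
  assumes g: "additive_on_Q g" and "\<mu> \<in> Q" "\<nu> \<in> Q"
  shows "g (\<mu> - sc n \<nu>) = g \<mu> - n * g \<nu>"
proof -
  have "g (\<mu> + - sc n \<nu>) = g \<mu> + g (- sc n \<nu>)"
    using g assms span_neg[OF span_scale] unfolding additive_on_Q_def by blast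
  then show ?thesis
    using additive_minus[OF g span_scale[OF assms(3)]] additive_scale[OF g assms(3)] by simp
qed

lemma c_additive: "\<beta> \<in> R \<Longrightarrow> additive_on_Q (\<lambda>\<mu>. c \<mu> \<beta>)"
  unfolding additive_on_Q_def using c_add by blast

lemma base_coordinates:
  assumes "\<mu> \<in> Q"
  shows "\<exists>n. \<mu> = (\<Sum>\<alpha>\<in>\<Pi>. sc (n \<alpha>) \<alpha>)"
  using assms
proof (induction rule: span_induct)
  case base
  show ?case
  proof (rule subspaceI)
    show "0 \<in> {\<mu>. \<exists>n. \<mu> = (\<Sum>\<alpha>\<in>\<Pi>. sc (n \<alpha>) \<alpha>)}" by (auto intro!: exI[of _ "\<lambda>_. 0"])
  next
    fix x y assume "x \<in> {\<mu>. \<exists>n. \<mu> = (\<Sum>\<alpha>\<in>\<Pi>. sc (n \<alpha>) \<alpha>)}" "y \<in> {\<mu>. \<exists>n. \<mu> = (\<Sum>\<alpha>\<in>\<Pi>. sc (n \<alpha>) \<alpha>)}"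
    then obtain m n where "x = (\<Sum>\<alpha>\<in>\<Pi>. sc (m \<alpha>) \<alpha>)" "y = (\<Sum>\<alpha>\<in>\<Pi>. sc (n \<alpha>) \<alpha>)" by blast
    then have "x + y = (\<Sum>\<alpha>\<in>\<Pi>. sc (m \<alpha> + n \<alpha>) \<alpha>)" by (simp add: scale_left_distrib sum.distrib)
    then show "x + y \<in> {\<mu>. \<exists>n. \<mu> = (\<Sum>\<alpha>\<in>\<Pi>. sc (n \<alpha>) \<alpha>)}" by (intro CollectI exI[of _ "\<lambda>\<alpha>. m \<alpha> + n \<alpha>"])
  next
    fix k x assume "x \<in> {\<mu>. \<exists>n. \<mu> = (\<Sum>\<alpha>\<in>\<Pi>. sc (n \<alpha>) \<alpha>)}"
    then obtain n where "x = (\<Sum>\<alpha>\<in>\<Pi>. sc (n \<alpha>) \<alpha>)" by blast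
    then have "sc k x = (\<Sum>\<alpha>\<in>\<Pi>. sc (k * n \<alpha>) \<alpha>)" by (simp add: scale_sum_right)
    then show "sc k x \<in> {\<mu>. \<exists>n. \<mu> = (\<Sum>\<alpha>\<in>\<Pi>. sc (n \<alpha>) \<alpha>)}" by (intro CollectI exI[of _ "\<lambda>\<alpha>. k * n \<alpha>"])
  qed
next
  case (step \<beta>)
  from base_combination[OF this] obtain n :: "'v \<Rightarrow> nat" where
    "\<beta> = (\<Sum>\<alpha>\<in>\<Pi>. sc (int (n \<alpha>)) \<alpha>) \<or> \<beta> = - (\<Sum>\<alpha>\<in>\<Pi>. sc (int (n \<alpha>)) \<alpha>)" ..
  then show ?case
  proof
    assume "\<beta> = - (\<Sum>\<alpha>\<in>\<Pi>. sc (int (n \<alpha>)) \<alpha>)"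
    then have "\<beta> = (\<Sum>\<alpha>\<in>\<Pi>. sc (- int (n \<alpha>)) \<alpha>)" by (simp add: sum_negf)
    then show ?thesis by (rule exI[of _ "\<lambda>\<alpha>. - int (n \<alpha>)"])
  qed (rule exI)
qed

definition coord :: "'v \<Rightarrow> 'v \<Rightarrow> int"
  where "coord \<mu> = (SOME n. \<mu> = (\<Sum>\<alpha>\<in>\<Pi>. sc (n \<alpha>) \<alpha>))"

lemma coord_sum: "\<mu> \<in> Q \<Longrightarrow> (\<Sum>\<alpha>\<in>\<Pi>. sc (coord \<mu> \<alpha>) \<alpha>) = \<mu>"
  unfolding coord_def by (rule someI_ex[OF base_coordinates, symmetric])

lemma coord_unique:
  assumes "\<alpha> \<in> \<Pi>"
  shows "coord (\<Sum>\<alpha>\<in>\<Pi>. sc (n \<alpha>) \<alpha>) \<alpha> = n \<alpha>"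
proof -
  let ?\<mu> = "\<Sum>\<alpha>\<in>\<Pi>. sc (n \<alpha>) \<alpha>"
  have "?\<mu> \<in> Q" by (intro span_sum span_scale base_Q)
  then have "(\<Sum>\<alpha>\<in>\<Pi>. sc (coord ?\<mu> \<alpha> - n \<alpha>) \<alpha>) = 0"
    by (simp add: scale_left_diff_distrib sum_subtractf coord_sum)
  from base_independent[OF this assms] show ?thesis by simp
qed

lemma coord_additive:
  assumes "\<alpha> \<in> \<Pi>"
  shows "additive_on_Q (\<lambda>\<mu>. coord \<mu> \<alpha>)"
  unfolding additive_on_Q_def
proof (intro ballI)
  fix \<mu> \<nu> assume q: "\<mu> \<in> Q" "\<nu> \<in> Q"
  have "\<mu> + \<nu> = (\<Sum>\<alpha>\<in>\<Pi>. sc (coord \<mu> \<alpha> + coord \<nu> \<alpha>) \<alpha>)"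
    by (simp add: scale_left_distrib sum.distrib coord_sum q)
  then show "coord (\<mu> + \<nu>) \<alpha> = coord \<mu> \<alpha> + coord \<nu> \<alpha>" using coord_unique[OF assms] by metis
qed

lemma coord_base: "\<alpha> \<in> \<Pi> \<Longrightarrow> \<beta> \<in> \<Pi> \<Longrightarrow> coord \<beta> \<alpha> = (if \<alpha> = \<beta> then 1 else 0)"
proof -
  assume a: "\<alpha> \<in> \<Pi>" "\<beta> \<in> \<Pi>"
  have "\<beta> = (\<Sum>\<alpha>\<in>\<Pi>. if \<alpha> = \<beta> then \<beta> else 0)" using a finite_base by simp
  also have "\<dots> = (\<Sum>\<alpha>\<in>\<Pi>. sc (if \<alpha> = \<beta> then 1 else 0) \<alpha>)" by (rule sum.cong) auto
  finally have "coord \<beta> \<alpha> = coord (\<Sum>\<alpha>\<in>\<Pi>. sc (if \<alpha> = \<beta> then 1 else 0) \<alpha>) \<alpha>"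
    by (rule arg_cong[of _ _ "\<lambda>\<mu>. coord \<mu> \<alpha>"])
  then show ?thesis unfolding coord_unique[OF a(1)] .
qed

lemma additive_expand:
  assumes g: "additive_on_Q g" and "\<mu> \<in> Q"
  shows "g \<mu> = (\<Sum>\<alpha>\<in>\<Pi>. coord \<mu> \<alpha> * g \<alpha>)"
proof -
  have "g \<mu> = g (\<Sum>\<alpha>\<in>\<Pi>. sc (coord \<mu> \<alpha>) \<alpha>)" using coord_sum[OF assms(2)] by simp
  also have "\<dots> = (\<Sum>\<alpha>\<in>\<Pi>. g (sc (coord \<mu> \<alpha>) \<alpha>))" by (rule additive_sum[OF g]) (intro span_scale base_Q)
  finally show ?thesis by (simp add: additive_scale[OF g] base_Q)
qed

lemma additive_eq:
  assumes "additive_on_Q f" "additive_on_Q g" "\<And>\<alpha>. \<alpha> \<in> \<Pi> \<Longrightarrow> f \<alpha> = g \<alpha>" "\<mu> \<in> Q"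
  shows "f \<mu> = g \<mu>"
  unfolding additive_expand[OF assms(1,4)] additive_expand[OF assms(2,4)] using assms(3) by simp

section \<open>Positive roots and reflections\<close>

definition positive :: "'v \<Rightarrow> bool"
  where "positive \<beta> \<longleftrightarrow> \<beta> \<in> R \<and> (\<forall>\<alpha>\<in>\<Pi>. 0 \<le> coord \<beta> \<alpha>)"

definition refl :: "'v \<Rightarrow> 'v \<Rightarrow> 'v"
  where "refl \<beta> \<mu> = \<mu> - sc (c \<mu> \<beta>) \<beta>"

lemma refl_self: "\<beta> \<in> R \<Longrightarrow> refl \<beta> \<beta> = - \<beta>"
  using scale_left_distrib[of 1 1 \<beta>] by (simp add: refl_def c_self)

lemma uminus_R: "\<beta> \<in> R \<Longrightarrow> - \<beta> \<in> R"
  using refl_R[of \<beta> \<beta>] refl_self by (simp add: refl_def)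

lemma coord_minus: "\<beta> \<in> Q \<Longrightarrow> \<alpha> \<in> \<Pi> \<Longrightarrow> coord (- \<beta>) \<alpha> = - coord \<beta> \<alpha>"
  using additive_minus[OF coord_additive] by blast

lemma positive_or_negative:
  assumes "\<beta> \<in> R"
  shows "positive \<beta> \<or> positive (- \<beta>)"
proof -
  obtain n :: "'v \<Rightarrow> nat" where
    "\<beta> = (\<Sum>\<alpha>\<in>\<Pi>. sc (int (n \<alpha>)) \<alpha>) \<or> \<beta> = - (\<Sum>\<alpha>\<in>\<Pi>. sc (int (n \<alpha>)) \<alpha>)"
    using base_combination[OF assms] ..
  then have "\<beta> = (\<Sum>\<alpha>\<in>\<Pi>. sc (int (n \<alpha>)) \<alpha>) \<or> - \<beta> = (\<Sum>\<alpha>\<in>\<Pi>. sc (int (n \<alpha>)) \<alpha>)" by auto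
  moreover have "0 \<le> coord (\<Sum>\<alpha>\<in>\<Pi>. sc (int (n \<alpha>)) \<alpha>) \<alpha>" if "\<alpha> \<in> \<Pi>" for \<alpha>
    by (simp add: coord_unique[OF that])
  ultimately show ?thesis unfolding positive_def using assms uminus_R by metis
qed

lemma coord_nonzero:
  assumes "\<beta> \<in> R"
  shows "\<exists>\<alpha>\<in>\<Pi>. coord \<beta> \<alpha> \<noteq> 0"
proof (rule ccontr)
  assume "\<not> ?thesis"
  then have "\<beta> = 0" using coord_sum[OF R_Q[OF assms]] by simp
  then show False using assms zero_R by simp
qed

lemma not_positive_both: "positive \<beta> \<Longrightarrow> \<not> positive (- \<beta>)"
proof
  assume p: "positive \<beta>" "positive (- \<beta>)"
  then have b: "\<beta> \<in> R" by (simp add: positive_def)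
  then obtain \<alpha> where a: "\<alpha> \<in> \<Pi>" "coord \<beta> \<alpha> \<noteq> 0" using coord_nonzero by blast
  have "0 \<le> coord \<beta> \<alpha>" "0 \<le> - coord \<beta> \<alpha>"
    using p a(1) coord_minus[OF R_Q[OF b] a(1)] unfolding positive_def by auto
  then show False using a(2) by simp
qed

lemma base_positive: "\<alpha> \<in> \<Pi> \<Longrightarrow> positive \<alpha>"
  using base_R by (auto simp: positive_def coord_base)

lemma dominant_positive:
  assumes "additive_on_Q g" "\<And>\<alpha>. \<alpha> \<in> \<Pi> \<Longrightarrow> 0 \<le> g \<alpha>" "positive \<beta>"
  shows "0 \<le> g \<beta>"
proof -
  have "\<beta> \<in> Q" using assms(3) R_Q by (simp add: positive_def)
  then have "g \<beta> = (\<Sum>\<alpha>\<in>\<Pi>. coord \<beta> \<alpha> * g \<alpha>)" by (rule additive_expand[OF assms(1)])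
  also have "\<dots> \<ge> 0" using assms(2,3) by (intro sum_nonneg mult_nonneg_nonneg) (auto simp: positive_def)
  finally show ?thesis .
qed

lemma refl_Q: "\<beta> \<in> R \<Longrightarrow> \<mu> \<in> Q \<Longrightarrow> refl \<beta> \<mu> \<in> Q"
  unfolding refl_def by (rule span_diff[OF _ span_scale[OF R_Q]])

lemma refl_add: "\<beta> \<in> R \<Longrightarrow> \<mu> \<in> Q \<Longrightarrow> \<nu> \<in> Q \<Longrightarrow> refl \<beta> (\<mu> + \<nu>) = refl \<beta> \<mu> + refl \<beta> \<nu>"
  by (simp add: refl_def c_add scale_left_distrib algebra_simps)

lemma refl_refl:
  assumes "\<beta> \<in> R" "\<mu> \<in> Q"
  shows "refl \<beta> (refl \<beta> \<mu>) = \<mu>"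
proof -
  have "c (refl \<beta> \<mu>) \<beta> = - c \<mu> \<beta>"
    unfolding refl_def additive_diff_scale[OF c_additive[OF assms(1)] assms(2) R_Q[OF assms(1)]] c_self[OF assms(1)]
    by simp
  then show ?thesis unfolding refl_def[of \<beta> "refl \<beta> \<mu>"] by (simp add: refl_def)
qed

lemma refl_closed: "\<beta> \<in> R \<Longrightarrow> \<gamma> \<in> R \<Longrightarrow> refl \<beta> \<gamma> \<in> R"
  using refl_R by (simp add: refl_def)

lemma c_refl_refl: "\<mu> \<in> Q \<Longrightarrow> \<beta> \<in> R \<Longrightarrow> \<gamma> \<in> R \<Longrightarrow> c (refl \<beta> \<mu>) (refl \<beta> \<gamma>) = c \<mu> \<gamma>"
  using c_refl by (simp add: refl_def)

lemma refl_bij: "\<beta> \<in> R \<Longrightarrow> bij_betw (refl \<beta>) R R"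
  by (rule bij_betw_byWitness[where f' = "refl \<beta>"]) (auto simp: refl_refl R_Q refl_closed)

lemma coord_refl:
  assumes "\<alpha> \<in> \<Pi>" "\<alpha>' \<in> \<Pi>" "\<alpha>' \<noteq> \<alpha>" "\<mu> \<in> Q"
  shows "coord (refl \<alpha> \<mu>) \<alpha>' = coord \<mu> \<alpha>'"
  unfolding refl_def additive_diff_scale[OF coord_additive[OF assms(2)] assms(4) base_Q[OF assms(1)]]
  using assms by (simp add: coord_base)

text \<open>A base reflection changes only the coordinate at \<alpha>. Any other positive coordinate
  of \<beta> survives, and one positive coordinate already makes a root positive.\<close>

lemma positive_refl:
  assumes \<alpha>: "\<alpha> \<in> \<Pi>" and \<beta>: "positive \<beta>"
  shows "positive (refl \<alpha> \<beta>) \<or> (\<exists>m>0. \<beta> = sc m \<alpha>)"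
proof (cases "\<exists>\<alpha>'\<in>\<Pi>. \<alpha>' \<noteq> \<alpha> \<and> coord \<beta> \<alpha>' \<noteq> 0")
  case True
  then obtain \<alpha>' where a: "\<alpha>' \<in> \<Pi>" "\<alpha>' \<noteq> \<alpha>" "coord \<beta> \<alpha>' \<noteq> 0" by blast
  have bR: "\<beta> \<in> R" using \<beta> by (simp add: positive_def)
  have rR: "refl \<alpha> \<beta> \<in> R" using refl_closed bR \<alpha> base_R by blast
  have "0 < coord (refl \<alpha> \<beta>) \<alpha>'"
    using coord_refl[OF \<alpha> a(1,2) R_Q[OF bR]] a \<beta> unfolding positive_def by force
  then have "\<not> positive (- refl \<alpha> \<beta>)"
    using coord_minus[OF R_Q[OF rR] a(1)] a(1) unfolding positive_def by force
  then show ?thesis using positive_or_negative[OF rR] by blast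
next
  case False
  have bR: "\<beta> \<in> R" using \<beta> by (simp add: positive_def)
  have "\<beta> = (\<Sum>\<alpha>'\<in>\<Pi>. sc (coord \<beta> \<alpha>') \<alpha>')" using coord_sum[OF R_Q[OF bR]] by simp
  also have "\<dots> = (\<Sum>\<alpha>'\<in>\<Pi>. if \<alpha>' = \<alpha> then sc (coord \<beta> \<alpha>) \<alpha> else 0)"
    by (rule sum.cong) (use False in auto)
  also have "\<dots> = sc (coord \<beta> \<alpha>) \<alpha>" using \<alpha> finite_base by simp
  finally have e: "\<beta> = sc (coord \<beta> \<alpha>) \<alpha>" .
  have "coord \<beta> \<alpha> \<noteq> 0"
  proof
    assume "coord \<beta> \<alpha> = 0"
    then have "\<beta> = 0" using e by simp
    then show False using bR zero_R by simp
  qed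
  then have "0 < coord \<beta> \<alpha>" using \<beta> \<alpha> unfolding positive_def by force
  then show ?thesis using e by blast
qed

text \<open>Summing over all roots makes the form invariant, since reflections permute
  \<open>R\<close> compatibly with \<open>c\<close>. On a root \<beta> it is positive because of the
  term c \<beta> \<beta> = 2.\<close>

definition form :: "'v \<Rightarrow> 'v \<Rightarrow> int"
  where "form \<mu> \<nu> = (\<Sum>\<gamma>\<in>R. c \<mu> \<gamma> * c \<nu> \<gamma>)"

lemma form_additive: "additive_on_Q (\<lambda>\<mu>. form \<mu> \<nu>)"
  unfolding additive_on_Q_def form_def by (simp add: c_add sum.distrib algebra_simps)

lemma form_sym: "form \<mu> \<nu> = form \<nu> \<mu>"
  by (simp add: form_def mult.commute)

lemma form_refl:
  assumes "\<beta> \<in> R" "\<mu> \<in> Q" "\<nu> \<in> Q"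
  shows "form (refl \<beta> \<mu>) (refl \<beta> \<nu>) = form \<mu> \<nu>"
proof -
  have "form (refl \<beta> \<mu>) (refl \<beta> \<nu>) = (\<Sum>\<gamma>\<in>R. c (refl \<beta> \<mu>) (refl \<beta> \<gamma>) * c (refl \<beta> \<nu>) (refl \<beta> \<gamma>))"
    unfolding form_def by (rule sum.reindex_bij_betw[OF refl_bij[OF assms(1)], symmetric])
  then show ?thesis using assms by (simp add: c_refl_refl form_def)
qed

text \<open>Invariance under the reflection in \<beta>, which negates \<beta>, replaces \<mu> by its
  reflection at the cost of a sign. Avoiding division keeps everything integral.\<close>

lemma form_c:
  assumes "\<beta> \<in> R" "\<mu> \<in> Q"
  shows "2 * form \<mu> \<beta> = c \<mu> \<beta> * form \<beta> \<beta>"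
proof -
  have "form \<mu> \<beta> = form (refl \<beta> \<mu>) (- \<beta>)"
    using form_refl[OF assms(1,2) R_Q[OF assms(1)]] refl_self[OF assms(1)] by simp
  also have "\<dots> = - form (refl \<beta> \<mu>) \<beta>"
    unfolding form_sym[of "refl \<beta> \<mu>"] by (rule additive_minus[OF form_additive R_Q[OF assms(1)]])
  also have "\<dots> = - form \<mu> \<beta> + c \<mu> \<beta> * form \<beta> \<beta>"
    unfolding refl_def additive_diff_scale[OF form_additive assms(2) R_Q[OF assms(1)]] by simp
  finally show ?thesis by simp
qed

lemma form_positive:
  assumes "\<beta> \<in> R"
  shows "0 < form \<beta> \<beta>"
proof -
  have "c \<beta> \<beta> * c \<beta> \<beta> \<le> form \<beta> \<beta>"
    unfolding form_def by (rule member_le_sum[OF assms]) (simp_all add: finite_R)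
  then show ?thesis by (simp add: c_self[OF assms])
qed

text \<open>By \<open>form_c\<close> the form determines the pairings, and for \<beta> = m \<alpha>
  it gives c \<mu> \<beta> * m = c \<mu> \<alpha>.\<close>

lemma refl_multiple:
  assumes "\<alpha> \<in> R" "\<beta> \<in> R" "\<beta> = sc m \<alpha>" "\<mu> \<in> Q"
  shows "refl \<beta> \<mu> = refl \<alpha> \<mu>"
proof -
  have fm: "form \<nu> \<beta> = m * form \<nu> \<alpha>" for \<nu>
    unfolding form_sym[of \<nu>] assms(3) by (rule additive_scale[OF form_additive R_Q[OF assms(1)]])
  have "m \<noteq> 0" using assms zero_R by auto
  have bb: "form \<beta> \<beta> = m * m * form \<alpha> \<alpha>" using fm[of \<beta>] fm[of \<alpha>] form_sym[of \<alpha> \<beta>] by simp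
  have "c \<mu> \<beta> * (m * m * form \<alpha> \<alpha>) = 2 * form \<mu> \<beta>"
    using form_c[OF assms(2,4)] unfolding bb by (rule sym)
  also have "\<dots> = m * (c \<mu> \<alpha> * form \<alpha> \<alpha>)"
    unfolding fm using form_c[OF assms(1,4)] by simp
  finally have "c \<mu> \<beta> * (m * m * form \<alpha> \<alpha>) = m * (c \<mu> \<alpha> * form \<alpha> \<alpha>)" .
  then have "(c \<mu> \<beta> * m) * (m * form \<alpha> \<alpha>) = c \<mu> \<alpha> * (m * form \<alpha> \<alpha>)" by (simp add: algebra_simps)
  moreover have "m * form \<alpha> \<alpha> \<noteq> 0" using \<open>m \<noteq> 0\<close> form_positive[OF assms(1)] by simp
  ultimately have "c \<mu> \<beta> * m = c \<mu> \<alpha>" by simp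
  then show ?thesis by (simp add: refl_def assms(3))
qed

section \<open>Words in reflections, dominance and exchange\<close>

definition act :: "'v list \<Rightarrow> 'v \<Rightarrow> 'v"
  where "act ws = foldr refl ws"

lemma act_simps [simp]: "act [] \<mu> = \<mu>" "act (\<alpha> # ws) \<mu> = refl \<alpha> (act ws \<mu>)"
  "act (vs @ ws) \<mu> = act vs (act ws \<mu>)"
  by (simp_all add: act_def)

lemma act_Q: "set ws \<subseteq> R \<Longrightarrow> \<mu> \<in> Q \<Longrightarrow> act ws \<mu> \<in> Q"
  by (induction ws) (auto simp: refl_Q)

lemma act_R: "set ws \<subseteq> R \<Longrightarrow> \<mu> \<in> R \<Longrightarrow> act ws \<mu> \<in> R"
  by (induction ws) (auto simp: refl_closed)

lemma act_add: "set ws \<subseteq> R \<Longrightarrow> \<mu> \<in> Q \<Longrightarrow> \<nu> \<in> Q \<Longrightarrow> act ws (\<mu> + \<nu>) = act ws \<mu> + act ws \<nu>"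
  by (induction ws) (auto simp: refl_add act_Q)

lemma act_c: "set ws \<subseteq> R \<Longrightarrow> \<mu> \<in> Q \<Longrightarrow> \<beta> \<in> R \<Longrightarrow> c (act ws \<mu>) (act ws \<beta>) = c \<mu> \<beta>"
  by (induction ws) (auto simp: c_refl_refl act_Q act_R)

lemma additive_act:
  assumes "additive_on_Q g" "set ws \<subseteq> R"
  shows "additive_on_Q (\<lambda>\<mu>. g (act ws \<mu>))"
  using assms by (simp add: additive_on_Q_def act_add act_Q)

lemma refl_minus: "\<beta> \<in> R \<Longrightarrow> \<mu> \<in> Q \<Longrightarrow> refl \<beta> (- \<mu>) = - refl \<beta> \<mu>"
  using additive_minus[OF c_additive] by (simp add: refl_def)

lemma act_minus: "set ws \<subseteq> R \<Longrightarrow> \<mu> \<in> Q \<Longrightarrow> act ws (- \<mu>) = - act ws \<mu>"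
  by (induction ws) (auto simp: refl_minus act_Q)

lemma refl_scale: "\<beta> \<in> R \<Longrightarrow> \<mu> \<in> Q \<Longrightarrow> refl \<beta> (sc n \<mu>) = sc n (refl \<beta> \<mu>)"
  using additive_scale[OF c_additive] by (simp add: refl_def scale_right_diff_distrib)

lemma act_scale: "set ws \<subseteq> R \<Longrightarrow> \<mu> \<in> Q \<Longrightarrow> act ws (sc n \<mu>) = sc n (act ws \<mu>)"
  by (induction ws) (auto simp: refl_scale act_Q)

lemma act_refl:
  assumes "set ws \<subseteq> R" "\<beta> \<in> R" "\<mu> \<in> Q"
  shows "act ws (refl \<beta> \<mu>) = refl (act ws \<beta>) (act ws \<mu>)"
proof -
  note b = span_scale[OF R_Q[OF assms(2)]]
  have "act ws (\<mu> + - sc (c \<mu> \<beta>) \<beta>) = act ws \<mu> + - sc (c \<mu> \<beta>) (act ws \<beta>)"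
    unfolding act_add[OF assms(1,3) span_neg[OF b]] act_minus[OF assms(1) b]
      act_scale[OF assms(1) R_Q[OF assms(2)]] ..
  then show ?thesis using act_c[OF assms(1,3,2)] by (simp add: refl_def)
qed

text \<open>For positive \<beta>, positivity of the form at \<beta> yields a base element \<alpha>
  with positive coordinate and positive pairing. If its reflection of \<beta> is positive, it has
  smaller height, and conjugating by \<alpha> reduces to it; otherwise \<beta> is a multiple of
  \<alpha> and has the same reflection.\<close>

lemma refl_word:
  assumes "\<beta> \<in> R"
  shows "\<exists>ws. set ws \<subseteq> \<Pi> \<and> (\<forall>\<mu>\<in>Q. refl \<beta> \<mu> = act ws \<mu>)"
proof -
  have pos: "\<exists>ws. set ws \<subseteq> \<Pi> \<and> (\<forall>\<mu>\<in>Q. refl \<beta> \<mu> = act ws \<mu>)" if "positive \<beta>" for \<beta>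
    using that
  proof (induction "nat (\<Sum>\<alpha>\<in>\<Pi>. coord \<beta> \<alpha>)" arbitrary: \<beta> rule: less_induct)
    case less
    have bR: "\<beta> \<in> R" and co: "\<And>\<alpha>. \<alpha> \<in> \<Pi> \<Longrightarrow> 0 \<le> coord \<beta> \<alpha>"
      using less.prems by (auto simp: positive_def)
    have "form \<beta> \<beta> = (\<Sum>\<alpha>\<in>\<Pi>. coord \<beta> \<alpha> * form \<alpha> \<beta>)"
      by (rule additive_expand[OF form_additive R_Q[OF bR]])
    then have "\<not> (\<forall>\<alpha>\<in>\<Pi>. coord \<beta> \<alpha> * form \<alpha> \<beta> \<le> 0)"
      using form_positive[OF bR] sum_nonpos[of \<Pi> "\<lambda>\<alpha>. coord \<beta> \<alpha> * form \<alpha> \<beta>"] by auto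
    then obtain \<alpha> where a: "\<alpha> \<in> \<Pi>" "0 < coord \<beta> \<alpha> * form \<alpha> \<beta>" by auto
    have aR: "\<alpha> \<in> R" using a(1) base_R by blast
    have "0 < form \<beta> \<alpha>" using a co[OF a(1)] form_sym by (simp add: zero_less_mult_iff)
    then have "0 < c \<beta> \<alpha> * form \<alpha> \<alpha>" using form_c[OF aR R_Q[OF bR]] by simp
    then have cpos: "0 < c \<beta> \<alpha>" using form_positive[OF aR] by (simp add: zero_less_mult_iff)
    show ?case
    proof (cases "positive (refl \<alpha> \<beta>)")
      case True
      let ?\<gamma> = "refl \<alpha> \<beta>"
      have gR: "?\<gamma> \<in> R" using True by (simp add: positive_def)
      have "(\<Sum>\<alpha>'\<in>\<Pi>. coord ?\<gamma> \<alpha>') < (\<Sum>\<alpha>'\<in>\<Pi>. coord \<beta> \<alpha>')"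
      proof (rule sum_strict_mono_ex1[OF finite_base])
        have e: "coord ?\<gamma> \<alpha>' = coord \<beta> \<alpha>' - c \<beta> \<alpha> * coord \<alpha> \<alpha>'" if "\<alpha>' \<in> \<Pi>" for \<alpha>'
          unfolding refl_def by (rule additive_diff_scale[OF coord_additive[OF that] R_Q[OF bR] R_Q[OF aR]])
        then show "\<forall>\<alpha>'\<in>\<Pi>. coord ?\<gamma> \<alpha>' \<le> coord \<beta> \<alpha>'" using cpos a(1) by (simp add: coord_base)
        show "\<exists>\<alpha>'\<in>\<Pi>. coord ?\<gamma> \<alpha>' < coord \<beta> \<alpha>'"
          using e[OF a(1)] cpos a(1) by (intro bexI[of _ \<alpha>]) (simp_all add: coord_base)
      qed
      moreover have "0 \<le> (\<Sum>\<alpha>'\<in>\<Pi>. coord ?\<gamma> \<alpha>')" using True by (intro sum_nonneg) (simp add: positive_def)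
      ultimately have "nat (\<Sum>\<alpha>'\<in>\<Pi>. coord ?\<gamma> \<alpha>') < nat (\<Sum>\<alpha>'\<in>\<Pi>. coord \<beta> \<alpha>')" by linarith
      from less.hyps[OF this True] obtain ws where
        ws: "set ws \<subseteq> \<Pi>" "\<And>\<mu>. \<mu> \<in> Q \<Longrightarrow> refl ?\<gamma> \<mu> = act ws \<mu>" by blast
      have "refl \<beta> \<mu> = act (\<alpha> # ws @ [\<alpha>]) \<mu>" if mu: "\<mu> \<in> Q" for \<mu>
      proof -
        have "act (\<alpha> # ws @ [\<alpha>]) \<mu> = refl \<alpha> (refl ?\<gamma> (refl \<alpha> \<mu>))"
          using ws(2)[OF refl_Q[OF aR mu]] by simp
        also have "\<dots> = refl (refl \<alpha> ?\<gamma>) (refl \<alpha> (refl \<alpha> \<mu>))"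
          using act_refl[of "[\<alpha>]" ?\<gamma> "refl \<alpha> \<mu>"] aR gR refl_Q[OF aR mu] by simp
        finally show ?thesis using refl_refl aR bR mu R_Q by simp
      qed
      then show ?thesis using ws(1) a(1) by (intro exI[of _ "\<alpha> # ws @ [\<alpha>]"]) auto
    next
      case False
      then obtain m where "\<beta> = sc m \<alpha>" using positive_refl[OF a(1) less.prems] by blast
      then have "\<forall>\<mu>\<in>Q. refl \<beta> \<mu> = act [\<alpha>] \<mu>" using refl_multiple[OF aR bR] by simp
      then show ?thesis using a(1) by (intro exI[of _ "[\<alpha>]"]) simp
    qed
  qed
  have "refl \<beta> \<mu> = refl (- \<beta>) \<mu>" if "\<mu> \<in> Q" for \<mu>
    by (rule refl_multiple[of "- \<beta>" \<beta> "- 1"]) (use assms uminus_R that in auto)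
  then show ?thesis using positive_or_negative[OF assms] pos by metis
qed

text \<open>
  Each reflection in a base element on which \<open>g\<close> is negative lowers the number of positive
  roots on which \<open>g\<close> is negative.
\<close>

lemma dominant_exists:
  "additive_on_Q g \<Longrightarrow> \<exists>ws. set ws \<subseteq> \<Pi> \<and> (\<forall>\<alpha>\<in>\<Pi>. 0 \<le> g (act ws \<alpha>))"
proof (induction "card {\<beta>. positive \<beta> \<and> g \<beta> < 0}" arbitrary: g rule: less_induct)
  case less
  show ?case
  proof (cases "\<forall>\<alpha>\<in>\<Pi>. 0 \<le> g \<alpha>")
    case True
    then show ?thesis by (intro exI[of _ "[]"]) simp
  next
    case False
    then obtain \<alpha> where a: "\<alpha> \<in> \<Pi>" "g \<alpha> < 0" by auto
    have aR: "\<alpha> \<in> R" using a(1) base_R by blast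
    let ?g = "\<lambda>\<mu>. g (refl \<alpha> \<mu>)"
    have ga: "additive_on_Q ?g" using additive_act[OF less.prems, of "[\<alpha>]"] aR by simp
    let ?A = "{\<beta>. positive \<beta> \<and> g \<beta> < 0}" and ?B = "{\<beta>. positive \<beta> \<and> g (refl \<alpha> \<beta>) < 0}"
    have finA: "finite ?A" by (rule finite_subset[OF _ finite_R]) (auto simp: positive_def)
    \<comment> \<open>The inclusion misses \<alpha>, which makes the count drop strictly. Positive
      multiples of \<alpha>, the only positive roots that may turn negative, are not in
      \<open>?B\<close>, since g is negative on \<alpha>.\<close>
    have "refl \<alpha> ` ?B \<subseteq> ?A - {\<alpha>}"
    proof
      fix \<gamma> assume "\<gamma> \<in> refl \<alpha> ` ?B"
      then obtain \<beta> where b: "positive \<beta>" "g (refl \<alpha> \<beta>) < 0" "\<gamma> = refl \<alpha> \<beta>" by blast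
      have bR: "\<beta> \<in> R" using b(1) by (simp add: positive_def)
      have nm: "\<not> (\<exists>m>0. \<beta> = sc m \<alpha>)"
      proof
        assume "\<exists>m>0. \<beta> = sc m \<alpha>"
        then obtain m where m: "m > 0" "\<beta> = sc m \<alpha>" by blast
        have "refl \<alpha> \<beta> = sc (- m) \<alpha>" unfolding m(2) refl_scale[OF aR R_Q[OF aR]] refl_self[OF aR] by simp
        then have "g (refl \<alpha> \<beta>) = - m * g \<alpha>" by (simp only: additive_scale[OF less.prems R_Q[OF aR]])
        then show False using b(2) mult_pos_neg[OF m(1) a(2)] by simp
      qed
      then have p: "positive \<gamma>" using positive_refl[OF a(1) b(1)] b(3) by blast
      have "\<gamma> \<noteq> \<alpha>"
      proof
        assume "\<gamma> = \<alpha>"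
        then have "\<beta> = - \<alpha>" using b(3) refl_refl[OF aR R_Q[OF bR]] refl_self[OF aR] by simp
        then show False using b(1) not_positive_both[OF base_positive[OF a(1)]] by simp
      qed
      then show "\<gamma> \<in> ?A - {\<alpha>}" using p b by simp
    qed
    moreover have "inj_on (refl \<alpha>) ?B"
      by (rule inj_on_inverseI[of _ "refl \<alpha>"]) (auto simp: positive_def refl_refl aR R_Q)
    ultimately have "card ?B \<le> card (?A - {\<alpha>})" using finA by (intro card_inj_on_le[of "refl \<alpha>"]) auto
    also have "\<dots> < card ?A" using finA a base_positive by (intro card_Diff1_less) auto
    finally obtain ws where ws: "set ws \<subseteq> \<Pi>" "\<forall>\<alpha>'\<in>\<Pi>. 0 \<le> g (refl \<alpha> (act ws \<alpha>'))"
      using less.hyps[of ?g] ga by blast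
    then show ?thesis using a(1) by (intro exI[of _ "\<alpha> # ws"]) auto
  qed
qed

text \<open>Some letter \<gamma> of the word turns a positive image \<delta> of \<alpha> negative.
  Then \<delta> is a multiple of \<gamma>, so moving the reflection in \<alpha> leftwards turns it
  into the one in \<gamma>, and the two cancel.\<close>

lemma exchange:
  assumes "\<alpha> \<in> \<Pi>"
  shows "set vs \<subseteq> \<Pi> \<Longrightarrow> positive (- act vs \<alpha>) \<Longrightarrow>
    \<exists>us. set us \<subseteq> \<Pi> \<and> length us < length vs \<and> (\<forall>\<mu>\<in>Q. act (vs @ [\<alpha>]) \<mu> = act us \<mu>)"
proof (induction vs)
  case Nil
  then show ?case using not_positive_both[OF base_positive[OF assms]] by simp
next
  case (Cons \<gamma> vs)
  have aR: "\<alpha> \<in> R" and gR: "\<gamma> \<in> R" and vR: "set vs \<subseteq> R" and vp: "set vs \<subseteq> \<Pi>"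
    using assms Cons.prems(1) base_R by auto
  let ?\<delta> = "act vs \<alpha>"
  have dR: "?\<delta> \<in> R" by (rule act_R[OF vR aR])
  show ?case
  proof (cases "positive ?\<delta>")
    case False
    then have "positive (- ?\<delta>)" using positive_or_negative[OF dR] by blast
    from Cons.IH[OF vp this] obtain us where
      "set us \<subseteq> \<Pi>" "length us < length vs" "\<forall>\<mu>\<in>Q. act (vs @ [\<alpha>]) \<mu> = act us \<mu>" by blast
    then show ?thesis using Cons.prems(1) by (intro exI[of _ "\<gamma> # us"]) auto
  next
    case True
    have "\<not> positive (refl \<gamma> ?\<delta>)" using Cons.prems(2) not_positive_both[of "refl \<gamma> ?\<delta>"] by auto
    then obtain m where m: "?\<delta> = sc m \<gamma>" using positive_refl[OF _ True] Cons.prems(1) by auto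
    have "act ((\<gamma> # vs) @ [\<alpha>]) \<mu> = act vs \<mu>" if mu: "\<mu> \<in> Q" for \<mu>
    proof -
      have "act ((\<gamma> # vs) @ [\<alpha>]) \<mu> = refl \<gamma> (refl ?\<delta> (act vs \<mu>))"
        using act_refl[OF vR aR mu] by simp
      also have "refl ?\<delta> (act vs \<mu>) = refl \<gamma> (act vs \<mu>)"
        by (rule refl_multiple[OF gR dR m act_Q[OF vR mu]])
      finally show ?thesis using refl_refl[OF gR act_Q[OF vR mu]] by simp
    qed
    then show ?thesis using vp by (intro exI[of _ vs]) auto
  qed
qed

lemma dominant_unique:
  assumes g: "additive_on_Q g" and dom: "\<And>\<alpha>. \<alpha> \<in> \<Pi> \<Longrightarrow> 0 \<le> g \<alpha>"
  shows "set ws \<subseteq> \<Pi> \<Longrightarrow> (\<And>\<alpha>. \<alpha> \<in> \<Pi> \<Longrightarrow> 0 \<le> g (act ws \<alpha>)) \<Longrightarrow> \<mu> \<in> Q \<Longrightarrow> g (act ws \<mu>) = g \<mu>"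
proof (induction "length ws" arbitrary: ws \<mu> rule: less_induct)
  case less
  show ?case
  proof (cases ws rule: rev_cases)
    case Nil
    then show ?thesis by simp
  next
    case (snoc vs \<alpha>)
    have a: "\<alpha> \<in> \<Pi>" and vp: "set vs \<subseteq> \<Pi>" and aR: "\<alpha> \<in> R" and vR: "set vs \<subseteq> R"
      using less.prems(1) base_R snoc by auto
    let ?\<beta> = "act vs \<alpha>"
    have bR: "?\<beta> \<in> R" by (rule act_R[OF vR aR])
    have wa: "act ws \<alpha> = - ?\<beta>"
      using act_minus[OF vR R_Q[OF aR]] refl_self[OF aR] by (simp add: snoc)
    show ?thesis
    proof (cases "positive ?\<beta>")
      case True
      have "0 \<le> g ?\<beta>" by (rule dominant_positive[OF g dom True])
      moreover have "0 \<le> - g ?\<beta>"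
        using less.prems(2)[OF a] additive_minus[OF g R_Q[OF bR]] unfolding wa by simp
      ultimately have b0: "g ?\<beta> = 0" by simp
      have e: "g (act ws \<nu>) = g (act vs \<nu>)" if nu: "\<nu> \<in> Q" for \<nu>
      proof -
        have "act ws \<nu> = act vs \<nu> - sc (c (act vs \<nu>) ?\<beta>) ?\<beta>"
          using act_refl[OF vR aR nu] by (simp add: snoc refl_def)
        then show ?thesis
          using additive_diff_scale[OF g act_Q[OF vR nu] R_Q[OF bR]] b0 by simp
      qed
      have "g (act vs \<mu>) = g \<mu>"
        by (rule less.hyps) (use snoc vp less.prems(2,3) e base_Q in auto)
      then show ?thesis using e[OF less.prems(3)] by simp
    next
      case False
      then have "positive (- ?\<beta>)" using positive_or_negative[OF bR] by blast
      from exchange[OF a vp this] obtain us where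
        us: "set us \<subseteq> \<Pi>" "length us < length vs" "\<And>\<mu>. \<mu> \<in> Q \<Longrightarrow> act ws \<mu> = act us \<mu>"
        unfolding snoc by blast
      have "g (act us \<mu>) = g \<mu>"
      proof (rule less.hyps)
        show "length us < length ws" using us(2) snoc by simp
        show "0 \<le> g (act us \<alpha>)" if "\<alpha> \<in> \<Pi>" for \<alpha> using less.prems(2)[OF that] us(3)[OF base_Q[OF that]] by simp
      qed (use us(1) less.prems(3) in auto)
      then show ?thesis using us(3)[OF less.prems(3)] by simp
    qed
  qed
qed

end

section \<open>The root system of a simple Lie algebra\<close>

lemma module_of_int_fun: "module (\<lambda>(n::int) (\<mu> :: 'a \<Rightarrow> 'b::ring_1) x. of_int n * \<mu> x)"
  by (unfold_locales) (auto simp: fun_eq_iff algebra_simps)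

lemma vector_space_fun: "vector_space (\<lambda>c (\<mu> :: 'a \<Rightarrow> 'b::field) x. c * \<mu> x)"
  by (unfold_locales) (auto simp: fun_eq_iff algebra_simps)

lemma sum_apply: "(\<Sum>i\<in>I. f i) x = (\<Sum>i\<in>I. f i x)"
  by (induction I rule: infinite_finite_induct) auto

locale based_lie_algebra = simple_cartan_lie_algebra s br Basis H
  for s :: "'k::{alg_closed_field,field_char_0} \<Rightarrow> 'g::ab_group_add \<Rightarrow> 'g" (infixr "*s" 75)
    and br Basis H +
  fixes \<Pi>
  assumes base: "root_base s br H \<Pi>"
begin

definition isc :: "int \<Rightarrow> ('g \<Rightarrow> 'k) \<Rightarrow> 'g \<Rightarrow> 'k"
  where "isc = (\<lambda>n \<mu> h. of_int n * \<mu> h)"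

text \<open>On the root lattice the values at coroots are integers of \<open>'k\<close>, and
  characteristic 0 leaves only one choice.\<close>

definition cint :: "('g \<Rightarrow> 'k) \<Rightarrow> ('g \<Rightarrow> 'k) \<Rightarrow> int"
  where "cint \<mu> \<beta> = (SOME j. \<mu> (cor \<beta>) = of_int j)"

lemma module_isc: "module isc"
  unfolding isc_def by (rule module_of_int_fun)

lemma lattice_isc: "root_lattice s br H = module.span isc R"
  unfolding root_lattice_def isc_def ..

lemma lattice_integer:
  assumes "\<mu> \<in> root_lattice s br H" and b: "\<beta> \<in> R"
  shows "\<mu> (cor \<beta>) = of_int (cint \<mu> \<beta>)"
proof -
  interpret m: module isc by (rule module_isc)
  have "\<exists>j::int. \<mu> (cor \<beta>) = of_int j"
    using assms(1) unfolding lattice_isc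
  proof (induction rule: m.span_induct)
    case base
    show ?case
    proof (rule m.subspaceI)
      fix x y :: "'g \<Rightarrow> 'k"
      assume "x \<in> {\<mu>. \<exists>j::int. \<mu> (cor \<beta>) = of_int j}" "y \<in> {\<mu>. \<exists>j::int. \<mu> (cor \<beta>) = of_int j}"
      then obtain i j :: int where "x (cor \<beta>) = of_int i" "y (cor \<beta>) = of_int j" by blast
      then show "x + y \<in> {\<mu>. \<exists>j::int. \<mu> (cor \<beta>) = of_int j}" by (auto intro!: exI[of _ "i + j"])
    next
      fix n and x :: "'g \<Rightarrow> 'k"
      assume "x \<in> {\<mu>. \<exists>j::int. \<mu> (cor \<beta>) = of_int j}"
      then obtain j :: int where "x (cor \<beta>) = of_int j" by blast
      then show "isc n x \<in> {\<mu>. \<exists>j::int. \<mu> (cor \<beta>) = of_int j}" by (auto simp: isc_def intro!: exI[of _ "n * j"])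
    qed (auto intro!: exI[of _ 0])
  next
    case (step a)
    then show ?case using weight_cor_integer[OF b root_weight] by blast
  qed
  then show ?thesis unfolding cint_def by (rule someI_ex)
qed

lemma lattice_dual:
  assumes "\<mu> \<in> root_lattice s br H"
  shows "h \<in> H \<Longrightarrow> k \<in> H \<Longrightarrow> \<mu> (h - c *s k) = \<mu> h - c * \<mu> k" and "x \<notin> H \<Longrightarrow> \<mu> x = 0"
proof -
  interpret m: module isc by (rule module_isc)
  have "(\<forall>h\<in>H. \<forall>k\<in>H. \<forall>c. \<mu> (h - c *s k) = \<mu> h - c * \<mu> k) \<and> (\<forall>x. x \<notin> H \<longrightarrow> \<mu> x = 0)"
    using assms unfolding lattice_isc
  proof (induction rule: m.span_induct)
    case base
    show ?case
    proof (rule m.subspaceI)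
      fix n and x :: "'g \<Rightarrow> 'k"
      assume x: "x \<in> {\<mu>. (\<forall>h\<in>H. \<forall>k\<in>H. \<forall>c. \<mu> (h - c *s k) = \<mu> h - c * \<mu> k) \<and> (\<forall>x. x \<notin> H \<longrightarrow> \<mu> x = 0)}"
      have "of_int n * (x h - c * x k) = of_int n * x h - c * (of_int n * x k)" for h k c
        by (simp add: algebra_simps)
      with x show "isc n x \<in> {\<mu>. (\<forall>h\<in>H. \<forall>k\<in>H. \<forall>c. \<mu> (h - c *s k) = \<mu> h - c * \<mu> k) \<and> (\<forall>x. x \<notin> H \<longrightarrow> \<mu> x = 0)}"
        by (simp add: isc_def)
    qed (auto simp: algebra_simps)
  next
    case (step a)
    then show ?case using weight_diff_scale[OF root_weight] weights_outside[OF root_weight] by blast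
  qed
  then show "h \<in> H \<Longrightarrow> k \<in> H \<Longrightarrow> \<mu> (h - c *s k) = \<mu> h - c * \<mu> k" and "x \<notin> H \<Longrightarrow> \<mu> x = 0"
    by blast+
qed

lemma cint_refl_eq:
  assumes "\<mu> \<in> root_lattice s br H" "\<beta> \<in> R"
  shows "\<mu> - isc (cint \<mu> \<beta>) \<beta> = refl \<beta> \<mu>"
  using lattice_integer[OF assms] by (auto simp: root_refl_def isc_def)

lemma cint_eqI: "\<mu> \<in> root_lattice s br H \<Longrightarrow> \<beta> \<in> R \<Longrightarrow> \<mu> (cor \<beta>) = of_int j \<Longrightarrow> cint \<mu> \<beta> = j"
  using lattice_integer by (metis of_int_eq_iff)

lemma root_in_lattice: "\<beta> \<in> R \<Longrightarrow> \<beta> \<in> root_lattice s br H"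
  unfolding lattice_isc by (rule module.span_base[OF module_isc])

text \<open>Invariance of the pairing rests on \<open>cor_refl\<close>, and its integrality on
  \<open>weight_cor_integer\<close>; both come from the reflection automorphisms.\<close>

sublocale rs: integral_root_system isc R \<Pi> cint
proof -
  interpret m: module isc by (rule module_isc)
  interpret v: vector_space "\<lambda>c (\<mu> :: 'g \<Rightarrow> 'k) h. c * \<mu> h" by (rule vector_space_fun)
  note b = base[unfolded root_base_def]
  have lat: "m.span R = root_lattice s br H" by (simp add: lattice_isc)
  show "integral_root_system isc R \<Pi> cint"
  proof (unfold_locales, unfold lat)
    show "finite R" unfolding roots_eq using weights_finite by simp
    show "\<Pi> \<subseteq> R" "0 \<notin> R" using b root_nonzero by blast+
  next
    fix n :: "('g \<Rightarrow> 'k) \<Rightarrow> int" and \<alpha>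
    assume z: "(\<Sum>\<alpha>\<in>\<Pi>. isc (n \<alpha>) \<alpha>) = 0" and a: "\<alpha> \<in> \<Pi>"
    have "\<not> v.dependent \<Pi>" "finite \<Pi>" using b by blast+
    moreover have "(\<Sum>\<alpha>\<in>\<Pi>. (\<lambda>h. of_int (n \<alpha>) * \<alpha> h)) = (0 :: 'g \<Rightarrow> 'k)" using z by (simp add: isc_def)
    ultimately have "(of_int (n \<alpha>) :: 'k) = 0" using v.independentD[of \<Pi> \<Pi> "\<lambda>\<alpha>. of_int (n \<alpha>)" \<alpha>] a by blast
    then show "n \<alpha> = 0" by simp
  next
    fix \<beta> assume "\<beta> \<in> R"
    then obtain n :: "('g \<Rightarrow> 'k) \<Rightarrow> nat" where n: "\<beta> = (\<lambda>h. \<Sum>\<alpha>\<in>\<Pi>. of_nat (n \<alpha>) * \<alpha> h) \<or>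
      \<beta> = (\<lambda>h. - (\<Sum>\<alpha>\<in>\<Pi>. of_nat (n \<alpha>) * \<alpha> h))" using b by blast
    have "(\<Sum>\<alpha>\<in>\<Pi>. isc (int (n \<alpha>)) \<alpha>) = (\<lambda>h. \<Sum>\<alpha>\<in>\<Pi>. of_nat (n \<alpha>) * \<alpha> h)"
      by (rule ext) (simp add: sum_apply isc_def)
    then show "\<exists>n :: ('g \<Rightarrow> 'k) \<Rightarrow> nat. \<beta> = (\<Sum>\<alpha>\<in>\<Pi>. isc (int (n \<alpha>)) \<alpha>) \<or> \<beta> = - (\<Sum>\<alpha>\<in>\<Pi>. isc (int (n \<alpha>)) \<alpha>)"
      using n by (intro exI[of _ n]) (auto simp: fun_eq_iff)
  next
    fix \<mu> \<nu> \<beta> assume m: "\<mu> \<in> root_lattice s br H" "\<nu> \<in> root_lattice s br H" "\<beta> \<in> R"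
    have "\<mu> + \<nu> \<in> root_lattice s br H" using m(1,2) unfolding lattice_isc by (rule m.span_add)
    then show "cint (\<mu> + \<nu>) \<beta> = cint \<mu> \<beta> + cint \<nu> \<beta>"
      by (rule cint_eqI) (simp_all add: m lattice_integer)
  next
    fix \<beta> assume "\<beta> \<in> R"
    then show "cint \<beta> \<beta> = 2" by (intro cint_eqI root_in_lattice) (simp_all add: root_cor)
  next
    fix \<beta> \<gamma> assume r: "\<beta> \<in> R" "\<gamma> \<in> R"
    then show "\<gamma> - isc (cint \<gamma> \<beta>) \<beta> \<in> R" unfolding cint_refl_eq[OF root_in_lattice[OF r(2)] r(1)] by (rule refl_root)
  next
    fix \<mu> \<beta> \<gamma> assume m: "\<mu> \<in> root_lattice s br H" "\<beta> \<in> R" "\<gamma> \<in> R"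
    have rl: "refl \<beta> \<mu> \<in> root_lattice s br H"
      unfolding cint_refl_eq[OF m(1,2), symmetric] using m(1) root_in_lattice[OF m(2)]
      unfolding lattice_isc by (intro m.span_diff m.span_scale)
    have "refl \<beta> \<mu> (cor (refl \<beta> \<gamma>)) = \<mu> (cor \<gamma>)"
      unfolding cor_refl[OF m(2,3)]
      unfolding root_refl_def lattice_dual(1)[OF m(1) cor_H[OF m(3)] cor_H[OF m(2)]]
        lattice_dual(1)[OF root_in_lattice[OF m(2)] cor_H[OF m(3)] cor_H[OF m(2)]] root_cor[OF m(2)]
      by (simp add: algebra_simps)
    then have "cint (refl \<beta> \<mu>) (refl \<beta> \<gamma>) = cint \<mu> \<gamma>"
      using lattice_integer[OF m(1,3)] by (intro cint_eqI rl refl_root m) simp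
    then show "cint (\<mu> - isc (cint \<mu> \<beta>) \<beta>) (\<gamma> - isc (cint \<gamma> \<beta>) \<beta>) = cint \<mu> \<gamma>"
      unfolding cint_refl_eq[OF m(1,2)] cint_refl_eq[OF root_in_lattice[OF m(3)] m(2)] .
  qed
qed

section \<open>Weights inside the root lattice and the highest root\<close>

lemma lattice_Q: "root_lattice s br H = rs.Q"
  by (rule lattice_isc)

lemma rs_refl: "\<beta> \<in> R \<Longrightarrow> \<mu> \<in> rs.Q \<Longrightarrow> rs.refl \<beta> \<mu> = refl \<beta> \<mu>"
  unfolding rs.refl_def using cint_refl_eq lattice_Q by simp

lemma weights_Q: "l \<in> weights \<Longrightarrow> l \<in> rs.Q"
  using rs.R_Q[of l] by (cases "l = 0") (auto simp: rs.span_zero roots_eq)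

lemma Q_outside: "l \<in> rs.Q \<Longrightarrow> x \<notin> H \<Longrightarrow> l x = 0"
  using lattice_dual(2) lattice_Q by blast

lemma weights_eq: "weights = insert 0 R"
  using zero_weight by (auto simp: roots_eq)

lemma br_span_left:
  assumes "\<And>l y. l \<in> weights \<Longrightarrow> y \<in> wsp l \<Longrightarrow> br y z \<in> S" "subspace S"
  shows "br y z \<in> S"
proof (rule br_span2[OF assms(2), of "\<Union>l\<in>weights. wsp l" "{z}"])
  show "z \<in> span {z}" by (rule span_base) simp
qed (use assms in \<open>auto simp: span_wsp\<close>)

text \<open>
  For \<open>x\<close> in the root space of a root \<open>\<theta>\<close> of maximal height, the elements obtained
  from \<open>x\<close> by bracketing with negative root vectors span an ideal.
\<close>

lemma highest_root: "\<exists>\<theta>\<in>R. \<forall>\<beta>\<in>R. \<forall>\<alpha>\<in>\<Pi>. rs.coord \<beta> \<alpha> \<le> rs.coord \<theta> \<alpha>"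
proof -
  define ht where "ht \<mu> = (\<Sum>\<alpha>\<in>\<Pi>. rs.coord \<mu> \<alpha>)" for \<mu>
  have ht: "rs.additive_on_Q ht"
    using rs.coord_additive by (simp add: ht_def rs.additive_on_Q_def sum.distrib)
  have htpos: "0 < ht \<beta>" if p: "rs.positive \<beta>" for \<beta>
  proof -
    obtain \<alpha> where a: "\<alpha> \<in> \<Pi>" "rs.coord \<beta> \<alpha> \<noteq> 0" using p rs.coord_nonzero by (auto simp: rs.positive_def)
    show ?thesis unfolding ht_def
      by (rule sum_pos2[OF rs.finite_base a(1)]) (use p a in \<open>auto simp: rs.positive_def order_less_le\<close>)
  qed
  have "R \<noteq> {}" using weights_nonzero weights_eq by fastforce
  then have "Max (ht ` R) \<in> ht ` R" using rs.finite_R by (intro Max_in) auto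
  then obtain \<theta> where \<theta>: "\<theta> \<in> R" "ht \<theta> = Max (ht ` R)" by auto
  then have mx: "ht \<beta> \<le> ht \<theta>" if "\<beta> \<in> R" for \<beta> using that rs.finite_R by simp
  note \<theta> = \<theta>(1)
  have esc: "\<beta> + \<theta> \<notin> weights" if p: "rs.positive \<beta>" for \<beta>
  proof
    have bR: "\<beta> \<in> R" using p by (simp add: rs.positive_def)
    have h: "ht (\<beta> + \<theta>) = ht \<beta> + ht \<theta>"
      using ht rs.R_Q bR \<theta> unfolding rs.additive_on_Q_def by blast
    assume "\<beta> + \<theta> \<in> weights"
    then consider "\<beta> + \<theta> = 0" | "\<beta> + \<theta> \<in> R" using weights_eq by blast
    then show False
    proof cases
      case 1
      then have "ht \<beta> + ht \<theta> = 0" using h rs.additive_zero[OF ht] by simp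
      then show False using mx[OF bR] htpos[OF p] by linarith
    next
      case 2
      then show False using mx[OF 2] h htpos[OF p] by linarith
    qed
  qed
  obtain x where x: "x \<in> wsp \<theta>" "x \<noteq> 0" using root_weight[OF \<theta>] wsp_0 unfolding weights_def by blast
  define N where "N = (\<Union>\<beta>\<in>{\<beta>. rs.positive \<beta>}. wsp (- \<beta>))"
  define J where "J = {foldr br ys x |ys. set ys \<subseteq> N}"
  have xJ: "x \<in> J" unfolding J_def by (rule CollectI, rule exI[of _ "[]"]) simp
  have JN: "br f z \<in> J" if f: "f \<in> N" and z: "z \<in> J" for f z
  proof -
    obtain ys where "z = foldr br ys x" "set ys \<subseteq> N" using z by (auto simp: J_def)
    then show ?thesis using f unfolding J_def by (intro CollectI exI[of _ "f # ys"]) simp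
  qed
  have spJN: "br f z \<in> span J" if "f \<in> N" "z \<in> span J" for f z
    by (rule br_span[OF subspace_span _ that(2)]) (use JN[OF that(1)] span_base in blast)
  \<comment> \<open>With \<open>y\<close> ranging over the whole algebra, [y, [f, z]] = [[y, f], z]
    + [f, [y, z]] is covered by the hypothesis for [y, f] and for y. At the empty word
    \<open>H\<close> scales \<open>x\<close>, positive root vectors kill it by maximal height, and
    negative ones belong to \<open>N\<close>.\<close>
  have id: "set ys \<subseteq> N \<Longrightarrow> br y (foldr br ys x) \<in> span J" for ys y
  proof (induction ys arbitrary: y)
    case Nil
    have "br y x \<in> span J"
    proof (rule br_span_left[OF _ subspace_span])
      fix l y assume l: "l \<in> weights" and y: "y \<in> wsp l"
      show "br y x \<in> span J"
      proof (cases "l = 0")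
        case True
        then have "y \<in> H" using y wsp_zero by simp
        then have "br y x = \<theta> y *s x" by (rule wsp_eigenvector[OF root_weight[OF \<theta>] x(1)])
        then show ?thesis using xJ by (simp add: span_scale span_base)
      next
        case False
        then have lR: "l \<in> R" using l weights_eq by blast
        show ?thesis
        proof (cases "rs.positive l")
          case True
          have "wsp (l + \<theta>) = {0}"
            by (rule wsp_nonweight) (use weights_outside[OF l] weights_outside[OF root_weight[OF \<theta>]] esc[OF True] in auto)
          then have "br y x = 0" using wsp_br[OF y x(1)] by auto
          then show ?thesis by (simp add: span_zero)
        next
          case False
          then have "rs.positive (- l)" using rs.positive_or_negative[OF lR] by blast
          then have "y \<in> N" unfolding N_def using y by (intro UN_I[of "- l"]) auto
          then show ?thesis by (intro span_base JN xJ)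
        qed
      qed
    qed
    then show ?case by simp
  next
    case (Cons f ys)
    let ?z = "foldr br ys x"
    have f: "f \<in> N" and ys: "set ys \<subseteq> N" using Cons.prems by auto
    have "br (br y f) ?z + br f (br y ?z) \<in> span J"
      by (rule span_add[OF Cons.IH[OF ys] spJN[OF f Cons.IH[OF ys]]])
    then show ?case by (simp add: br_br)
  qed
  have "lie_ideal s br (span J)"
    unfolding lie_ideal_def
  proof (intro conjI allI ballI)
    fix y z assume z: "z \<in> span J"
    show "br y z \<in> span J"
      by (rule br_span[OF subspace_span _ z]) (use id in \<open>auto simp: J_def\<close>)
  qed simp
  moreover have "span J \<noteq> {0}" using span_base[OF xJ] x(2) by auto
  ultimately have JU: "span J = UNIV" using ideals by blast
  \<comment> \<open>Every letter subtracts a positive root, so a word has a weight bounded by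
    \<theta> in all coordinates. As the words span the algebra, no root can be outside
    \<open>K\<close>.\<close>
  define K where "K = {l \<in> weights. \<forall>\<alpha>\<in>\<Pi>. rs.coord l \<alpha> \<le> rs.coord \<theta> \<alpha>}"
  have wt: "set ys \<subseteq> N \<Longrightarrow> \<exists>l. l \<in> rs.Q \<and> (\<forall>\<alpha>\<in>\<Pi>. rs.coord l \<alpha> \<le> rs.coord \<theta> \<alpha>) \<and> foldr br ys x \<in> wsp l" for ys
  proof (induction ys)
    case Nil
    then show ?case using x(1) rs.R_Q[OF \<theta>] by (intro exI[of _ \<theta>]) simp
  next
    case (Cons f ys)
    then obtain l where l: "l \<in> rs.Q" "\<forall>\<alpha>\<in>\<Pi>. rs.coord l \<alpha> \<le> rs.coord \<theta> \<alpha>" "foldr br ys x \<in> wsp l" by auto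
    obtain \<beta> where b: "rs.positive \<beta>" "f \<in> wsp (- \<beta>)" using Cons.prems by (auto simp: N_def)
    have bQ: "\<beta> \<in> rs.Q" using b(1) rs.R_Q by (simp add: rs.positive_def)
    have "rs.coord (- \<beta> + l) \<alpha> \<le> rs.coord \<theta> \<alpha>" if a: "\<alpha> \<in> \<Pi>" for \<alpha>
    proof -
      have "rs.coord (- \<beta> + l) \<alpha> = rs.coord (- \<beta>) \<alpha> + rs.coord l \<alpha>"
        using rs.coord_additive[OF a] rs.span_neg[OF bQ] l(1) unfolding rs.additive_on_Q_def by blast
      then show ?thesis using rs.coord_minus[OF bQ a] l(2) a b(1) by (force simp: rs.positive_def)
    qed
    moreover have "- \<beta> + l \<in> rs.Q" by (intro rs.span_add rs.span_neg bQ l(1))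
    moreover have "foldr br (f # ys) x \<in> wsp (- \<beta> + l)" using wsp_br[OF b(2) l(3)] by simp
    ultimately show ?case by blast
  qed
  have "J \<subseteq> span (\<Union>l\<in>K. wsp l)"
  proof
    fix z assume "z \<in> J"
    then obtain l where l: "l \<in> rs.Q" "\<forall>\<alpha>\<in>\<Pi>. rs.coord l \<alpha> \<le> rs.coord \<theta> \<alpha>" "z \<in> wsp l"
      using wt unfolding J_def by blast
    show "z \<in> span (\<Union>l\<in>K. wsp l)"
    proof (cases "l \<in> weights")
      case True
      then have "l \<in> K" using l by (simp add: K_def)
      then show ?thesis using l(3) by (intro span_base) blast
    next
      case False
      then have "z = 0" using wsp_nonweight[of l] Q_outside[OF l(1)] l(3) by blast
      then show ?thesis by (simp add: span_zero)
    qed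
  qed
  then have "span J \<subseteq> span (\<Union>l\<in>K. wsp l)" by (intro span_minimal) auto
  then have KU: "span (\<Union>l\<in>K. wsp l) = UNIV" using JU by blast
  have "\<beta> \<in> K" if b: "\<beta> \<in> R" for \<beta>
  proof (rule ccontr)
    assume n: "\<beta> \<notin> K"
    obtain y where y: "y \<in> wsp \<beta>" "y \<noteq> 0" using root_weight[OF b] wsp_0 unfolding weights_def by blast
    have "y = 0"
      by (rule wsp_span_disjoint[of K y \<beta>]) (use KU y(1) n weights_outside[OF root_weight[OF b]] in \<open>auto simp: K_def\<close>)
    then show False using y(2) by simp
  qed
  then show ?thesis using \<theta> by (intro bexI[of _ \<theta>]) (auto simp: K_def)
qed

end

section \<open>The action on pairs of subsets of a base\<close>

text \<open>The short roots are exactly the degrees of the components of an enveloped pair.\<close>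

definition bc2_short :: "(int \<times> int) set"
  where "bc2_short = {(1, 0), (- 1, 0), (1, 1), (- 1, - 1)}"

text \<open>
  Proportional roots have the same reflection, and \<open>2\<alpha>\<^sub>1\<close>, \<open>2\<alpha>\<^sub>1 + 2\<alpha>\<^sub>2\<close> are doubles of roots, so
  there are four reflections.
\<close>

lemma bc2_refl_cases:
  assumes "\<beta> \<in> bc2_roots"
  shows "bc2_refl \<beta> \<in> {\<lambda>(a, b). (2 * b - a, b), \<lambda>(a, b). (a, a - b), \<lambda>(a, b). (a - 2 * b, - b),
    \<lambda>(a, b). (- a, b - a)}"
proof -
  have d: "(4 * a - 4 * b) div 4 = a - b" "(- 4 * a + 4 * b) div 4 = b - a" for a b :: int
    by presburger+
  have e: "bc2_refl (1, 0) = (\<lambda>(a, b). (2 * b - a, b))" "bc2_refl (- 1, 0) = (\<lambda>(a, b). (2 * b - a, b))"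
    "bc2_refl (2, 0) = (\<lambda>(a, b). (2 * b - a, b))" "bc2_refl (- 2, 0) = (\<lambda>(a, b). (2 * b - a, b))"
    "bc2_refl (0, 1) = (\<lambda>(a, b). (a, a - b))" "bc2_refl (0, - 1) = (\<lambda>(a, b). (a, a - b))"
    "bc2_refl (1, 1) = (\<lambda>(a, b). (a - 2 * b, - b))" "bc2_refl (- 1, - 1) = (\<lambda>(a, b). (a - 2 * b, - b))"
    "bc2_refl (2, 2) = (\<lambda>(a, b). (a - 2 * b, - b))" "bc2_refl (- 2, - 2) = (\<lambda>(a, b). (a - 2 * b, - b))"
    "bc2_refl (2, 1) = (\<lambda>(a, b). (- a, b - a))" "bc2_refl (- 2, - 1) = (\<lambda>(a, b). (- a, b - a))"
    by (auto simp: fun_eq_iff bc2_refl_def Let_def; presburger)+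
  show ?thesis using assms unfolding bc2_roots_def bc2_pos_def by (auto simp: e)
qed

lemma bc2_refl_props:
  assumes "\<beta> \<in> bc2_roots"
  shows "bc2_refl \<beta> (x + y) = bc2_refl \<beta> x + bc2_refl \<beta> y" "bc2_refl \<beta> (bc2_refl \<beta> x) = x"
    "x \<in> bc2_roots \<Longrightarrow> bc2_refl \<beta> x \<in> bc2_roots" "x \<in> bc2_short \<Longrightarrow> bc2_refl \<beta> x \<in> bc2_short"
  using bc2_refl_cases[OF assms]
  by (cases x; cases y; auto simp: bc2_roots_def bc2_pos_def bc2_short_def)+

text \<open>\<open>bc2_weyl\<close> is given as a generated monoid. This predicate collects what is
  used of its elements and visibly passes to inverses.\<close>

definition bc2_automorphism :: "(int \<times> int \<Rightarrow> int \<times> int) \<Rightarrow> bool"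
  where "bc2_automorphism u \<longleftrightarrow> bij u \<and> (\<forall>x y. u (x + y) = u x + u y) \<and>
    (\<forall>x. u x \<in> bc2_roots \<longleftrightarrow> x \<in> bc2_roots) \<and> (\<forall>x. u x \<in> bc2_short \<longleftrightarrow> x \<in> bc2_short)"

lemma bc2_automorphismD:
  assumes "bc2_automorphism u"
  shows "bij u" "u (x + y) = u x + u y" "u x \<in> bc2_roots \<longleftrightarrow> x \<in> bc2_roots"
    "u x \<in> bc2_short \<longleftrightarrow> x \<in> bc2_short"
  using assms unfolding bc2_automorphism_def by blast+

lemma bc2_weyl_automorphism:
  assumes "u \<in> bc2_weyl"
  shows "bc2_automorphism u"
  using assms unfolding bc2_weyl_def
proof (induction rule: generated_by.induct)
  case id
  then show ?case unfolding bc2_automorphism_def by (intro conjI bij_id) simp_all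
next
  case (comp r w)
  then obtain \<beta> where b: "\<beta> \<in> bc2_roots" "r = bc2_refl \<beta>" by blast
  note p = bc2_refl_props[OF b(1)]
  have "bij r" unfolding b(2) by (rule o_bij[of "bc2_refl \<beta>"]) (auto simp: p)
  then have "bij (r \<circ> w)" using comp.IH unfolding bc2_automorphism_def by (intro bij_comp) auto
  moreover have "r x \<in> bc2_roots \<longleftrightarrow> x \<in> bc2_roots" "r x \<in> bc2_short \<longleftrightarrow> x \<in> bc2_short" for x
    unfolding b(2) using p by metis+
  ultimately show ?case using comp.IH p(1) unfolding bc2_automorphism_def by (simp add: b(2))
qed

lemma bc2_automorphism_inv:
  assumes "bc2_automorphism u"
  shows "bc2_automorphism (inv u)" "u (inv u x) = x" "inv u (u x) = x"
proof -
  have b: "bij u" using assms by (simp add: bc2_automorphism_def)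
  then show i: "u (inv u x) = x" "inv u (u x) = x" for x by (simp_all add: bij_is_surj surj_f_inv_f bij_is_inj)
  have "inv u (x + y) = inv u x + inv u y" for x y
    using assms i unfolding bc2_automorphism_def by metis
  then show "bc2_automorphism (inv u)"
    using assms i bij_imp_bij_inv[OF b] unfolding bc2_automorphism_def by metis
qed

lemma bc2_automorphism_0: "bc2_automorphism u \<Longrightarrow> u 0 = 0"
  using bc2_automorphismD(2)[of u 0 0] by simp

text \<open>Lets one additive functional, the sum of the coordinates, detect positivity, so that a
  single application of \<open>rs.dominant_exists\<close> is enough.\<close>

lemma bc2_roots_pos:
  "x \<in> bc2_roots \<union> {0} \<Longrightarrow> 0 \<le> fst x + snd x \<longleftrightarrow> x \<in> bc2_pos \<union> {0}"
  by (cases x) (simp add: bc2_roots_def bc2_pos_def zero_prod_def; elim disjE; simp)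

lemma bc2_pos_nonneg: "x \<in> bc2_pos \<union> {0} \<Longrightarrow> 0 \<le> fst x \<and> 0 \<le> snd x"
  by (auto simp: bc2_pos_def)

section \<open>The homomorphisms attached to subsets of the base\<close>

context based_lie_algebra
begin

abbreviation X where "X \<equiv> chi s br H \<Pi>"
abbreviation X2 where "X2 \<equiv> chi2 s br H \<Pi>"

lemma chi_eqI:
  assumes f: "rs.additive_on_Q f" "\<And>\<mu>. \<mu> \<notin> rs.Q \<Longrightarrow> f \<mu> = 0"
    "\<And>\<alpha>. \<alpha> \<in> S \<Longrightarrow> f \<alpha> = 1" "\<And>\<alpha>. \<alpha> \<in> \<Pi> - S \<Longrightarrow> f \<alpha> = 0" and S: "S \<subseteq> \<Pi>"
  shows "X S = f"
  unfolding chi_def lattice_Q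
proof (rule the_equality)
  show "(\<forall>\<mu>\<in>rs.Q. \<forall>\<nu>\<in>rs.Q. f (\<mu> + \<nu>) = f \<mu> + f \<nu>) \<and> (\<forall>\<mu>. \<mu> \<notin> rs.Q \<longrightarrow> f \<mu> = 0) \<and>
      (\<forall>\<alpha>\<in>S. f \<alpha> = 1) \<and> (\<forall>\<alpha>\<in>\<Pi> - S. f \<alpha> = 0)"
    using f unfolding rs.additive_on_Q_def by blast
  fix g assume g: "(\<forall>\<mu>\<in>rs.Q. \<forall>\<nu>\<in>rs.Q. g (\<mu> + \<nu>) = g \<mu> + g \<nu>) \<and> (\<forall>\<mu>. \<mu> \<notin> rs.Q \<longrightarrow> g \<mu> = 0) \<and>
      (\<forall>\<alpha>\<in>S. g \<alpha> = (1::int)) \<and> (\<forall>\<alpha>\<in>\<Pi> - S. g \<alpha> = 0)"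
  then have ga: "rs.additive_on_Q g" by (simp add: rs.additive_on_Q_def)
  show "g = f"
  proof
    fix \<mu>
    show "g \<mu> = f \<mu>"
    proof (cases "\<mu> \<in> rs.Q")
      case True
      show ?thesis
      proof (rule rs.additive_eq[OF ga f(1) _ True])
        fix \<alpha> assume "\<alpha> \<in> \<Pi>"
        then show "g \<alpha> = f \<alpha>" using g f(3,4) by (cases "\<alpha> \<in> S") auto
      qed
    next
      case False
      then show ?thesis using g f(2) by auto
    qed
  qed
qed

lemma chi_props:
  assumes S: "S \<subseteq> \<Pi>"
  shows "rs.additive_on_Q (X S)" "\<mu> \<notin> rs.Q \<Longrightarrow> X S \<mu> = 0"
    "\<alpha> \<in> \<Pi> \<Longrightarrow> X S \<alpha> = (if \<alpha> \<in> S then 1 else 0)"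
proof -
  define f where "f \<mu> = (if \<mu> \<in> rs.Q then \<Sum>\<alpha>\<in>S. rs.coord \<mu> \<alpha> else 0)" for \<mu>
  have "rs.coord (\<mu> + \<nu>) \<alpha> = rs.coord \<mu> \<alpha> + rs.coord \<nu> \<alpha>" if "\<alpha> \<in> S" "\<mu> \<in> rs.Q" "\<nu> \<in> rs.Q" for \<mu> \<nu> \<alpha>
    using rs.coord_additive[of \<alpha>] S that unfolding rs.additive_on_Q_def by blast
  then have fa: "rs.additive_on_Q f"
    unfolding rs.additive_on_Q_def f_def by (simp add: rs.span_add sum.distrib)
  have fb: "f \<alpha> = (if \<alpha> \<in> S then 1 else 0)" if a: "\<alpha> \<in> \<Pi>" for \<alpha>
  proof -
    have "f \<alpha> = (\<Sum>\<alpha>'\<in>S. if \<alpha>' = \<alpha> then 1 else 0)"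
      unfolding f_def using a rs.base_Q[OF a] S by (auto simp: rs.coord_base intro!: sum.cong)
    then show ?thesis using finite_subset[OF S rs.finite_base] by simp
  qed
  have "X S = f"
  proof (rule chi_eqI[OF fa _ _ _ S])
    show "f \<mu> = 0" if "\<mu> \<notin> rs.Q" for \<mu> using that by (simp add: f_def)
    show "f \<alpha> = 1" if "\<alpha> \<in> S" for \<alpha> using fb[of \<alpha>] that S by auto
    show "f \<alpha> = 0" if "\<alpha> \<in> \<Pi> - S" for \<alpha> using fb[of \<alpha>] that by auto
  qed
  then show "rs.additive_on_Q (X S)" "\<mu> \<notin> rs.Q \<Longrightarrow> X S \<mu> = 0"
    "\<alpha> \<in> \<Pi> \<Longrightarrow> X S \<alpha> = (if \<alpha> \<in> S then 1 else 0)"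
    using fa fb by (auto simp: f_def)
qed

lemma chi_inj:
  assumes "S \<subseteq> \<Pi>" "S' \<subseteq> \<Pi>" "X S = X S'"
  shows "S = S'"
proof -
  have "\<alpha> \<in> S \<longleftrightarrow> \<alpha> \<in> S'" if "\<alpha> \<in> \<Pi>" for \<alpha>
    using chi_props(3)[OF assms(1) that] chi_props(3)[OF assms(2) that] assms(3) by (auto split: if_splits)
  then show ?thesis using assms(1,2) by blast
qed

lemma chi2_inj:
  assumes "ST \<in> SPA s br H \<Pi>" "ST' \<in> SPA s br H \<Pi>" "X2 ST = X2 ST'"
  shows "ST = ST'"
proof -
  have P: "fst ST \<subseteq> \<Pi>" "snd ST \<subseteq> \<Pi>" "fst ST' \<subseteq> \<Pi>" "snd ST' \<subseteq> \<Pi>"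
    using assms(1,2) unfolding SPA_def by blast+
  have "X (fst ST) \<mu> = X (fst ST') \<mu> \<and> X (snd ST) \<mu> = X (snd ST') \<mu>" for \<mu>
    using fun_cong[OF assms(3), of \<mu>] by (simp add: chi2_def)
  then have "X (fst ST) = X (fst ST')" "X (snd ST) = X (snd ST')" by blast+
  then have "fst ST = fst ST'" "snd ST = snd ST'"
    using chi_inj[OF P(1,3)] chi_inj[OF P(2,4)] by blast+
  then show ?thesis by (rule prod_eqI)
qed

section \<open>The positive member of an orbit\<close>

lemma weyl_group_word:
  assumes "w \<in> weyl_group s br H"
  shows "\<exists>ws. set ws \<subseteq> \<Pi> \<and> (\<forall>\<mu>\<in>rs.Q. w \<mu> = rs.act ws \<mu>)"
  using assms unfolding weyl_group_def
proof (induction rule: generated_by.induct)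
  case id
  then show ?case by (intro exI[of _ "[]"]) simp
next
  case (comp r w)
  then obtain \<beta> ws where b: "\<beta> \<in> R" "r = refl \<beta>" and ws: "set ws \<subseteq> \<Pi>" "\<And>\<mu>. \<mu> \<in> rs.Q \<Longrightarrow> w \<mu> = rs.act ws \<mu>"
    by blast
  obtain vs where vs: "set vs \<subseteq> \<Pi>" "\<And>\<mu>. \<mu> \<in> rs.Q \<Longrightarrow> rs.refl \<beta> \<mu> = rs.act vs \<mu>"
    using rs.refl_word[OF b(1)] by blast
  have wR: "set ws \<subseteq> R" using ws(1) rs.base_R by blast
  have "(r \<circ> w) \<mu> = rs.act (vs @ ws) \<mu>" if mu: "\<mu> \<in> rs.Q" for \<mu>
    using rs_refl[OF b(1) rs.act_Q[OF wR mu]] vs(2)[OF rs.act_Q[OF wR mu]] by (simp add: b(2) ws(2)[OF mu])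
  then show ?case using vs(1) ws(1) by (intro exI[of _ "vs @ ws"]) simp
qed

lemma word_weyl_group:
  assumes "set ws \<subseteq> R"
  shows "\<exists>w\<in>weyl_group s br H. \<forall>\<mu>\<in>rs.Q. w \<mu> = rs.act ws \<mu>"
  using assms
proof (induction ws)
  case Nil
  then show ?case unfolding weyl_group_def by (intro bexI[of _ id] generated_by.id) simp
next
  case (Cons \<beta> ws)
  then obtain w where w: "w \<in> weyl_group s br H" "\<And>\<mu>. \<mu> \<in> rs.Q \<Longrightarrow> w \<mu> = rs.act ws \<mu>" by auto
  have "refl \<beta> \<circ> w \<in> weyl_group s br H"
    using w(1) Cons.prems unfolding weyl_group_def by (intro generated_by.comp) auto
  moreover have "(refl \<beta> \<circ> w) \<mu> = rs.act (\<beta> # ws) \<mu>" if mu: "\<mu> \<in> rs.Q" for \<mu>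
    using rs_refl[of \<beta>] rs.act_Q[OF _ mu, of ws] Cons.prems by (simp add: w(2)[OF mu])
  ultimately show ?case by blast
qed

lemma act_rev_left:
  "set ws \<subseteq> R \<Longrightarrow> \<mu> \<in> rs.Q \<Longrightarrow> rs.act (rev ws) (rs.act ws \<mu>) = \<mu>"
  by (induction ws) (simp_all add: rs.refl_refl rs.act_Q)

lemma act_rev_right:
  "set ws \<subseteq> R \<Longrightarrow> \<mu> \<in> rs.Q \<Longrightarrow> rs.act ws (rs.act (rev ws) \<mu>) = \<mu>"
  using act_rev_left[of "rev ws" \<mu>] by simp

lemma root_lattice_value:
  assumes "ST \<in> SPA s br H \<Pi>" "\<beta> \<in> R"
  shows "X2 ST \<beta> \<in> bc2_roots \<union> {0}"
  using assms unfolding SPA_def by blast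

text \<open>The Weyl group element is returned as a word in base reflections, because
  \<open>word_automorphism\<close> builds the automorphism from such a word.\<close>

lemma weyl_act_spec:
  assumes ST: "ST \<in> SPA s br H \<Pi>" and u: "bc2_automorphism u"
  shows "weyl_act s br H \<Pi> u ST \<in> SPA s br H \<Pi>"
    "\<exists>ws. set ws \<subseteq> \<Pi> \<and> (\<forall>\<mu>\<in>rs.Q. X2 (weyl_act s br H \<Pi> u ST) \<mu> = u (X2 ST (rs.act ws \<mu>)))"
proof -
  have STP: "fst ST \<subseteq> \<Pi>" "snd ST \<subseteq> \<Pi>" using ST by (auto simp: SPA_def)
  note u_add = bc2_automorphismD(2)[OF u]
  have X2_add: "X2 ST (\<mu> + \<nu>) = X2 ST \<mu> + X2 ST \<nu>" if "\<mu> \<in> rs.Q" "\<nu> \<in> rs.Q" for \<mu> \<nu>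
    using chi_props(1)[OF STP(1)] chi_props(1)[OF STP(2)] that by (simp add: chi2_def rs.additive_on_Q_def)
  define \<rho> where "\<rho> ws = (\<lambda>\<mu>. if \<mu> \<in> rs.Q then u (X2 ST (rs.act ws \<mu>)) else 0)" for ws
  have \<rho>_add: "\<rho> ws (\<mu> + \<nu>) = \<rho> ws \<mu> + \<rho> ws \<nu>" if "set ws \<subseteq> R" "\<mu> \<in> rs.Q" "\<nu> \<in> rs.Q" for ws \<mu> \<nu>
    using that by (simp add: \<rho>_def rs.span_add rs.act_add X2_add rs.act_Q u_add)
  have \<rho>_fst: "rs.additive_on_Q (\<lambda>\<mu>. fst (\<rho> ws \<mu>))" and \<rho>_snd: "rs.additive_on_Q (\<lambda>\<mu>. snd (\<rho> ws \<mu>))"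
    and \<rho>_sum: "rs.additive_on_Q (\<lambda>\<mu>. fst (\<rho> ws \<mu>) + snd (\<rho> ws \<mu>))"
    if "set ws \<subseteq> R" for ws
    using \<rho>_add[OF that] by (simp_all add: rs.additive_on_Q_def)
  have \<rho>_roots: "\<rho> ws \<beta> \<in> bc2_roots \<union> {0}" if "set ws \<subseteq> R" "\<beta> \<in> R" for ws \<beta>
  proof -
    have "X2 ST (rs.act ws \<beta>) \<in> bc2_roots \<union> {0}"
      by (rule root_lattice_value[OF ST rs.act_R[OF that]])
    moreover have "\<rho> ws \<beta> = u (X2 ST (rs.act ws \<beta>))" using rs.R_Q[OF that(2)] by (simp add: \<rho>_def)
    ultimately show ?thesis
      using bc2_automorphism_0[OF u] bc2_automorphismD(3)[OF u, of "X2 ST (rs.act ws \<beta>)"] by auto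
  qed
  have orbit: "weyl_orbit s br H \<Pi> u ST = \<rho> ` {ws. set ws \<subseteq> \<Pi>}"
  proof (intro equalityI subsetI)
    fix f assume "f \<in> weyl_orbit s br H \<Pi> u ST"
    then obtain w where w: "w \<in> weyl_group s br H" "f = (\<lambda>\<mu>. if \<mu> \<in> rs.Q then (u \<circ> X2 ST \<circ> w) \<mu> else 0)"
      unfolding weyl_orbit_def lattice_Q by blast
    obtain ws where ws: "set ws \<subseteq> \<Pi>" "\<And>\<mu>. \<mu> \<in> rs.Q \<Longrightarrow> w \<mu> = rs.act ws \<mu>"
      using weyl_group_word[OF w(1)] by blast
    have "f = \<rho> ws" unfolding w(2) by (rule ext) (simp add: \<rho>_def ws(2))
    then show "f \<in> \<rho> ` {ws. set ws \<subseteq> \<Pi>}" using ws(1) by blast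
  next
    fix f assume "f \<in> \<rho> ` {ws. set ws \<subseteq> \<Pi>}"
    then obtain ws where ws: "set ws \<subseteq> \<Pi>" "f = \<rho> ws" by blast
    then obtain w where w: "w \<in> weyl_group s br H" "\<And>\<mu>. \<mu> \<in> rs.Q \<Longrightarrow> w \<mu> = rs.act ws \<mu>"
      using word_weyl_group[of ws] rs.base_R by blast
    have "f = (\<lambda>\<mu>. if \<mu> \<in> rs.Q then (u \<circ> X2 ST \<circ> w) \<mu> else 0)"
      unfolding ws(2) by (rule ext) (simp add: \<rho>_def w(2))
    then show "f \<in> weyl_orbit s br H \<Pi> u ST" unfolding weyl_orbit_def lattice_Q using w(1) by blast
  qed
  \<comment> \<open>Dominance is asked for the coordinate sum only; \<open>bc2_roots_pos\<close>
    turns it into positivity.\<close>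
  obtain ws where ws: "set ws \<subseteq> \<Pi>" "\<And>\<alpha>. \<alpha> \<in> \<Pi> \<Longrightarrow> 0 \<le> fst (\<rho> [] (rs.act ws \<alpha>)) + snd (\<rho> [] (rs.act ws \<alpha>))"
    using rs.dominant_exists[OF \<rho>_sum[of "[]"]] by auto
  have wR: "set ws \<subseteq> R" using ws(1) rs.base_R by blast
  have \<rho>_Nil: "\<rho> [] (rs.act ws \<mu>) = \<rho> ws \<mu>" if "\<mu> \<in> rs.Q" for \<mu>
    using that rs.act_Q[OF wR that] by (simp add: \<rho>_def)
  have pos: "\<rho> ws \<alpha> \<in> bc2_pos \<union> {0}" if a: "\<alpha> \<in> \<Pi>" for \<alpha>
    using ws(2)[OF a] \<rho>_Nil[OF rs.base_Q[OF a]] \<rho>_roots[OF wR, of \<alpha>] a rs.base_R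
    by (subst bc2_roots_pos[symmetric]) auto
  \<comment> \<open>Two positive members are conjugate by the word \<open>?xs\<close>. Both
    coordinates of a positive member are dominant, so uniqueness holds for each coordinate
    separately.\<close>
  have unique: "\<rho> vs = \<rho> ws" if vs: "set vs \<subseteq> \<Pi>" and p: "\<And>\<alpha>. \<alpha> \<in> \<Pi> \<Longrightarrow> \<rho> vs \<alpha> \<in> bc2_pos \<union> {0}" for vs
  proof
    fix \<mu>
    have vR: "set vs \<subseteq> R" using vs rs.base_R by blast
    let ?xs = "rev ws @ vs"
    have xP: "set ?xs \<subseteq> \<Pi>" using ws(1) vs by simp
    have e: "\<rho> ws (rs.act ?xs \<mu>) = \<rho> vs \<mu>" if "\<mu> \<in> rs.Q" for \<mu>
    proof -
      have "rs.act vs \<mu> \<in> rs.Q" "rs.act ?xs \<mu> \<in> rs.Q"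
        using rs.act_Q[OF vR that] rs.act_Q[of ?xs \<mu>] wR vR that by auto
      then show ?thesis using that act_rev_right[OF wR, of "rs.act vs \<mu>"] by (simp add: \<rho>_def)
    qed
    show "\<rho> vs \<mu> = \<rho> ws \<mu>"
    proof (cases "\<mu> \<in> rs.Q")
      case True
      have "fst (\<rho> ws (rs.act ?xs \<mu>)) = fst (\<rho> ws \<mu>)"
        by (rule rs.dominant_unique[OF \<rho>_fst[OF wR] _ xP _ True])
          (use bc2_pos_nonneg[OF pos] bc2_pos_nonneg[OF p] e rs.base_Q in auto)
      moreover have "snd (\<rho> ws (rs.act ?xs \<mu>)) = snd (\<rho> ws \<mu>)"
        by (rule rs.dominant_unique[OF \<rho>_snd[OF wR] _ xP _ True])
          (use bc2_pos_nonneg[OF pos] bc2_pos_nonneg[OF p] e rs.base_Q in auto)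
      ultimately show ?thesis using e[OF True] by (simp add: prod_eq_iff)
    qed (simp add: \<rho>_def)
  qed
  have the_\<rho>: "(THE f. f \<in> weyl_orbit s br H \<Pi> u ST \<and> f ` \<Pi> \<subseteq> bc2_pos \<union> {0}) = \<rho> ws"
    unfolding orbit
  proof (rule the_equality)
    show "\<rho> ws \<in> \<rho> ` {ws. set ws \<subseteq> \<Pi>} \<and> \<rho> ws ` \<Pi> \<subseteq> bc2_pos \<union> {0}" using ws(1) pos by blast
    fix f assume f: "f \<in> \<rho> ` {ws. set ws \<subseteq> \<Pi>} \<and> f ` \<Pi> \<subseteq> bc2_pos \<union> {0}"
    then obtain vs where vs: "set vs \<subseteq> \<Pi>" "f = \<rho> vs" by blast
    have "f ` \<Pi> \<subseteq> bc2_pos \<union> {0}" using f ..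
    then show "f = \<rho> ws" unfolding vs(2) by (intro unique[OF vs(1)]) blast
  qed
  \<comment> \<open>Moved back by the inverse word, this root takes a short value under
    \<open>\<rho> ws\<close>, so the first coordinate there is odd.\<close>
  obtain \<beta>0 where b0: "\<beta>0 \<in> R" "X2 ST \<beta>0 \<in> bc2_short"
    using ST unfolding SPA_def bc2_short_def by blast
  define \<beta> where "\<beta> = rs.act (rev ws) \<beta>0"
  have bR: "\<beta> \<in> R" unfolding \<beta>_def by (rule rs.act_R) (use wR b0 in auto)
  have "\<rho> ws \<beta> = u (X2 ST \<beta>0)"
    using act_rev_right[OF wR rs.R_Q[OF b0(1)]] rs.R_Q[OF bR] by (simp add: \<rho>_def \<beta>_def)
  then have short: "\<rho> ws \<beta> \<in> bc2_short" using b0(2) bc2_automorphismD(4)[OF u] by simp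
  \<comment> \<open>The odd value at \<beta> forces an odd, hence positive, first coordinate at
    another base element. The highest root has all coordinates at least 1, so its first coordinate
    would be at least 3, while \<Delta> allows at most 2.\<close>
  have not2: "fst (\<rho> ws \<alpha>) \<noteq> 2" if a: "\<alpha> \<in> \<Pi>" for \<alpha>
  proof
    assume a2: "fst (\<rho> ws \<alpha>) = 2"
    have "odd (fst (\<rho> ws \<beta>))" using short by (auto simp: bc2_short_def)
    moreover have "fst (\<rho> ws \<beta>) = (\<Sum>\<alpha>\<in>\<Pi>. rs.coord \<beta> \<alpha> * fst (\<rho> ws \<alpha>))"
      by (rule rs.additive_expand[OF \<rho>_fst[OF wR] rs.R_Q[OF bR]])
    ultimately have "\<not> (\<forall>\<alpha>\<in>\<Pi>. even (fst (\<rho> ws \<alpha>)))" by (auto intro!: dvd_sum)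
    then obtain \<alpha>' where a': "\<alpha>' \<in> \<Pi>" "odd (fst (\<rho> ws \<alpha>'))" by blast
    then have "1 \<le> fst (\<rho> ws \<alpha>')" using bc2_pos_nonneg[OF pos[OF a'(1)]] by (cases "fst (\<rho> ws \<alpha>') = 0") auto
    have ne: "\<alpha> \<noteq> \<alpha>'" using a' a2 by auto
    obtain \<theta> where t: "\<theta> \<in> R" "\<And>\<beta> \<alpha>. \<beta> \<in> R \<Longrightarrow> \<alpha> \<in> \<Pi> \<Longrightarrow> rs.coord \<beta> \<alpha> \<le> rs.coord \<theta> \<alpha>"
      using highest_root by blast
    have t1: "1 \<le> rs.coord \<theta> \<alpha>''" if "\<alpha>'' \<in> \<Pi>" for \<alpha>''
      using t(2)[of \<alpha>'' \<alpha>''] that rs.base_R rs.coord_base[OF that that] by auto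
    have "(\<Sum>\<alpha>''\<in>{\<alpha>, \<alpha>'}. fst (\<rho> ws \<alpha>'')) \<le> (\<Sum>\<alpha>''\<in>\<Pi>. fst (\<rho> ws \<alpha>''))"
      using a a'(1) rs.finite_base bc2_pos_nonneg[OF pos] by (intro sum_mono2) auto
    also have "\<dots> \<le> (\<Sum>\<alpha>''\<in>\<Pi>. rs.coord \<theta> \<alpha>'' * fst (\<rho> ws \<alpha>''))"
    proof (rule sum_mono)
      fix \<alpha>'' assume p: "\<alpha>'' \<in> \<Pi>"
      show "fst (\<rho> ws \<alpha>'') \<le> rs.coord \<theta> \<alpha>'' * fst (\<rho> ws \<alpha>'')"
        using mult_right_mono[OF t1[OF p], of "fst (\<rho> ws \<alpha>'')"] bc2_pos_nonneg[OF pos[OF p]] by simp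
    qed
    also have "\<dots> = fst (\<rho> ws \<theta>)"
      by (rule rs.additive_expand[OF \<rho>_fst[OF wR] rs.R_Q[OF t(1)], symmetric])
    also have "\<dots> \<le> 2" using \<rho>_roots[OF wR t(1)] by (auto simp: bc2_roots_def bc2_pos_def)
    finally show False using a2 \<open>1 \<le> fst (\<rho> ws \<alpha>')\<close> ne by simp
  qed
  have val: "\<rho> ws \<alpha> \<in> {(0, 0), (1, 0), (0, 1), (1, 1)}" if "\<alpha> \<in> \<Pi>" for \<alpha>
    using pos[OF that] not2[OF that] by (auto simp: bc2_pos_def zero_prod_def)
  define ST' where "ST' = ({\<alpha> \<in> \<Pi>. fst (\<rho> ws \<alpha>) = 1}, {\<alpha> \<in> \<Pi>. snd (\<rho> ws \<alpha>) = 1})"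
  have "X (fst ST') = (\<lambda>\<mu>. fst (\<rho> ws \<mu>))"
    by (rule chi_eqI[OF \<rho>_fst[OF wR]]) (use val in \<open>fastforce simp: ST'_def \<rho>_def\<close>)+
  moreover have "X (snd ST') = (\<lambda>\<mu>. snd (\<rho> ws \<mu>))"
    by (rule chi_eqI[OF \<rho>_snd[OF wR]]) (use val in \<open>fastforce simp: ST'_def \<rho>_def\<close>)+
  ultimately have X': "X2 ST' = \<rho> ws" by (simp add: chi2_def)
  have "X2 ST' ` R \<subseteq> bc2_roots \<union> {0}" unfolding X' using \<rho>_roots[OF wR] by blast
  moreover have "X2 ST' ` R \<inter> {(1, 0), (- 1, 0), (1, 1), (- 1, - 1)} \<noteq> {}"
    unfolding X' using short bR unfolding bc2_short_def by blast
  moreover have "fst ST' \<subseteq> \<Pi>" "snd ST' \<subseteq> \<Pi>" by (auto simp: ST'_def)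
  ultimately have SPA': "ST' \<in> SPA s br H \<Pi>" unfolding SPA_def by blast
  have "weyl_act s br H \<Pi> u ST = ST'"
    unfolding weyl_act_def the_\<rho> Let_def
    by (rule the_equality) (use SPA' X' chi2_inj in auto)
  then show "weyl_act s br H \<Pi> u ST \<in> SPA s br H \<Pi>"
    "\<exists>ws. set ws \<subseteq> \<Pi> \<and> (\<forall>\<mu>\<in>rs.Q. X2 (weyl_act s br H \<Pi> u ST) \<mu> = u (X2 ST (rs.act ws \<mu>)))"
    using SPA' ws(1) X' by (auto simp: \<rho>_def)
qed

lemma word_automorphism:
  assumes "set ws \<subseteq> R"
  shows "\<exists>f. automorphism f \<and> (\<forall>l\<in>weights. f ` wsp l = wsp (rs.act ws l))"
  using assms
proof (induction ws)
  case Nil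
  then show ?case by (intro exI[of _ id] conjI automorphism_id) simp
next
  case (Cons \<beta> ws)
  then obtain f where f: "automorphism f" "\<And>l. l \<in> weights \<Longrightarrow> f ` wsp l = wsp (rs.act ws l)" by auto
  have b: "\<beta> \<in> R" and wR: "set ws \<subseteq> R" using Cons.prems by auto
  have "(refl_aut \<beta> \<circ> f) ` wsp l = wsp (rs.act (\<beta> # ws) l)" if l: "l \<in> weights" for l
  proof -
    have "rs.act ws l \<in> weights"
    proof (cases "l = 0")
      case True
      have "rs.act ws 0 = 0" using rs.act_add[OF wR rs.span_zero rs.span_zero] by simp
      then show ?thesis using True zero_weight by simp
    next
      case False
      then show ?thesis using rs.act_R[OF wR] l weights_eq by blast
    qed
    then have "refl_aut \<beta> ` f ` wsp l = wsp (rs.act (\<beta> # ws) l)"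
      using refl_aut_wsp[OF b] f(2)[OF l] rs_refl[OF b weights_Q] by simp
    then show ?thesis by (simp add: image_comp)
  qed
  then show ?case using automorphism_comp[OF refl_aut(1)[OF b] f(1)] by blast
qed

end

section \<open>Graded isomorphisms\<close>

lemma lie_pair_cong:
  assumes "\<And>\<sigma>. C \<sigma> 0 = D \<sigma> 0" "\<And>\<sigma>. C \<sigma> 1 = D \<sigma> 1"
  shows "lie_pair br C = lie_pair br D"
proof -
  have "(if i = 0 \<or> i = 1 then C \<sigma> i else {0}) = (if i = 0 \<or> i = 1 then D \<sigma> i else {0})" for \<sigma> i
    using assms by auto
  then show ?thesis unfolding lie_pair_def assms by simp
qed

lemma pspace_enveloped:
  "pspace (enveloped_pair br L) \<sigma> = {x + y | x y. x \<in> L (sg \<sigma>, 0) \<and> y \<in> L (sg \<sigma>, sg \<sigma>)}"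
  by (simp add: enveloped_pair_def lie_pair_def)

lemma triple_enveloped: "triple (enveloped_pair br L) \<sigma> x y z = br (br x y) z"
  by (simp add: enveloped_pair_def lie_pair_def)

lemma pcomp_enveloped: "i = 0 \<or> i = 1 \<Longrightarrow> pcomp (enveloped_pair br L) \<sigma> i = L (sg \<sigma>, sg \<sigma> * i)"
  by (simp add: enveloped_pair_def lie_pair_def)

lemma enveloped_props:
  assumes g: "bc2_graded s br L"
  shows "x \<in> pspace (enveloped_pair br L) \<sigma> \<Longrightarrow> y \<in> pspace (enveloped_pair br L) (opp \<sigma>) \<Longrightarrow>
      z \<in> pspace (enveloped_pair br L) \<sigma> \<Longrightarrow> br (br x y) z \<in> pspace (enveloped_pair br L) \<sigma>"
    and "i = 0 \<or> i = 1 \<Longrightarrow> L (sg \<sigma>, sg \<sigma> * i) \<subseteq> pspace (enveloped_pair br L) \<sigma>"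
    and "module.subspace s (pspace (enveloped_pair br L) \<sigma>)"
proof -
  interpret lie_algebra s br by (rule bc2_gradedD(1)[OF g])
  have k: "trilinear_pair s (enveloped_pair br L)"
    using sp_graded_kantor_pair_enveloped[OF g] unfolding sp_graded_kantor_pair_def kantor_pair_def by blast
  then show "x \<in> pspace (enveloped_pair br L) \<sigma> \<Longrightarrow> y \<in> pspace (enveloped_pair br L) (opp \<sigma>) \<Longrightarrow>
      z \<in> pspace (enveloped_pair br L) \<sigma> \<Longrightarrow> br (br x y) z \<in> pspace (enveloped_pair br L) \<sigma>"
    unfolding trilinear_pair_def triple_enveloped by blast
  show "subspace (pspace (enveloped_pair br L) \<sigma>)"
    using k unfolding trilinear_pair_def by blast
  have 0: "0 \<in> L \<alpha>" for \<alpha> by (rule subspace_0[OF bc2_gradedD(2)[OF g]])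
  show "i = 0 \<or> i = 1 \<Longrightarrow> L (sg \<sigma>, sg \<sigma> * i) \<subseteq> pspace (enveloped_pair br L) \<sigma>"
  proof (elim disjE)
    assume "i = 0"
    show ?thesis
    proof
      fix x assume "x \<in> L (sg \<sigma>, sg \<sigma> * i)"
      then have "x = x + 0 \<and> x \<in> L (sg \<sigma>, 0) \<and> 0 \<in> L (sg \<sigma>, sg \<sigma>)" using 0 \<open>i = 0\<close> by simp
      then show "x \<in> pspace (enveloped_pair br L) \<sigma>" unfolding pspace_enveloped by blast
    qed
  next
    assume "i = 1"
    show ?thesis
    proof
      fix x assume "x \<in> L (sg \<sigma>, sg \<sigma> * i)"
      then have "x = 0 + x \<and> 0 \<in> L (sg \<sigma>, 0) \<and> x \<in> L (sg \<sigma>, sg \<sigma>)" using 0 \<open>i = 1\<close> by simp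
      then show "x \<in> pspace (enveloped_pair br L) \<sigma>" unfolding pspace_enveloped by blast
    qed
  qed
qed

lemma enveloped_triple_degree:
  assumes g: "bc2_graded s br L" and "x \<in> L (sg \<sigma>, sg \<sigma> * i)" "y \<in> L (sg (opp \<sigma>), sg (opp \<sigma>) * j)"
    "z \<in> L (sg \<sigma>, sg \<sigma> * k)"
  shows "br (br x y) z \<in> L (sg \<sigma>, sg \<sigma> * (i - j + k))"
proof -
  have "br (br x y) z \<in> L ((sg \<sigma>, sg \<sigma> * i) + (sg (opp \<sigma>), sg (opp \<sigma>) * j) + (sg \<sigma>, sg \<sigma> * k))"
    using assms(2-4) by (intro bc2_gradedD(3)[OF g])
  then show ?thesis by (simp add: algebra_simps)
qed

lemma lin_onD:
  assumes "lin_on s t V f"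
  shows "x \<in> V \<Longrightarrow> y \<in> V \<Longrightarrow> f (x + y) = f x + f y" "x \<in> V \<Longrightarrow> f (s c x) = t c (f x)"
  using assms unfolding lin_on_def by blast+

text \<open>Products have to be compared only when the resulting degree is 0 or 1: the other
  possible degrees, -1 and 2, lie outside \<Delta>, where both sides vanish. Trilinearity then
  extends the comparison to sums, one argument at a time.\<close>

lemma graded_isomorphic_homogeneous:
  fixes L :: "int \<times> int \<Rightarrow> 'l::ab_group_add set" and M :: "int \<times> int \<Rightarrow> 'm::ab_group_add set"
  assumes gL: "bc2_graded s br L" and gM: "bc2_graded t br' M"
    and bij: "\<And>\<sigma> i. i = 0 \<or> i = 1 \<Longrightarrow> bij_betw (F \<sigma> i) (L (sg \<sigma>, sg \<sigma> * i)) (M (sg \<sigma>, sg \<sigma> * i))"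
    and lin: "\<And>\<sigma> i. i = 0 \<or> i = 1 \<Longrightarrow> lin_on s t (L (sg \<sigma>, sg \<sigma> * i)) (F \<sigma> i)"
    and tri: "\<And>\<sigma> i j k x y z. i = 0 \<or> i = 1 \<Longrightarrow> j = 0 \<or> j = 1 \<Longrightarrow> k = 0 \<or> k = 1 \<Longrightarrow>
      i - j + k = 0 \<or> i - j + k = 1 \<Longrightarrow> x \<in> L (sg \<sigma>, sg \<sigma> * i) \<Longrightarrow>
      y \<in> L (sg (opp \<sigma>), sg (opp \<sigma>) * j) \<Longrightarrow> z \<in> L (sg \<sigma>, sg \<sigma> * k) \<Longrightarrow>
      F \<sigma> (i - j + k) (br (br x y) z) = br' (br' (F \<sigma> i x) (F (opp \<sigma>) j y)) (F \<sigma> k z)"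
  shows "graded_isomorphic s (enveloped_pair br L) t (enveloped_pair br' M)"
proof -
  interpret l: lie_algebra s br by (rule bc2_gradedD(1)[OF gL])
  interpret m: lie_algebra t br' by (rule bc2_gradedD(1)[OF gM])
  let ?P = "pspace (enveloped_pair br L)" and ?Q = "pspace (enveloped_pair br' M)"
  define C where "C \<sigma> i = L (sg \<sigma>, sg \<sigma> * i)" for \<sigma> i
  define D where "D \<sigma> i = M (sg \<sigma>, sg \<sigma> * i)" for \<sigma> i
  have subC: "l.subspace (C \<sigma> i)" and subD: "m.subspace (D \<sigma> i)" for \<sigma> i
    unfolding C_def D_def by (rule bc2_gradedD(2)[OF gL], rule bc2_gradedD(2)[OF gM])
  have PC: "?P \<sigma> = {x + y | x y. x \<in> C \<sigma> 0 \<and> y \<in> C \<sigma> 1}"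
    and QD: "?Q \<sigma> = {x + y | x y. x \<in> D \<sigma> 0 \<and> y \<in> D \<sigma> 1}" for \<sigma>
    by (simp_all add: pspace_enveloped C_def D_def)
  have ne: "(sg \<sigma>, sg \<sigma> * 0) \<noteq> (sg \<sigma>, sg \<sigma> * 1)" for \<sigma> by (cases \<sigma>) auto
  have disC: "x = 0" if "x \<in> C \<sigma> 0" "x \<in> C \<sigma> 1" for x \<sigma>
    using bc2_graded_disjoint[OF gL ne] that unfolding C_def by blast
  have disD: "x = 0" if "x \<in> D \<sigma> 0" "x \<in> D \<sigma> 1" for x \<sigma>
    using bc2_graded_disjoint[OF gM ne] that unfolding D_def by blast
  have bijC: "bij_betw (F \<sigma> i) (C \<sigma> i) (D \<sigma> i)" and linC: "lin_on s t (C \<sigma> i) (F \<sigma> i)"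
    if "i = 0 \<or> i = 1" for \<sigma> i
    using bij[OF that] lin[OF that] by (simp_all add: C_def D_def)
  have F0: "F \<sigma> i 0 = 0" if "i = 0 \<or> i = 1" for \<sigma> i
    using lin_onD(2)[OF linC[OF that] l.subspace_0[OF subC], where c = 0] by simp
  \<comment> \<open>Well defined, since the two components intersect in 0.\<close>
  define f where "f \<sigma> x = (THE v. \<exists>x0 x1. x0 \<in> C \<sigma> 0 \<and> x1 \<in> C \<sigma> 1 \<and> x = x0 + x1 \<and> v = F \<sigma> 0 x0 + F \<sigma> 1 x1)" for \<sigma> x
  have f: "f \<sigma> (x0 + x1) = F \<sigma> 0 x0 + F \<sigma> 1 x1" if x: "x0 \<in> C \<sigma> 0" "x1 \<in> C \<sigma> 1" for \<sigma> x0 x1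
    unfolding f_def
  proof (rule the_equality)
    fix v assume "\<exists>y0 y1. y0 \<in> C \<sigma> 0 \<and> y1 \<in> C \<sigma> 1 \<and> x0 + x1 = y0 + y1 \<and> v = F \<sigma> 0 y0 + F \<sigma> 1 y1"
    then obtain y0 y1 where y: "y0 \<in> C \<sigma> 0" "y1 \<in> C \<sigma> 1" "x0 + x1 = y0 + y1" "v = F \<sigma> 0 y0 + F \<sigma> 1 y1" by blast
    have e: "x0 - y0 = y1 - x1" using y(3) by (simp add: algebra_simps)
    have "x0 - y0 = 0"
      by (rule disC[of _ \<sigma>]) (use l.subspace_diff[OF subC] x y(1,2) e in \<open>metis+\<close>)
    then show "v = F \<sigma> 0 x0 + F \<sigma> 1 x1" using y(3,4) by simp
  qed (use x in blast)
  have fh: "f \<sigma> x = F \<sigma> i x" if "i = 0 \<or> i = 1" "x \<in> C \<sigma> i" for \<sigma> i x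
    using that f[OF _ l.subspace_0[OF subC]] f[OF l.subspace_0[OF subC]] F0 by fastforce
  have CP: "C \<sigma> i \<subseteq> ?P \<sigma>" if "i = 0 \<or> i = 1" for \<sigma> i
    unfolding C_def by (rule enveloped_props(2)[OF gL that])
  have linf: "lin_on s t (?P \<sigma>) (f \<sigma>)" for \<sigma>
    unfolding lin_on_def
  proof (intro conjI ballI allI)
    fix x y assume "x \<in> ?P \<sigma>" "y \<in> ?P \<sigma>"
    then obtain x0 x1 y0 y1 where x: "x = x0 + x1" "x0 \<in> C \<sigma> 0" "x1 \<in> C \<sigma> 1"
      and y: "y = y0 + y1" "y0 \<in> C \<sigma> 0" "y1 \<in> C \<sigma> 1" unfolding PC by blast
    have "f \<sigma> ((x0 + y0) + (x1 + y1)) = F \<sigma> 0 (x0 + y0) + F \<sigma> 1 (x1 + y1)"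
      by (rule f) (use x y l.subspace_add[OF subC] in blast)+
    also have "\<dots> = f \<sigma> x + f \<sigma> y"
      using x y lin_onD(1)[OF linC] by (simp add: f algebra_simps)
    finally show "f \<sigma> (x + y) = f \<sigma> x + f \<sigma> y" unfolding x y by (simp add: algebra_simps)
  next
    fix c x assume "x \<in> ?P \<sigma>"
    then obtain x0 x1 where x: "x = x0 + x1" "x0 \<in> C \<sigma> 0" "x1 \<in> C \<sigma> 1" unfolding PC by blast
    have "f \<sigma> (s c x0 + s c x1) = F \<sigma> 0 (s c x0) + F \<sigma> 1 (s c x1)"
      by (rule f) (use x l.subspace_scale[OF subC] in blast)+
    then show "f \<sigma> (s c x) = t c (f \<sigma> x)"
      using x lin_onD(2)[OF linC] by (simp add: f l.scale_right_distrib m.scale_right_distrib)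
  qed
  have bijf: "bij_betw (f \<sigma>) (?P \<sigma>) (?Q \<sigma>)" for \<sigma>
    unfolding bij_betw_def
  proof
    have FD: "F \<sigma> i x \<in> D \<sigma> i" if "i = 0 \<or> i = 1" "x \<in> C \<sigma> i" for i x
      using bijC[OF that(1), of \<sigma>] that(2) by (auto simp: bij_betw_def)
    show "inj_on (f \<sigma>) (?P \<sigma>)"
    proof (rule inj_onI)
      fix x y assume "x \<in> ?P \<sigma>" "y \<in> ?P \<sigma>" and e: "f \<sigma> x = f \<sigma> y"
      then obtain x0 x1 y0 y1 where x: "x = x0 + x1" "x0 \<in> C \<sigma> 0" "x1 \<in> C \<sigma> 1"
        and y: "y = y0 + y1" "y0 \<in> C \<sigma> 0" "y1 \<in> C \<sigma> 1" unfolding PC by blast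
      have e: "F \<sigma> 0 x0 + F \<sigma> 1 x1 = F \<sigma> 0 y0 + F \<sigma> 1 y1" using e x y by (simp add: f)
      then have d: "F \<sigma> 0 x0 - F \<sigma> 0 y0 = F \<sigma> 1 y1 - F \<sigma> 1 x1" by (simp add: algebra_simps)
      have "F \<sigma> 0 x0 - F \<sigma> 0 y0 \<in> D \<sigma> 0" by (intro m.subspace_diff[OF subD] FD x y disjI1 refl)
      moreover have "F \<sigma> 0 x0 - F \<sigma> 0 y0 \<in> D \<sigma> 1" unfolding d by (intro m.subspace_diff[OF subD] FD x y disjI2 refl)
      ultimately have "F \<sigma> 0 x0 - F \<sigma> 0 y0 = 0" by (rule disD)
      then have "F \<sigma> 0 x0 = F \<sigma> 0 y0" "F \<sigma> 1 x1 = F \<sigma> 1 y1" using e by simp_all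
      then show "x = y" using x y bijC[where i = 0 and \<sigma> = \<sigma>] bijC[where i = 1 and \<sigma> = \<sigma>] unfolding bij_betw_def by (auto dest: inj_onD)
    qed
    show "f \<sigma> ` ?P \<sigma> = ?Q \<sigma>"
    proof (intro equalityI subsetI)
      fix v assume "v \<in> f \<sigma> ` ?P \<sigma>"
      then obtain x0 x1 where "v = f \<sigma> (x0 + x1)" "x0 \<in> C \<sigma> 0" "x1 \<in> C \<sigma> 1" unfolding PC by blast
      then show "v \<in> ?Q \<sigma>" unfolding QD using f FD by blast
    next
      fix v assume "v \<in> ?Q \<sigma>"
      then obtain v0 v1 where v: "v = v0 + v1" "v0 \<in> D \<sigma> 0" "v1 \<in> D \<sigma> 1" unfolding QD by blast
      obtain x0 where x0: "x0 \<in> C \<sigma> 0" "F \<sigma> 0 x0 = v0" using bijC[where i = 0 and \<sigma> = \<sigma>] v(2) unfolding bij_betw_def by (metis imageE)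
      obtain x1 where x1: "x1 \<in> C \<sigma> 1" "F \<sigma> 1 x1 = v1" using bijC[where i = 1 and \<sigma> = \<sigma>] v(3) unfolding bij_betw_def by (metis imageE)
      have "v = f \<sigma> (x0 + x1)" using f[OF x0(1) x1(1)] x0 x1 v(1) by simp
      then show "v \<in> f \<sigma> ` ?P \<sigma>" unfolding PC using x0(1) x1(1) by blast
    qed
  qed
  define T where "T \<sigma> x y z \<longleftrightarrow> f \<sigma> (br (br x y) z) = br' (br' (f \<sigma> x) (f (opp \<sigma>) y)) (f \<sigma> z)" for \<sigma> x y z
  have Th: "T \<sigma> x y z" if i: "i = 0 \<or> i = 1" "j = 0 \<or> j = 1" "k = 0 \<or> k = 1"
    and x: "x \<in> C \<sigma> i" and y: "y \<in> C (opp \<sigma>) j" and z: "z \<in> C \<sigma> k" for \<sigma> i j k x y z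
  proof -
    have b: "br (br x y) z \<in> C \<sigma> (i - j + k)"
      using x y z unfolding C_def by (rule enveloped_triple_degree[OF gL])
    have FD: "F \<sigma>' i' x' \<in> D \<sigma>' i'" if "i' = 0 \<or> i' = 1" "x' \<in> C \<sigma>' i'" for \<sigma>' i' x'
      using bijC[OF that(1), of \<sigma>'] that(2) by (auto simp: bij_betw_def)
    show ?thesis
    proof (cases "i - j + k = 0 \<or> i - j + k = 1")
      case True
      have "F \<sigma> (i - j + k) (br (br x y) z) = br' (br' (F \<sigma> i x) (F (opp \<sigma>) j y)) (F \<sigma> k z)"
        using x y z unfolding C_def by (rule tri[OF i True])
      then show ?thesis unfolding T_def fh[OF True b] fh[OF i(1) x] fh[OF i(2) y] fh[OF i(3) z] .
    next
      case False
      then have out: "(sg \<sigma>, sg \<sigma> * (i - j + k)) \<notin> bc2_roots \<union> {0}"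
        by (cases \<sigma>) (auto simp: bc2_roots_def bc2_pos_def zero_prod_def)
      have "br (br x y) z = 0" using b bc2_gradedD(4)[OF gL out] unfolding C_def by blast
      moreover have "br' (br' (F \<sigma> i x) (F (opp \<sigma>) j y)) (F \<sigma> k z) \<in> M (sg \<sigma>, sg \<sigma> * (i - j + k))"
        using FD[OF i(1) x] FD[OF i(2) y] FD[OF i(3) z] unfolding D_def by (rule enveloped_triple_degree[OF gM])
      then have "br' (br' (F \<sigma> i x) (F (opp \<sigma>) j y)) (F \<sigma> k z) = 0"
        using bc2_gradedD(4)[OF gM out] by blast
      moreover have "f \<sigma> 0 = 0" using fh[OF disjI1[OF refl] l.subspace_0[OF subC], of \<sigma>] F0[OF disjI1[OF refl], of \<sigma>] l.subspace_0[OF subC] by simp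
      ultimately show ?thesis unfolding T_def fh[OF i(1) x] fh[OF i(2) y] fh[OF i(3) z] by simp
    qed
  qed
  have TP: "T \<sigma> x y z" if x: "x \<in> ?P \<sigma>" and y: "y \<in> ?P (opp \<sigma>)" and z: "z \<in> ?P \<sigma>" for \<sigma> x y z
  proof -
    note add = lin_onD(1)[OF linf]
    note cl = enveloped_props(1)[OF gL]
    have 1: "T \<sigma> a b z" if a: "a \<in> C \<sigma> i" "i = 0 \<or> i = 1" and b: "b \<in> C (opp \<sigma>) j" "j = 0 \<or> j = 1" for a b i j
    proof -
      obtain z0 z1 where zz: "z = z0 + z1" "z0 \<in> C \<sigma> 0" "z1 \<in> C \<sigma> 1" using z unfolding PC by blast
      have P: "a \<in> ?P \<sigma>" "b \<in> ?P (opp \<sigma>)" "z0 \<in> ?P \<sigma>" "z1 \<in> ?P \<sigma>"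
        using CP[OF a(2)] CP[OF b(2)] CP[where i = 0] CP[where i = 1] a b zz by blast+
      show ?thesis
        using Th[OF a(2) b(2) _ a(1) b(1) zz(2)] Th[OF a(2) b(2) _ a(1) b(1) zz(3)]
        unfolding T_def zz(1) add[OF P(3,4)] l.br_add_right m.br_add_right
          add[OF cl[OF P(1,2,3)] cl[OF P(1,2,4)]] by simp
    qed
    have 2: "T \<sigma> a y z" if a: "a \<in> C \<sigma> i" "i = 0 \<or> i = 1" for a i
    proof -
      obtain y0 y1 where yy: "y = y0 + y1" "y0 \<in> C (opp \<sigma>) 0" "y1 \<in> C (opp \<sigma>) 1" using y unfolding PC by blast
      have P: "a \<in> ?P \<sigma>" "y0 \<in> ?P (opp \<sigma>)" "y1 \<in> ?P (opp \<sigma>)"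
        using CP[OF a(2)] CP[where i = 0] CP[where i = 1] a yy by blast+
      show ?thesis
        using 1[OF a yy(2)] 1[OF a yy(3)]
        unfolding T_def yy(1) add[OF P(2,3)] l.br_add_right m.br_add_right l.br_add_left m.br_add_left
          add[OF cl[OF P(1,2) z] cl[OF P(1,3) z]] by simp
    qed
    obtain x0 x1 where xx: "x = x0 + x1" "x0 \<in> C \<sigma> 0" "x1 \<in> C \<sigma> 1" using x unfolding PC by blast
    have P: "x0 \<in> ?P \<sigma>" "x1 \<in> ?P \<sigma>" using CP[where i = 0] CP[where i = 1] xx by blast+
    show ?thesis
      using 2[OF xx(2)] 2[OF xx(3)]
      unfolding T_def xx(1) add[OF P] l.br_add_left m.br_add_left
        add[OF cl[OF P(1) y z] cl[OF P(2) y z]] by simp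
  qed
  have comp: "f \<sigma> ` pcomp (enveloped_pair br L) \<sigma> i = pcomp (enveloped_pair br' M) \<sigma> i" for \<sigma> i
  proof (cases "i = 0 \<or> i = 1")
    case True
    have "f \<sigma> ` C \<sigma> i = F \<sigma> i ` C \<sigma> i" by (rule image_cong[OF refl]) (rule fh[OF True])
    then show ?thesis
      unfolding pcomp_enveloped[OF True] using bijC[OF True, of \<sigma>] by (simp add: C_def D_def bij_betw_def)
  next
    case False
    have "f \<sigma> 0 = 0" using fh[OF disjI1[OF refl] l.subspace_0[OF subC], of \<sigma>] F0[OF disjI1[OF refl], of \<sigma>] l.subspace_0[OF subC] by simp
    then show ?thesis using False by (simp add: enveloped_pair_def lie_pair_def)
  qed
  show ?thesis
    unfolding graded_isomorphic_def
    using sp_graded_kantor_pair_enveloped[OF gL] sp_graded_kantor_pair_enveloped[OF gM] bijf linf TP comp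
    unfolding triple_enveloped T_def by (intro conjI exI[of _ f]) auto
qed

section \<open>Products between short root spaces\<close>

definition sign_of :: "int \<times> int \<Rightarrow> sign"
  where "sign_of \<alpha> = (if 0 < fst \<alpha> then Pos else Neg)"

lemma bc2_shortE:
  assumes "\<alpha> \<in> bc2_short"
  obtains i where "i = 0 \<or> i = 1" "\<alpha> = (sg (sign_of \<alpha>), sg (sign_of \<alpha>) * i)"
proof -
  have "\<alpha> = (1, 0) \<or> \<alpha> = (- 1, 0) \<or> \<alpha> = (1, 1) \<or> \<alpha> = (- 1, - 1)"
    using assms by (simp add: bc2_short_def)
  then show thesis using that[of 0] that[of 1] by (elim disjE) (simp_all add: sign_of_def)
qed

lemma bc2_shortI: "i = 0 \<or> i = 1 \<Longrightarrow> (sg \<sigma>, sg \<sigma> * i) \<in> bc2_short"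
  by (cases \<sigma>) (auto simp: bc2_short_def)

text \<open>
  The products \<open>[[x, y], z]\<close> of elements of short root spaces with arbitrary signs are determined by
  the Kantor pair: if \<open>x\<close> and \<open>y\<close> have the same sign, the Jacobi identity gives
  \<open>[[x, y], z] = {x, z, y} - {y, z, x}\<close>.
\<close>

lemma graded_isomorphic_short:
  assumes gL: "bc2_graded s br L" and gM: "bc2_graded t br' M"
    and "graded_isomorphic s (enveloped_pair br L) t (enveloped_pair br' M)"
  obtains h where "\<And>\<alpha>. \<alpha> \<in> bc2_short \<Longrightarrow> bij_betw (h \<alpha>) (L \<alpha>) (M \<alpha>)"
    "\<And>\<alpha>. \<alpha> \<in> bc2_short \<Longrightarrow> lin_on s t (L \<alpha>) (h \<alpha>)"
    "\<And>\<alpha> \<beta> \<gamma> x y z. \<alpha> \<in> bc2_short \<Longrightarrow> \<beta> \<in> bc2_short \<Longrightarrow> \<gamma> \<in> bc2_short \<Longrightarrow> \<alpha> + \<beta> + \<gamma> \<in> bc2_short \<Longrightarrow>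
      x \<in> L \<alpha> \<Longrightarrow> y \<in> L \<beta> \<Longrightarrow> z \<in> L \<gamma> \<Longrightarrow>
      h (\<alpha> + \<beta> + \<gamma>) (br (br x y) z) = br' (br' (h \<alpha> x) (h \<beta> y)) (h \<gamma> z)"
proof -
  interpret l: lie_algebra s br by (rule bc2_gradedD(1)[OF gL])
  interpret m: lie_algebra t br' by (rule bc2_gradedD(1)[OF gM])
  let ?P = "pspace (enveloped_pair br L)"
  obtain f where bij: "\<And>\<sigma>. bij_betw (f \<sigma>) (?P \<sigma>) (pspace (enveloped_pair br' M) \<sigma>)"
    and lin: "\<And>\<sigma>. lin_on s t (?P \<sigma>) (f \<sigma>)"
    and tri: "\<And>\<sigma> x y z. x \<in> ?P \<sigma> \<Longrightarrow> y \<in> ?P (opp \<sigma>) \<Longrightarrow> z \<in> ?P \<sigma> \<Longrightarrow>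
      f \<sigma> (br (br x y) z) = br' (br' (f \<sigma> x) (f (opp \<sigma>) y)) (f \<sigma> z)"
    and comp: "\<And>\<sigma> i. f \<sigma> ` pcomp (enveloped_pair br L) \<sigma> i = pcomp (enveloped_pair br' M) \<sigma> i"
  proof -
    from assms(3) obtain f where "\<forall>\<sigma>. bij_betw (f \<sigma>) (?P \<sigma>) (pspace (enveloped_pair br' M) \<sigma>)"
      "\<forall>\<sigma>. lin_on s t (?P \<sigma>) (f \<sigma>)"
      "\<forall>\<sigma>. \<forall>x\<in>?P \<sigma>. \<forall>y\<in>?P (opp \<sigma>). \<forall>z\<in>?P \<sigma>.
        f \<sigma> (br (br x y) z) = br' (br' (f \<sigma> x) (f (opp \<sigma>) y)) (f \<sigma> z)"
      "\<forall>\<sigma> i. f \<sigma> ` pcomp (enveloped_pair br L) \<sigma> i = pcomp (enveloped_pair br' M) \<sigma> i"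
      unfolding graded_isomorphic_def triple_enveloped by (elim conjE exE)
    then show thesis by (intro that[of f]) simp_all
  qed
  have sub: "l.subspace (?P \<sigma>)" for \<sigma> by (rule enveloped_props(3)[OF gL])
  have LP: "L \<alpha> \<subseteq> ?P (sign_of \<alpha>)" if "\<alpha> \<in> bc2_short" for \<alpha>
    using that by (rule bc2_shortE) (metis enveloped_props(2)[OF gL])
  have fneg: "f \<sigma> (- x) = - f \<sigma> x" if "x \<in> ?P \<sigma>" for \<sigma> x
    using lin_onD(2)[OF lin that, where c = "- 1"] by simp
  have fdiff: "f \<sigma> (x - y) = f \<sigma> x - f \<sigma> y" if "x \<in> ?P \<sigma>" "y \<in> ?P \<sigma>" for \<sigma> x y
    using lin_onD(1)[OF lin that(1) l.subspace_neg[OF sub that(2)]] fneg[OF that(2)] by simp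
  show ?thesis
  proof (rule that[of "\<lambda>\<alpha>. f (sign_of \<alpha>)"])
    fix \<alpha> assume a: "\<alpha> \<in> bc2_short"
    obtain i where i: "i = 0 \<or> i = 1" "\<alpha> = (sg (sign_of \<alpha>), sg (sign_of \<alpha>) * i)" by (rule bc2_shortE[OF a])
    have "inj_on (f (sign_of \<alpha>)) (L \<alpha>)"
      using bij[of "sign_of \<alpha>"] LP[OF a] unfolding bij_betw_def by (blast intro: inj_on_subset)
    moreover have "f (sign_of \<alpha>) ` L \<alpha> = M \<alpha>"
      using comp[of "sign_of \<alpha>" i] by (simp only: pcomp_enveloped[OF i(1)] i(2)[symmetric])
    ultimately show "bij_betw (f (sign_of \<alpha>)) (L \<alpha>) (M \<alpha>)" by (simp add: bij_betw_def)
    show "lin_on s t (L \<alpha>) (f (sign_of \<alpha>))"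
      using lin[of "sign_of \<alpha>"] LP[OF a] unfolding lin_on_def by blast
  next
    fix \<alpha> \<beta> \<gamma> x y z
    assume s: "\<alpha> \<in> bc2_short" "\<beta> \<in> bc2_short" "\<gamma> \<in> bc2_short" and s4: "\<alpha> + \<beta> + \<gamma> \<in> bc2_short"
      and xyz: "x \<in> L \<alpha>" "y \<in> L \<beta>" "z \<in> L \<gamma>"
    have P: "x \<in> ?P (sign_of \<alpha>)" "y \<in> ?P (sign_of \<beta>)" "z \<in> ?P (sign_of \<gamma>)" using xyz LP s by blast+
    have cl: "br (br a b) c \<in> ?P \<sigma>" if "a \<in> ?P \<sigma>" "b \<in> ?P (opp \<sigma>)" "c \<in> ?P \<sigma>" for a b c \<sigma>
      by (rule enveloped_props(1)[OF gL that])
    \<comment> \<open>Short roots have first coordinate 1 or -1. Three of them add up to a short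
      root only if exactly one has the sign opposite to the sum.\<close>
    consider \<sigma> where "sign_of \<alpha> = \<sigma>" "sign_of \<beta> = opp \<sigma>" "sign_of \<gamma> = \<sigma>" "sign_of (\<alpha> + \<beta> + \<gamma>) = \<sigma>"
      | \<sigma> where "sign_of \<alpha> = opp \<sigma>" "sign_of \<beta> = \<sigma>" "sign_of \<gamma> = \<sigma>" "sign_of (\<alpha> + \<beta> + \<gamma>) = \<sigma>"
      | \<sigma> where "sign_of \<alpha> = \<sigma>" "sign_of \<beta> = \<sigma>" "sign_of \<gamma> = opp \<sigma>" "sign_of (\<alpha> + \<beta> + \<gamma>) = \<sigma>"
    proof -
      have fst1: "fst \<delta> = 1 \<or> fst \<delta> = - 1" if "\<delta> \<in> bc2_short" for \<delta>
        using that by (auto simp: bc2_short_def)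
      have "(sign_of \<alpha> = sign_of (\<alpha> + \<beta> + \<gamma>) \<and> sign_of \<beta> = opp (sign_of (\<alpha> + \<beta> + \<gamma>)) \<and> sign_of \<gamma> = sign_of (\<alpha> + \<beta> + \<gamma>)) \<or>
        (sign_of \<alpha> = opp (sign_of (\<alpha> + \<beta> + \<gamma>)) \<and> sign_of \<beta> = sign_of (\<alpha> + \<beta> + \<gamma>) \<and> sign_of \<gamma> = sign_of (\<alpha> + \<beta> + \<gamma>)) \<or>
        (sign_of \<alpha> = sign_of (\<alpha> + \<beta> + \<gamma>) \<and> sign_of \<beta> = sign_of (\<alpha> + \<beta> + \<gamma>) \<and> sign_of \<gamma> = opp (sign_of (\<alpha> + \<beta> + \<gamma>)))"
        using fst1[OF s(1)] fst1[OF s(2)] fst1[OF s(3)] fst1[OF s4] by (auto simp: sign_of_def)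
      then show thesis using that by blast
    qed
    then show "f (sign_of (\<alpha> + \<beta> + \<gamma>)) (br (br x y) z) =
      br' (br' (f (sign_of \<alpha>) x) (f (sign_of \<beta>) y)) (f (sign_of \<gamma>) z)"
    proof cases
      case 1
      then show ?thesis using tri P by simp
    next
      case (2 \<sigma>)
      have p: "x \<in> ?P (opp \<sigma>)" "y \<in> ?P \<sigma>" "z \<in> ?P \<sigma>" using P 2 by simp_all
      have "br (br x y) z = - br (br y x) z" using l.br_swap[of x y] l.br_minus by simp
      then have "f \<sigma> (br (br x y) z) = - br' (br' (f \<sigma> y) (f (opp \<sigma>) x)) (f \<sigma> z)"
        using fneg[OF cl[OF p(2,1,3)]] tri[OF p(2,1,3)] by simp
      also have "\<dots> = br' (br' (f (opp \<sigma>) x) (f \<sigma> y)) (f \<sigma> z)"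
        using m.br_swap[of "f (opp \<sigma>) x" "f \<sigma> y"] m.br_minus by simp
      finally show ?thesis using 2 by simp
    next
      case (3 \<sigma>)
      have p: "x \<in> ?P \<sigma>" "y \<in> ?P \<sigma>" "z \<in> ?P (opp \<sigma>)" using P 3 by simp_all
      have "br (br x y) z = br (br x z) y - br (br y z) x"
        by (simp add: l.br_br[of x y z] l.br_swap[of y "br x z"] l.br_swap[of x "br y z"])
      then have "f \<sigma> (br (br x y) z) =
          br' (br' (f \<sigma> x) (f (opp \<sigma>) z)) (f \<sigma> y) - br' (br' (f \<sigma> y) (f (opp \<sigma>) z)) (f \<sigma> x)"
        using fdiff[OF cl[OF p(1,3,2)] cl[OF p(2,3,1)]] tri[OF p(1,3,2)] tri[OF p(2,3,1)] by simp
      also have "\<dots> = br' (br' (f \<sigma> x) (f \<sigma> y)) (f (opp \<sigma>) z)"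
        by (simp add: m.br_br[of "f \<sigma> x" "f \<sigma> y"] m.br_swap[of "f \<sigma> y" "br' (f \<sigma> x) (f (opp \<sigma>) z)"]
            m.br_swap[of "f \<sigma> x" "br' (f \<sigma> y) (f (opp \<sigma>) z)"])
      finally show ?thesis using 3 by simp
    qed
  qed
qed

text \<open>Reindexing homogeneous decompositions along a bijection: with the inverse of u it gives
  existence, and with u it carries any competitor back to the unique decomposition for
  \<open>L\<close>.\<close>

lemma weyl_twist_graded:
  fixes L :: "int \<times> int \<Rightarrow> 'l::ab_group_add set"
  assumes g: "bc2_graded s br L" and u: "bc2_automorphism u"
  shows "bc2_graded s br (weyl_twist u L)"
proof -
  note i = bc2_automorphism_inv[OF u]
  define P where "P L x c \<longleftrightarrow> (\<forall>\<alpha>. c \<alpha> \<in> L \<alpha>) \<and> finite {\<alpha>. c \<alpha> \<noteq> 0} \<and> x = (\<Sum>\<alpha> | c \<alpha> \<noteq> 0. c \<alpha>)"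
    for L :: "int \<times> int \<Rightarrow> 'l set" and x c
  have tr: "P (\<lambda>\<alpha>. L (v \<alpha>)) x (\<lambda>\<alpha>. c (v \<alpha>))" if P: "P L x c" and v: "bij v" for v L x c
  proof -
    have bb: "bij_betw v {\<alpha>. c (v \<alpha>) \<noteq> 0} {\<alpha>. c \<alpha> \<noteq> 0}"
      by (rule bij_betw_byWitness[where f' = "inv v"])
        (auto simp: bij_is_inj[OF v] surj_f_inv_f[OF bij_is_surj[OF v]])
    show ?thesis
      unfolding P_def
    proof (intro conjI)
      show "\<forall>\<alpha>. c (v \<alpha>) \<in> L (v \<alpha>)" using P unfolding P_def by blast
      show "finite {\<alpha>. c (v \<alpha>) \<noteq> 0}" using P bij_betw_finite[OF bb] unfolding P_def by blast
      show "x = (\<Sum>\<alpha> | c (v \<alpha>) \<noteq> 0. c (v \<alpha>))"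
        unfolding sum.reindex_bij_betw[OF bb, of c] using P unfolding P_def by (elim conjE)
    qed
  qed
  have "\<exists>!c. P (weyl_twist u L) x c" for x
  proof -
    have ex: "\<exists>!c. P L x c" using g unfolding bc2_graded_def P_def by (elim conjE) (erule spec)
    then obtain c where c: "P L x c" by (rule ex1E)
    show ?thesis
    proof (rule ex1I)
      show "P (weyl_twist u L) x (\<lambda>\<alpha>. c (inv u \<alpha>))"
        unfolding weyl_twist_def by (rule tr[OF c bc2_automorphismD(1)[OF i(1)]])
      fix d assume d: "P (weyl_twist u L) x d"
      have "(\<lambda>\<alpha>. weyl_twist u L (u \<alpha>)) = L" by (simp add: weyl_twist_def i(3))
      with tr[OF d bc2_automorphismD(1)[OF u]] have "P L x (\<lambda>\<alpha>. d (u \<alpha>))" by (simp only:)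
      from ex1_eq[of "P L x", OF ex this c] have "d (u (inv u \<alpha>)) = c (inv u \<alpha>)" for \<alpha> by (rule fun_cong)
      then show "d = (\<lambda>\<alpha>. c (inv u \<alpha>))" unfolding i(2) by (rule ext)
    qed
  qed
  moreover have "br x y \<in> weyl_twist u L (\<alpha> + \<beta>)" if "x \<in> weyl_twist u L \<alpha>" "y \<in> weyl_twist u L \<beta>" for x y \<alpha> \<beta>
    using bc2_gradedD(3)[OF g] that bc2_automorphismD(2)[OF i(1)] by (simp add: weyl_twist_def)
  moreover have "weyl_twist u L \<alpha> = {0}" if a: "\<alpha> \<notin> bc2_roots \<union> {0}" for \<alpha>
  proof -
    have "inv u \<alpha> \<noteq> 0" using a i(2)[of \<alpha>] bc2_automorphism_0[OF u] by auto
    then show ?thesis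
      unfolding weyl_twist_def by (intro bc2_gradedD(4)[OF g]) (use a bc2_automorphismD(3)[OF i(1)] in blast)
  qed
  ultimately show ?thesis
    unfolding bc2_graded_def P_def
    using bc2_gradedD(1)[OF g] bc2_gradedD(2)[OF g] by (simp add: weyl_twist_def)
qed

section \<open>The grading of the Lie algebra by a pair of subsets\<close>

context based_lie_algebra
begin

text \<open>Indexed by \<open>weights\<close> and not only by roots, so that \<open>H\<close>, the
  space of weight 0, is part of degree 0.\<close>

definition root_grading :: "('g \<Rightarrow> 'k) set \<times> ('g \<Rightarrow> 'k) set \<Rightarrow> int \<times> int \<Rightarrow> 'g set"
  where "root_grading ST \<alpha> = span (\<Union>l\<in>{l \<in> weights. X2 ST l = \<alpha>}. wsp l)"

lemma wcomp_span_zero: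
  assumes "J \<subseteq> weights" "y \<in> span (\<Union>l\<in>J. wsp l)" "m \<notin> J"
  shows "wcomp y m = 0"
  using assms(2)
proof (induction rule: span_induct)
  case base
  have "wcomp 0 m = 0" using wcomp_scale[of 0 0] by simp
  then show ?case by (intro subspaceI) (auto simp: wcomp_add wcomp_scale)
next
  case (step a)
  then obtain l where "l \<in> J" "a \<in> wsp l" by blast
  then show ?case using assms(1,3) wcomp_wsp[of l a] by auto
qed

lemma chi2_zero:
  assumes "ST \<in> SPA s br H \<Pi>"
  shows "X2 ST 0 = 0"
  using assms chi_props(1)[THEN rs.additive_zero] by (simp add: chi2_def SPA_def zero_prod_def)

lemma chi2_add:
  assumes "ST \<in> SPA s br H \<Pi>" "\<mu> \<in> rs.Q" "\<nu> \<in> rs.Q"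
  shows "X2 ST (\<mu> + \<nu>) = X2 ST \<mu> + X2 ST \<nu>"
proof -
  have "fst ST \<subseteq> \<Pi>" "snd ST \<subseteq> \<Pi>" using assms(1) by (simp_all add: SPA_def)
  then show ?thesis using chi_props(1) assms(2,3) by (simp add: chi2_def rs.additive_on_Q_def)
qed

lemma root_grading_graded:
  assumes ST: "ST \<in> SPA s br H \<Pi>"
  shows "bc2_graded s br (root_grading ST)"
proof -
  let ?W = "\<lambda>\<alpha>. {l \<in> weights. X2 ST l = \<alpha>}"
  have sub: "?W \<alpha> \<subseteq> weights" for \<alpha> by blast
  have dec: "\<exists>!c. (\<forall>\<alpha>. c \<alpha> \<in> root_grading ST \<alpha>) \<and> finite {\<alpha>. c \<alpha> \<noteq> 0} \<and> x = (\<Sum>\<alpha> | c \<alpha> \<noteq> 0. c \<alpha>)" for x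
  proof (rule ex1I)
    let ?c = "\<lambda>\<alpha>. \<Sum>l\<in>?W \<alpha>. wcomp x l"
    have supp: "{\<alpha>. ?c \<alpha> \<noteq> 0} \<subseteq> X2 ST ` weights"
    proof
      fix \<alpha> assume "\<alpha> \<in> {\<alpha>. ?c \<alpha> \<noteq> 0}"
      then have "?W \<alpha> \<noteq> {}" by (metis (mono_tags, lifting) mem_Collect_eq sum.empty)
      then show "\<alpha> \<in> X2 ST ` weights" by blast
    qed
    have "x = (\<Sum>l\<in>weights. wcomp x l)" by (rule wcomp(3)[symmetric])
    also have "\<dots> = (\<Sum>\<alpha>\<in>X2 ST ` weights. ?c \<alpha>)" by (rule sum.image_gen[OF weights_finite])
    also have "\<dots> = (\<Sum>\<alpha> | ?c \<alpha> \<noteq> 0. ?c \<alpha>)"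
      by (rule sum.mono_neutral_right) (use supp weights_finite in auto)
    finally have "x = (\<Sum>\<alpha> | ?c \<alpha> \<noteq> 0. ?c \<alpha>)" .
    moreover have "finite {\<alpha>. ?c \<alpha> \<noteq> 0}" by (rule finite_subset[OF supp]) (simp add: weights_finite)
    moreover have "?c \<alpha> \<in> root_grading ST \<alpha>" for \<alpha>
      unfolding root_grading_def by (intro span_sum span_base) (auto intro: wcomp(1))
    ultimately show "(\<forall>\<alpha>. ?c \<alpha> \<in> root_grading ST \<alpha>) \<and> finite {\<alpha>. ?c \<alpha> \<noteq> 0} \<and> x = (\<Sum>\<alpha> | ?c \<alpha> \<noteq> 0. ?c \<alpha>)"
      by blast
    fix c assume c: "(\<forall>\<alpha>. c \<alpha> \<in> root_grading ST \<alpha>) \<and> finite {\<alpha>. c \<alpha> \<noteq> 0} \<and> x = (\<Sum>\<alpha> | c \<alpha> \<noteq> 0. c \<alpha>)"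
    have z: "wcomp (c \<alpha>) l = 0" if "l \<notin> ?W \<alpha>" for \<alpha> l
      by (rule wcomp_span_zero[OF sub _ that]) (use c in \<open>unfold root_grading_def, blast\<close>)
    have w0: "wcomp 0 l = 0" for l using wcomp_scale[of 0 0] by simp
    have wsum: "wcomp (\<Sum>\<alpha>\<in>A. c \<alpha>) l = (\<Sum>\<alpha>\<in>A. wcomp (c \<alpha>) l)" for A l
      by (induction A rule: infinite_finite_induct) (simp_all add: w0 wcomp_add)
    \<comment> \<open>A weight occurs in a single degree, so the weight components of
      \<open>x\<close> determine every \<open>c \<alpha>\<close>.\<close>
    have wx: "wcomp x l = wcomp (c (X2 ST l)) l" for l
    proof -
      have "wcomp x l = (\<Sum>\<alpha> | c \<alpha> \<noteq> 0. wcomp (c \<alpha>) l)" using wsum c by metis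
      also have "\<dots> = (\<Sum>\<alpha> | c \<alpha> \<noteq> 0. if \<alpha> = X2 ST l then wcomp (c (X2 ST l)) l else 0)"
        by (rule sum.cong) (use z in auto)
      also have "\<dots> = wcomp (c (X2 ST l)) l" using c w0 by (cases "c (X2 ST l) = 0") (auto simp: sum.delta)
      finally show ?thesis .
    qed
    show "c = ?c"
    proof
      fix \<alpha>
      have "c \<alpha> = (\<Sum>l\<in>weights. wcomp (c \<alpha>) l)" by (rule wcomp(3)[symmetric])
      also have "\<dots> = (\<Sum>l\<in>?W \<alpha>. wcomp (c \<alpha>) l)"
        by (rule sum.mono_neutral_right[OF weights_finite]) (use z in auto)
      also have "\<dots> = ?c \<alpha>" by (rule sum.cong) (use wx in auto)
      finally show "c \<alpha> = ?c \<alpha>" .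
    qed
  qed
  have brg: "br x y \<in> root_grading ST (\<alpha> + \<beta>)" if "x \<in> root_grading ST \<alpha>" "y \<in> root_grading ST \<beta>" for x y \<alpha> \<beta>
  proof -
    have "br a b \<in> root_grading ST (\<alpha> + \<beta>)" if a: "a \<in> (\<Union>l\<in>?W \<alpha>. wsp l)" and b: "b \<in> (\<Union>l\<in>?W \<beta>. wsp l)" for a b
    proof -
      obtain l m where l: "l \<in> weights" "X2 ST l = \<alpha>" "a \<in> wsp l" and m: "m \<in> weights" "X2 ST m = \<beta>" "b \<in> wsp m"
        using a b by blast
      have ab: "br a b \<in> wsp (l + m)" by (rule wsp_br[OF l(3) m(3)])
      show ?thesis
      proof (cases "l + m \<in> weights")
        case True
        have "X2 ST (l + m) = \<alpha> + \<beta>" using chi2_add[OF ST weights_Q[OF l(1)] weights_Q[OF m(1)]] l m by simp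
        then show ?thesis unfolding root_grading_def using True ab by (intro span_base) blast
      next
        case False
        have "(l + m) x = 0" if "x \<notin> H" for x
          using weights_outside[OF l(1) that] weights_outside[OF m(1) that] by simp
        then have "br a b = 0" using wsp_nonweight[of "l + m"] False ab by blast
        then show ?thesis unfolding root_grading_def by (simp add: span_zero)
      qed
    qed
    from br_span2[OF _ this that[unfolded root_grading_def]]
    show ?thesis by (simp add: root_grading_def)
  qed
  have out: "root_grading ST \<alpha> = {0}" if a: "\<alpha> \<notin> bc2_roots \<union> {0}" for \<alpha>
  proof -
    have "X2 ST l \<in> bc2_roots \<union> {0}" if "l \<in> weights" for l
      using that weights_eq chi2_zero[OF ST] root_lattice_value[OF ST] by auto
    then have "?W \<alpha> = {}" using a by blast
    then show ?thesis unfolding root_grading_def by (simp only: UN_empty span_empty)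
  qed
  show ?thesis
    unfolding bc2_graded_def
  proof (intro conjI)
    show "lie_algebra s br" by (rule lie_algebra_axioms)
    show "\<forall>\<alpha>. subspace (root_grading ST \<alpha>)" by (simp add: root_grading_def)
    show "\<forall>x. \<exists>!c. (\<forall>\<alpha>. c \<alpha> \<in> root_grading ST \<alpha>) \<and> finite {\<alpha>. c \<alpha> \<noteq> 0} \<and> x = (\<Sum>\<alpha> | c \<alpha> \<noteq> 0. c \<alpha>)"
      by (rule allI) (rule dec)
    show "\<forall>\<alpha> \<beta>. \<forall>x\<in>root_grading ST \<alpha>. \<forall>y\<in>root_grading ST \<beta>. br x y \<in> root_grading ST (\<alpha> + \<beta>)"
      by (intro allI ballI brg)
    show "\<forall>\<alpha>. \<alpha> \<notin> bc2_roots \<union> {0} \<longrightarrow> root_grading ST \<alpha> = {0}" by (intro allI impI out)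
  qed
qed

text \<open>The degrees involved have first coordinate 1 or -1, so weight 0 does not contribute and
  roots give the same spans as weights.\<close>

lemma root_pair_enveloped:
  assumes ST: "ST \<in> SPA s br H \<Pi>"
  shows "root_pair s br H \<Pi> ST = enveloped_pair br (root_grading ST)"
proof -
  have "span (\<Union>\<mu>\<in>{\<mu> \<in> R. X2 ST \<mu> = (sg \<sigma>, n)}. root_space s br H \<mu>) = root_grading ST (sg \<sigma>, n)" for \<sigma> n
  proof -
    have "sg \<sigma> \<noteq> 0" by (cases \<sigma>) auto
    then have "{\<mu> \<in> R. X2 ST \<mu> = (sg \<sigma>, n)} = {l \<in> weights. X2 ST l = (sg \<sigma>, n)}"
      using weights_eq chi2_zero[OF ST] by (auto simp: zero_prod_def)
    then show ?thesis unfolding root_grading_def by (simp add: root_space_wsp)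
  qed
  then show ?thesis
    unfolding root_pair_def enveloped_pair_def by (intro lie_pair_cong) simp_all
qed

section \<open>Transport by Weyl group automorphisms\<close>

lemma weyl_act_automorphism:
  assumes ST: "ST \<in> SPA s br H \<Pi>" and u: "bc2_automorphism u"
  shows "\<exists>f. automorphism f \<and>
    (\<forall>\<alpha>. f ` root_grading (weyl_act s br H \<Pi> u ST) \<alpha> = root_grading ST (inv u \<alpha>))"
proof -
  note i = bc2_automorphism_inv[OF u]
  let ?ST = "weyl_act s br H \<Pi> u ST"
  obtain ws where ws: "set ws \<subseteq> \<Pi>" "\<And>\<mu>. \<mu> \<in> rs.Q \<Longrightarrow> X2 ?ST \<mu> = u (X2 ST (rs.act ws \<mu>))"
    using weyl_act_spec(2)[OF ST u] by blast
  have wR: "set ws \<subseteq> R" using ws(1) rs.base_R by blast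
  obtain f where f: "automorphism f" "\<And>l. l \<in> weights \<Longrightarrow> f ` wsp l = wsp (rs.act ws l)"
    using word_automorphism[OF wR] by blast
  interpret f: Vector_Spaces.linear s s f using f(1) by (simp add: automorphism_def)
  have act0: "rs.act vs 0 = 0" if "set vs \<subseteq> R" for vs
    using rs.act_add[OF that rs.span_zero rs.span_zero] by simp
  have actw: "rs.act vs l \<in> weights" if "set vs \<subseteq> R" "l \<in> weights" for vs l
    using that(2) act0[OF that(1)] rs.act_R[OF that(1)] unfolding weights_eq by auto
  have "f ` root_grading ?ST \<alpha> = root_grading ST (inv u \<alpha>)" for \<alpha>
  proof -
    have "rs.act ws ` {l \<in> weights. X2 ?ST l = \<alpha>} = {l \<in> weights. X2 ST l = inv u \<alpha>}"
    proof (intro equalityI subsetI)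
      fix m assume "m \<in> rs.act ws ` {l \<in> weights. X2 ?ST l = \<alpha>}"
      then obtain l where l: "l \<in> weights" "X2 ?ST l = \<alpha>" "m = rs.act ws l" by blast
      then show "m \<in> {l \<in> weights. X2 ST l = inv u \<alpha>}"
        using actw[OF wR l(1)] ws(2)[OF weights_Q[OF l(1)]] by (auto simp: i(3))
    next
      fix m assume "m \<in> {l \<in> weights. X2 ST l = inv u \<alpha>}"
      then have m: "m \<in> weights" "X2 ST m = inv u \<alpha>" by blast+
      let ?l = "rs.act (rev ws) m"
      have l: "?l \<in> weights" by (rule actw) (use wR m in auto)
      have e: "rs.act ws ?l = m" by (rule act_rev_right[OF wR weights_Q[OF m(1)]])
      have "X2 ?ST ?l = \<alpha>" using ws(2)[OF weights_Q[OF l]] e m(2) i(2) by simp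
      then show "m \<in> rs.act ws ` {l \<in> weights. X2 ?ST l = \<alpha>}" using l e by (intro image_eqI[of _ _ ?l]) auto
    qed
    moreover have "f ` (\<Union>l\<in>{l \<in> weights. X2 ?ST l = \<alpha>}. wsp l) = (\<Union>m\<in>rs.act ws ` {l \<in> weights. X2 ?ST l = \<alpha>}. wsp m)"
      unfolding image_UN using f(2) by simp
    ultimately show ?thesis unfolding root_grading_def f.span_image[symmetric] by simp
  qed
  then show ?thesis using f(1) by blast
qed

text \<open>The map on degree \<alpha> first goes by \<open>h\<close> from the component of
  \<open>L\<close> at the inverse image of \<alpha> under u to the same degree of the
  \<chi>-grading, then by the inverse of the automorphism \<open>f\<close> to degree \<alpha> of the
  \<chi>'-grading.\<close>

lemma weyl_image_isomorphic:
  assumes ST: "ST \<in> SPA s br H \<Pi>" and u: "bc2_automorphism u"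
    and L: "envelops sL brL L s (root_pair s br H \<Pi> ST)"
  shows "graded_isomorphic sL (enveloped_pair brL (weyl_twist u L)) s
    (root_pair s br H \<Pi> (weyl_act s br H \<Pi> u ST))"
proof -
  let ?ST = "weyl_act s br H \<Pi> u ST"
  note ST' = weyl_act_spec(1)[OF ST u]
  note i = bc2_automorphism_inv[OF u]
  let ?M = "root_grading ST" and ?M' = "root_grading ?ST"
  have gL: "bc2_graded sL brL L"
    and iso: "graded_isomorphic sL (enveloped_pair brL L) s (enveloped_pair br ?M)"
    using L unfolding envelops_def root_pair_enveloped[OF ST] by blast+
  obtain h where bij: "\<And>\<alpha>. \<alpha> \<in> bc2_short \<Longrightarrow> bij_betw (h \<alpha>) (L \<alpha>) (?M \<alpha>)"
    and lin: "\<And>\<alpha>. \<alpha> \<in> bc2_short \<Longrightarrow> lin_on sL s (L \<alpha>) (h \<alpha>)"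
    and tri: "\<And>\<alpha> \<beta> \<gamma> x y z. \<alpha> \<in> bc2_short \<Longrightarrow> \<beta> \<in> bc2_short \<Longrightarrow> \<gamma> \<in> bc2_short \<Longrightarrow> \<alpha> + \<beta> + \<gamma> \<in> bc2_short \<Longrightarrow>
      x \<in> L \<alpha> \<Longrightarrow> y \<in> L \<beta> \<Longrightarrow> z \<in> L \<gamma> \<Longrightarrow>
      h (\<alpha> + \<beta> + \<gamma>) (brL (brL x y) z) = br (br (h \<alpha> x) (h \<beta> y)) (h \<gamma> z)"
    using graded_isomorphic_short[OF gL root_grading_graded[OF ST] iso] by metis
  obtain f where f: "automorphism f" and fM: "\<And>\<alpha>. f ` ?M' \<alpha> = ?M (inv u \<alpha>)"
    using weyl_act_automorphism[OF ST u] by blast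
  have fb: "bij f" and fl: "endo f" and fh: "\<And>x y. f (br x y) = br (f x) (f y)"
    using f by (auto simp: automorphism_def)
  interpret f: Vector_Spaces.linear s s f by (rule fl)
  define g where "g = inv f"
  have fg: "f (g x) = x" and gf: "g (f x) = x" for x
    using fb by (simp_all add: g_def bij_is_surj surj_f_inv_f bij_is_inj)
  have g: "g (x + y) = g x + g y" "g (c *s x) = c *s g x" "g (br x y) = br (g x) (g y)" for x y c
    by (metis fg gf f.add, metis fg gf f.scale, metis fg gf fh)
  have gM: "bij_betw g (?M (inv u \<alpha>)) (?M' \<alpha>)" for \<alpha>
    unfolding fM[symmetric] by (rule bij_betw_byWitness[where f' = f]) (auto simp: fg gf)
  \<comment> \<open>The inverse of u may flip signs, so products of the \<open>u\<close>-image
    become products in \<open>L\<close> with mixed signs; this is why \<open>tri\<close> is needed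
    for arbitrary short degrees.\<close>
  define d where "d \<sigma> k = inv u (sg \<sigma>, sg \<sigma> * k)" for \<sigma> k
  have ds: "d \<sigma> k \<in> bc2_short" if "k = 0 \<or> k = 1" for \<sigma> k
    unfolding d_def bc2_automorphismD(4)[OF i(1)] by (rule bc2_shortI[OF that])
  have dd: "d \<sigma> a + d (opp \<sigma>) b + d \<sigma> c = d \<sigma> (a - b + c)" for \<sigma> a b c
    unfolding d_def bc2_automorphismD(2)[OF i(1), symmetric] by (simp add: algebra_simps)
  have tw: "weyl_twist u L (sg \<sigma>, sg \<sigma> * k) = L (d \<sigma> k)" for \<sigma> k by (simp add: weyl_twist_def d_def)
  have bijF: "bij_betw (\<lambda>x. g (h (d \<sigma> k) x)) (L (d \<sigma> k)) (?M' (sg \<sigma>, sg \<sigma> * k))"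
    and linF: "lin_on sL s (L (d \<sigma> k)) (\<lambda>x. g (h (d \<sigma> k) x))"
    if k: "k = 0 \<or> k = 1" for \<sigma> k
  proof -
    have "bij_betw (g \<circ> h (d \<sigma> k)) (L (d \<sigma> k)) (?M' (sg \<sigma>, sg \<sigma> * k))"
      by (rule bij_betw_trans[OF bij[OF ds[OF k]]]) (unfold d_def, rule gM)
    then show "bij_betw (\<lambda>x. g (h (d \<sigma> k) x)) (L (d \<sigma> k)) (?M' (sg \<sigma>, sg \<sigma> * k))"
      unfolding o_def .
    show "lin_on sL s (L (d \<sigma> k)) (\<lambda>x. g (h (d \<sigma> k) x))"
      unfolding lin_on_def
      using lin_onD[OF lin[OF ds[OF k]]] g(1,2) by simp
  qed
  have triF: "g (h (d \<sigma> (a - b + c)) (brL (brL x y) z)) =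
        br (br (g (h (d \<sigma> a) x)) (g (h (d (opp \<sigma>) b) y))) (g (h (d \<sigma> c) z))"
    if abc: "a = 0 \<or> a = 1" "b = 0 \<or> b = 1" "c = 0 \<or> c = 1" "a - b + c = 0 \<or> a - b + c = 1"
      and xyz: "x \<in> L (d \<sigma> a)" "y \<in> L (d (opp \<sigma>) b)" "z \<in> L (d \<sigma> c)" for \<sigma> a b c x y z
  proof -
    have "d \<sigma> a + d (opp \<sigma>) b + d \<sigma> c \<in> bc2_short" unfolding dd by (rule ds[OF abc(4)])
    from tri[OF ds[OF abc(1)] ds[OF abc(2)] ds[OF abc(3)] this xyz]
    show ?thesis unfolding dd g(3)[symmetric] by (rule arg_cong)
  qed
  show ?thesis
    unfolding root_pair_enveloped[OF ST']
    by (rule graded_isomorphic_homogeneous[OF weyl_twist_graded[OF gL u] root_grading_graded[OF ST'],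
          where F = "\<lambda>\<sigma> k x. g (h (d \<sigma> k) x)"], unfold tw) (rule bijF linF triF; assumption)+
qed

end

theorem theorem8p3p1:
  fixes s :: "'k::{alg_closed_field,field_char_0} \<Rightarrow> 'g::ab_group_add \<Rightarrow> 'g"
    and br :: "'g \<Rightarrow> 'g \<Rightarrow> 'g"
    and H :: "'g set"
    and \<Pi> S T :: "('g \<Rightarrow> 'k) set"
    and u :: "int \<times> int \<Rightarrow> int \<times> int"
    and sL :: "'k \<Rightarrow> 'l::ab_group_add \<Rightarrow> 'l"
    and brL :: "'l \<Rightarrow> 'l \<Rightarrow> 'l"
    and L :: "int \<times> int \<Rightarrow> 'l set"
  assumes "fd_simple_lie_algebra s br"
    and "cartan_subalgebra s br H"
    and "root_base s br H \<Pi>"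
    and "(S, T) \<in> SPA s br H \<Pi>"
    and "u \<in> bc2_weyl"
    and "envelops sL brL L s (root_pair s br H \<Pi> (S, T))"
  shows "graded_isomorphic sL (enveloped_pair brL (weyl_twist u L))
           s (root_pair s br H \<Pi> (weyl_act s br H \<Pi> u (S, T)))"
proof -
  note G = assms(1)[unfolded fd_simple_lie_algebra_def]
  interpret g: lie_algebra s br using G by blast
  obtain B0 where B0: "finite B0" "g.span B0 = UNIV" using G by blast
  obtain B where B: "B \<subseteq> B0" "g.independent B" "B0 \<subseteq> g.span B"
    using g.maximal_independent_subset[of B0] by metis
  have "g.span B = UNIV" using g.span_minimal[OF B(3) g.subspace_span] B0(2) by blast
  then interpret finite_dimensional_vector_space s B
    using B finite_subset[OF B(1) B0(1)] by unfold_locales auto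
  interpret based_lie_algebra s br B H \<Pi>
    using G assms(2,3) by unfold_locales blast+
  show ?thesis
    by (rule weyl_image_isomorphic[OF assms(4) bc2_weyl_automorphism[OF assms(5)] assms(6)])
qed

end
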